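(* Let $\Bbbk$ be a field and let $R$ be the skew polynomial ring $\Bbbk_{p_{ij}}[x_1,\dots,x_n]$ for $n\geq 2$ and $p_{ij}\in\Bbbk^{\times}$ ($1\le i<j\le n$) being generic. Let $G$ be a finite group of algebra automorphisms of $R$. Then $G$ acts on the finite dimensional $\Bbbk$-space $V:=\bigoplus_{s=1}^n\Bbbk x_s$ and the following are equivalent. (1) $G\subseteq\mathrm{GL}(V)$ is small. (2) The $G$-action on $R$ is homologically small. (3) There is a natural isomorphism of graded algebras $R\ast G\cong\operatorname{End}_{R^G}(R)$.
   Context: $\Bbbk^{\times}$ is the set of units of $\Bbbk$. $\Bbbk_{p_{ij}}[x_1,\dots,x_n]$ is the $\Bbbk$-algebra generated by $x_1,\dots,x_n$ subject to $x_jx_i=p_{ij}x_ix_j$ for all $i<j$, graded with $\deg x_i=1$. The word "generic" is used without a more specific condition; its role is to ensure that every algebra automorphism $\phi$ of $R$ is diagonal, i.e. $\phi(x_i)=a_ix_i$ for some $a_i\in\Bbbk^{\times}$ (a result of Alev and Chamarie). A pseudo-reflection of a finite dimensional vector space $V$ is a non-identity element of $\mathrm{GL}(V)$ of finite order fixing a hyperplane of $V$ pointwise. A finite subgroup of $\mathrm{GL}(V)$ is small if it contains no pseudo-reflection. $R\ast G$ is the skew group algebra and $R^G$ is the fixed subring. Homological smallness is defined for actions of semisimple Hopf algebras, so here the group algebra $\Bbbk G$ is understood to be semisimple (i.e. $|G|$ is invertible in $\Bbbk$). Let $I$ be the two-sided ideal of $R\ast G$ generated by the idempotent $\frac1{|G|}\sum_{g\in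 G}g$. The grade of a right $R$-module $M$ is $j(M)=\min\{i:\operatorname{Ext}^i_R(M,R)\ne0\}$ ($=\infty$ if all these Ext groups vanish). The $G$-action is homologically small if $j((R\ast G)/I)\ge2$, with $(R\ast G)/I$ viewed as a right $R$-module. In (3), $R$ is a right $R^G$-module by multiplication, and the statement means that the natural algebra map $R\ast G\to\operatorname{End}_{R^G}(R)$, $r\ast g\mapsto(x\mapsto r\,g(x))$, is an isomorphism. *)

theory Defs
  imports "HOL-Library.Poly_Mapping" "HOL-Library.Extended_Nat" "HOL-Algebra.Algebra"
begin

section \<open>Skew polynomial rings\<close>

text \<open>
  Words form the free monoid. With its monoid structure written additively, the convolution
  product of \<open>Poly_Mapping\<close> makes \<open>fword \<Rightarrow>\<^sub>0 'k\<close> the free (noncommutative) algebra over \<open>'k\<close>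
  on the generators \<open>Word [i]\<close>.
\<close>

datatype fword = Word (letters: "nat list")

instantiation fword :: monoid_add
begin

definition zero_fword :: fword where
  "zero_fword = Word []"

definition plus_fword :: "fword \<Rightarrow> fword \<Rightarrow> fword" where
  "plus_fword u v = Word (letters u @ letters v)"

instance
  by standard (simp_all add: zero_fword_def plus_fword_def)

end

definition free_alg :: "nat \<Rightarrow> (fword \<Rightarrow>\<^sub>0 'k::field) ring" where
  "free_alg n = \<lparr>carrier = {f. \<forall>w \<in> Poly_Mapping.keys f. set (letters w) \<subseteq> {1..n}},
     monoid.mult = (*), one = 1, ring.zero = 0, add = (+)\<rparr>"

definition free_const :: "'k::field \<Rightarrow> (fword \<Rightarrow>\<^sub>0 'k)" where
  "free_const c = Poly_Mapping.single (Word []) c"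

definition free_var :: "nat \<Rightarrow> (fword \<Rightarrow>\<^sub>0 'k::field)" where
  "free_var i = Poly_Mapping.single (Word [i]) 1"

definition sp_ideal :: "nat \<Rightarrow> (nat \<Rightarrow> nat \<Rightarrow> 'k::field) \<Rightarrow> (fword \<Rightarrow>\<^sub>0 'k) set" where
  "sp_ideal n p = Idl\<^bsub>free_alg n\<^esub>
     {free_var j * free_var i - free_const (p i j) * free_var i * free_var j | i j.
        1 \<le> i \<and> i < j \<and> j \<le> n}"

definition sp_ring :: "nat \<Rightarrow> (nat \<Rightarrow> nat \<Rightarrow> 'k::field) \<Rightarrow> (fword \<Rightarrow>\<^sub>0 'k) set ring" where
  "sp_ring n p = free_alg n Quot sp_ideal n p"

definition sp_class :: "nat \<Rightarrow> (nat \<Rightarrow> nat \<Rightarrow> 'k::field) \<Rightarrow> (fword \<Rightarrow>\<^sub>0 'k) \<Rightarrow> (fword \<Rightarrow>\<^sub>0 'k) set" where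
  "sp_class n p f = sp_ideal n p +>\<^bsub>free_alg n\<^esub> f"

text \<open>The \<open>'k\<close>-algebra structure of \<open>sp_ring n p\<close> is the central ring homomorphism \<open>sp_const n p\<close>.\<close>

definition sp_const :: "nat \<Rightarrow> (nat \<Rightarrow> nat \<Rightarrow> 'k::field) \<Rightarrow> 'k \<Rightarrow> (fword \<Rightarrow>\<^sub>0 'k) set" where
  "sp_const n p c = sp_class n p (free_const c)"

definition sp_scalars :: "nat \<Rightarrow> (nat \<Rightarrow> nat \<Rightarrow> 'k::field) \<Rightarrow> (fword \<Rightarrow>\<^sub>0 'k) set set" where
  "sp_scalars n p = range (sp_const n p)"

definition sp_var :: "nat \<Rightarrow> (nat \<Rightarrow> nat \<Rightarrow> 'k::field) \<Rightarrow> nat \<Rightarrow> (fword \<Rightarrow>\<^sub>0 'k) set" where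
  "sp_var n p i = sp_class n p (free_var i)"

definition sp_vars :: "nat \<Rightarrow> (nat \<Rightarrow> nat \<Rightarrow> 'k::field) \<Rightarrow> (fword \<Rightarrow>\<^sub>0 'k) set list" where
  "sp_vars n p = map (sp_var n p) [1..<Suc n]"

definition sp_V :: "nat \<Rightarrow> (nat \<Rightarrow> nat \<Rightarrow> 'k::field) \<Rightarrow> (fword \<Rightarrow>\<^sub>0 'k) set set" where
  "sp_V n p = ring.Span (sp_ring n p) (sp_scalars n p) (sp_vars n p)"

definition sp_degree :: "nat \<Rightarrow> (nat \<Rightarrow> nat \<Rightarrow> 'k::field) \<Rightarrow> int \<Rightarrow> (fword \<Rightarrow>\<^sub>0 'k) set set" where
  "sp_degree n p d = sp_class n p `
     {f \<in> carrier (free_alg n). \<forall>w \<in> Poly_Mapping.keys f. int (length (letters w)) = d}"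

definition sp_auts ::
  "nat \<Rightarrow> (nat \<Rightarrow> nat \<Rightarrow> 'k::field) \<Rightarrow> ((fword \<Rightarrow>\<^sub>0 'k) set \<Rightarrow> (fword \<Rightarrow>\<^sub>0 'k) set) set" where
  "sp_auts n p = {\<phi> \<in> Bij (carrier (sp_ring n p)).
     \<phi> \<in> ring_hom (sp_ring n p) (sp_ring n p) \<and> (\<forall>c. \<phi> (sp_const n p c) = sp_const n p c)}"

definition sp_AutGroup ::
  "nat \<Rightarrow> (nat \<Rightarrow> nat \<Rightarrow> 'k::field) \<Rightarrow> ((fword \<Rightarrow>\<^sub>0 'k) set \<Rightarrow> (fword \<Rightarrow>\<^sub>0 'k) set) monoid" where
  "sp_AutGroup n p = BijGroup (carrier (sp_ring n p)) \<lparr>carrier := sp_auts n p\<rparr>"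

text \<open>
  Genericity of the parameters means that they admit only diagonal algebra automorphisms, which
  is the case e.g. for the parameters covered by the theorem of Alev and Chamarie.
\<close>

definition sp_generic :: "nat \<Rightarrow> (nat \<Rightarrow> nat \<Rightarrow> 'k::field) \<Rightarrow> bool" where
  "sp_generic n p \<longleftrightarrow> (\<forall>\<phi> \<in> sp_auts n p. \<forall>i \<in> {1..n}. \<exists>a. a \<noteq> 0 \<and>
     \<phi> (sp_var n p i) = sp_const n p a \<otimes>\<^bsub>sp_ring n p\<^esub> sp_var n p i)"


section \<open>Linear groups and small subgroups\<close>

text \<open>
  Vector spaces are subspaces, over a subfield \<open>K\<close>, of a ring \<open>R\<close>, as in
  \<open>HOL-Algebra.Embedded_Algebras\<close>; \<open>R\<close> need not be commutative.
\<close>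

definition GL :: "('a, 'b) ring_scheme \<Rightarrow> 'a set \<Rightarrow> 'a set \<Rightarrow> ('a \<Rightarrow> 'a) monoid" where
  "GL R K V = BijGroup V \<lparr>carrier := {f \<in> Bij V.
     (\<forall>u \<in> V. \<forall>v \<in> V. f (u \<oplus>\<^bsub>R\<^esub> v) = f u \<oplus>\<^bsub>R\<^esub> f v) \<and>
     (\<forall>k \<in> K. \<forall>v \<in> V. f (k \<otimes>\<^bsub>R\<^esub> v) = k \<otimes>\<^bsub>R\<^esub> f v)}\<rparr>"

definition hyperplane :: "('a, 'b) ring_scheme \<Rightarrow> 'a set \<Rightarrow> 'a set \<Rightarrow> 'a set \<Rightarrow> bool" where
  "hyperplane R K V H \<longleftrightarrow> H \<subseteq> V \<and>
     (\<exists>m. ring.dimension R m K H \<and> ring.dimension R (Suc m) K V)"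

definition pseudo_reflection ::
  "('a, 'b) ring_scheme \<Rightarrow> 'a set \<Rightarrow> 'a set \<Rightarrow> ('a \<Rightarrow> 'a) \<Rightarrow> bool" where
  "pseudo_reflection R K V f \<longleftrightarrow> f \<in> carrier (GL R K V) \<and> f \<noteq> \<one>\<^bsub>GL R K V\<^esub> \<and>
     (\<exists>m::nat. m > 0 \<and> f [^]\<^bsub>GL R K V\<^esub> m = \<one>\<^bsub>GL R K V\<^esub>) \<and>
     (\<exists>H. hyperplane R K V H \<and> (\<forall>v \<in> H. f v = v))"

definition small :: "('a, 'b) ring_scheme \<Rightarrow> 'a set \<Rightarrow> 'a set \<Rightarrow> ('a \<Rightarrow> 'a) set \<Rightarrow> bool" where
  "small R K V \<Gamma> \<longleftrightarrow> subgroup \<Gamma> (GL R K V) \<and> finite \<Gamma> \<and> \<not> (\<exists>f \<in> \<Gamma>. pseudo_reflection R K V f)"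


section \<open>Right modules\<close>

text \<open>
  Right modules use the record type of \<open>HOL-Algebra.Module\<close>: \<open>r \<odot>\<^bsub>M\<^esub> x\<close> stands for \<open>x \<cdot> r\<close>
  (note the order of factors in \<open>smult_mult\<close>). The fields \<open>mult\<close> and \<open>one\<close> are irrelevant.
\<close>

locale right_module = R?: ring R + M?: abelian_group M
  for R :: "('r, 'z) ring_scheme" (structure) and M :: "('r, 'm) module" (structure) +
  assumes smult_closed:
      "\<lbrakk>r \<in> carrier R; x \<in> carrier M\<rbrakk> \<Longrightarrow> r \<odot>\<^bsub>M\<^esub> x \<in> carrier M"
    and smult_add_scalar:
      "\<lbrakk>r \<in> carrier R; s \<in> carrier R; x \<in> carrier M\<rbrakk> \<Longrightarrow>
        (r \<oplus>\<^bsub>R\<^esub> s) \<odot>\<^bsub>M\<^esub> x = r \<odot>\<^bsub>M\<^esub> x \<oplus>\<^bsub>M\<^esub> s \<odot>\<^bsub>M\<^esub> x"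
    and smult_add:
      "\<lbrakk>r \<in> carrier R; x \<in> carrier M; y \<in> carrier M\<rbrakk> \<Longrightarrow>
        r \<odot>\<^bsub>M\<^esub> (x \<oplus>\<^bsub>M\<^esub> y) = r \<odot>\<^bsub>M\<^esub> x \<oplus>\<^bsub>M\<^esub> r \<odot>\<^bsub>M\<^esub> y"
    and smult_mult:
      "\<lbrakk>r \<in> carrier R; s \<in> carrier R; x \<in> carrier M\<rbrakk> \<Longrightarrow>
        (r \<otimes>\<^bsub>R\<^esub> s) \<odot>\<^bsub>M\<^esub> x = s \<odot>\<^bsub>M\<^esub> (r \<odot>\<^bsub>M\<^esub> x)"
    and smult_one:
      "x \<in> carrier M \<Longrightarrow> \<one>\<^bsub>R\<^esub> \<odot>\<^bsub>M\<^esub> x = x"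

text \<open>A ring \<open>S\<close> as a right module along a ring homomorphism \<open>\<eta>\<close> into \<open>S\<close>.\<close>

definition module_via :: "('s, 'z) ring_scheme \<Rightarrow> ('r \<Rightarrow> 's) \<Rightarrow> ('r, 's) module" where
  "module_via S \<eta> = \<lparr>carrier = carrier S, monoid.mult = monoid.mult S, one = one S,
     ring.zero = ring.zero S, add = add S, smult = (\<lambda>r x. x \<otimes>\<^bsub>S\<^esub> \<eta> r)\<rparr>"

definition mod_hom ::
  "('r, 'z) ring_scheme \<Rightarrow> ('r, 'm) module \<Rightarrow> ('r, 'n) module \<Rightarrow> ('m \<Rightarrow> 'n) set" where
  "mod_hom R M N = {f \<in> carrier M \<rightarrow>\<^sub>E carrier N.
     (\<forall>x \<in> carrier M. \<forall>y \<in> carrier M. f (x \<oplus>\<^bsub>M\<^esub> y) = f x \<oplus>\<^bsub>N\<^esub> f y) \<and>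
     (\<forall>r \<in> carrier R. \<forall>x \<in> carrier M. f (r \<odot>\<^bsub>M\<^esub> x) = r \<odot>\<^bsub>N\<^esub> f x)}"

definition hom_group ::
  "('r, 'z) ring_scheme \<Rightarrow> ('r, 'm) module \<Rightarrow> ('r, 'n) module \<Rightarrow> ('m \<Rightarrow> 'n) monoid" where
  "hom_group R M N = \<lparr>carrier = mod_hom R M N,
     monoid.mult = (\<lambda>f g. \<lambda>x \<in> carrier M. f x \<oplus>\<^bsub>N\<^esub> g x), one = (\<lambda>x \<in> carrier M. \<zero>\<^bsub>N\<^esub>)\<rparr>"

definition End_ring :: "('r, 'z) ring_scheme \<Rightarrow> ('r, 'm) module \<Rightarrow> ('m \<Rightarrow> 'm) ring" where
  "End_ring R M = \<lparr>carrier = mod_hom R M M, monoid.mult = compose (carrier M),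
     one = (\<lambda>x \<in> carrier M. x), ring.zero = (\<lambda>x \<in> carrier M. \<zero>\<^bsub>M\<^esub>),
     add = (\<lambda>f g. \<lambda>x \<in> carrier M. f x \<oplus>\<^bsub>M\<^esub> g x)\<rparr>"


section \<open>Ext groups and grade\<close>

definition module_basis :: "('r, 'z) ring_scheme \<Rightarrow> ('r, 'm) module \<Rightarrow> 'm set \<Rightarrow> bool" where
  "module_basis R M B \<longleftrightarrow> B \<subseteq> carrier M \<and>
     (\<forall>x \<in> carrier M. \<exists>!c. c \<in> B \<rightarrow>\<^sub>E carrier R \<and> finite {b \<in> B. c b \<noteq> \<zero>\<^bsub>R\<^esub>} \<and>
        x = (\<Oplus>\<^bsub>M\<^esub>b \<in> {b \<in> B. c b \<noteq> \<zero>\<^bsub>R\<^esub>}. c b \<odot>\<^bsub>M\<^esub> b))"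

definition free_module :: "('r, 'z) ring_scheme \<Rightarrow> ('r, 'm) module \<Rightarrow> bool" where
  "free_module R M \<longleftrightarrow> right_module R M \<and> (\<exists>B. module_basis R M B)"

text \<open>An exact complex \<open>\<dots> \<rightarrow> P 1 \<rightarrow> P 0 \<rightarrow> M \<rightarrow> 0\<close> with differentials \<open>d i : P (i + 1) \<rightarrow> P i\<close>.\<close>

definition free_resolution ::
  "('r, 'z) ring_scheme \<Rightarrow> ('r, 'm) module \<Rightarrow> (nat \<Rightarrow> ('r, 'p) module) \<Rightarrow> (nat \<Rightarrow> 'p \<Rightarrow> 'p) \<Rightarrow>
   ('p \<Rightarrow> 'm) \<Rightarrow> bool" where
  "free_resolution R M P d \<epsilon> \<longleftrightarrow>
     (\<forall>i. free_module R (P i)) \<and>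
     (\<forall>i. d i \<in> mod_hom R (P (Suc i)) (P i)) \<and>
     \<epsilon> \<in> mod_hom R (P 0) M \<and>
     \<epsilon> ` carrier (P 0) = carrier M \<and>
     d 0 ` carrier (P 1) = {x \<in> carrier (P 0). \<epsilon> x = \<zero>\<^bsub>M\<^esub>} \<and>
     (\<forall>i. d (Suc i) ` carrier (P (Suc (Suc i))) =
        {x \<in> carrier (P (Suc i)). d i x = \<zero>\<^bsub>P i\<^esub>})"

text \<open>The \<open>i\<close>-th cohomology group of the cochain complex \<open>Hom\<^bsub>R\<^esub>(P, N)\<close>.\<close>

definition hom_cocycles ::
  "('r, 'z) ring_scheme \<Rightarrow> (nat \<Rightarrow> ('r, 'p) module) \<Rightarrow> (nat \<Rightarrow> 'p \<Rightarrow> 'p) \<Rightarrow> ('r, 'n) module \<Rightarrow>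
   nat \<Rightarrow> ('p \<Rightarrow> 'n) set" where
  "hom_cocycles R P d N i = {f \<in> mod_hom R (P i) N. \<forall>x \<in> carrier (P (Suc i)). f (d i x) = \<zero>\<^bsub>N\<^esub>}"

definition hom_coboundaries ::
  "('r, 'z) ring_scheme \<Rightarrow> (nat \<Rightarrow> ('r, 'p) module) \<Rightarrow> (nat \<Rightarrow> 'p \<Rightarrow> 'p) \<Rightarrow> ('r, 'n) module \<Rightarrow>
   nat \<Rightarrow> ('p \<Rightarrow> 'n) set" where
  "hom_coboundaries R P d N i =
     (case i of 0 \<Rightarrow> {\<one>\<^bsub>hom_group R (P 0) N\<^esub>}
      | Suc j \<Rightarrow> (\<lambda>f. compose (carrier (P (Suc j))) f (d j)) ` mod_hom R (P j) N)"

definition hom_cohomology ::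
  "('r, 'z) ring_scheme \<Rightarrow> (nat \<Rightarrow> ('r, 'p) module) \<Rightarrow> (nat \<Rightarrow> 'p \<Rightarrow> 'p) \<Rightarrow> ('r, 'n) module \<Rightarrow>
   nat \<Rightarrow> ('p \<Rightarrow> 'n) set monoid" where
  "hom_cohomology R P d N i =
     (hom_group R (P i) N) \<lparr>carrier := hom_cocycles R P d N i\<rparr> Mod hom_coboundaries R P d N i"

text \<open>
  \<open>Ext\<^sup>i\<close> is computed from a chosen free resolution; up to isomorphism the choice does not matter.
  The modules in the resolution have carriers in \<open>('m \<times> 'r) list\<close>. Every right module on \<open>'m\<close>
  over a ring on \<open>'r\<close> has such a resolution: this type is infinite and at least as large as \<open>'m\<close>
  and \<open>'r\<close>, so a free module on a basis of at most its cardinality can be carried by it, and the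
  successive kernels are again of at most its cardinality.
\<close>

definition Ext ::
  "('r, 'z) ring_scheme \<Rightarrow> ('r, 'm) module \<Rightarrow> ('r, 'n) module \<Rightarrow> nat \<Rightarrow>
   (('m \<times> 'r) list \<Rightarrow> 'n) set monoid" where
  "Ext R M N i = (case SOME (P, d). \<exists>\<epsilon>. free_resolution R M P d \<epsilon> of
     (P, d) \<Rightarrow> hom_cohomology R P d N i)"

definition grade :: "('r, 'z) ring_scheme \<Rightarrow> ('r, 'm) module \<Rightarrow> enat" where
  "grade R M = Inf {enat i | i. \<not> trivial_group (Ext R M (module_via R (\<lambda>r. r)) i)}"


section \<open>Skew group rings and homological smallness\<close>

text \<open>
  In the following \<open>G\<close> is a finite group of automorphisms of the ring \<open>R\<close>, under the operations of
  \<open>BijGroup (carrier R)\<close>. The function \<open>a\<close> on \<open>G\<close> represents the element \<open>\<Sum>\<^sub>g a g * g\<close>, and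
  \<open>(r * g) (s * h) = r g(s) * g h\<close>.
\<close>

definition skew_group_ring :: "('a, 'z) ring_scheme \<Rightarrow> ('a \<Rightarrow> 'a) set \<Rightarrow> (('a \<Rightarrow> 'a) \<Rightarrow> 'a) ring" where
  "skew_group_ring R G = \<lparr>carrier = G \<rightarrow>\<^sub>E carrier R,
     monoid.mult = (\<lambda>a b. \<lambda>h \<in> G. \<Oplus>\<^bsub>R\<^esub>g \<in> G. a g \<otimes>\<^bsub>R\<^esub>
        g (b (inv\<^bsub>BijGroup (carrier R)\<^esub> g \<otimes>\<^bsub>BijGroup (carrier R)\<^esub> h))),
     one = (\<lambda>g \<in> G. if g = \<one>\<^bsub>BijGroup (carrier R)\<^esub> then \<one>\<^bsub>R\<^esub> else \<zero>\<^bsub>R\<^esub>),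
     ring.zero = (\<lambda>g \<in> G. \<zero>\<^bsub>R\<^esub>),
     add = (\<lambda>a b. \<lambda>g \<in> G. a g \<oplus>\<^bsub>R\<^esub> b g)\<rparr>"

definition skew_emb :: "('a, 'z) ring_scheme \<Rightarrow> ('a \<Rightarrow> 'a) set \<Rightarrow> 'a \<Rightarrow> ('a \<Rightarrow> 'a) \<Rightarrow> 'a" where
  "skew_emb R G r = (\<lambda>g \<in> G. if g = \<one>\<^bsub>BijGroup (carrier R)\<^esub> then r else \<zero>\<^bsub>R\<^esub>)"

definition fixed_ring :: "('a, 'z) ring_scheme \<Rightarrow> ('a \<Rightarrow> 'a) set \<Rightarrow> ('a, 'z) ring_scheme" where
  "fixed_ring R G = R \<lparr>carrier := {r \<in> carrier R. \<forall>g \<in> G. g r = r}\<rparr>"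

definition natural_map ::
  "('a, 'z) ring_scheme \<Rightarrow> ('a \<Rightarrow> 'a) set \<Rightarrow> (('a \<Rightarrow> 'a) \<Rightarrow> 'a) \<Rightarrow> 'a \<Rightarrow> 'a" where
  "natural_map R G a = (\<lambda>x \<in> carrier R. \<Oplus>\<^bsub>R\<^esub>g \<in> G. a g \<otimes>\<^bsub>R\<^esub> g x)"

definition averaging_ideal ::
  "nat \<Rightarrow> (nat \<Rightarrow> nat \<Rightarrow> 'k::field) \<Rightarrow> ((fword \<Rightarrow>\<^sub>0 'k) set \<Rightarrow> (fword \<Rightarrow>\<^sub>0 'k) set) set \<Rightarrow>
   (((fword \<Rightarrow>\<^sub>0 'k) set \<Rightarrow> (fword \<Rightarrow>\<^sub>0 'k) set) \<Rightarrow> (fword \<Rightarrow>\<^sub>0 'k) set) set" where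
  "averaging_ideal n p G = Idl\<^bsub>skew_group_ring (sp_ring n p) G\<^esub>
     {\<lambda>g \<in> G. sp_const n p (inverse (of_nat (card G)))}"

definition homologically_small ::
  "nat \<Rightarrow> (nat \<Rightarrow> nat \<Rightarrow> 'k::field) \<Rightarrow> ((fword \<Rightarrow>\<^sub>0 'k) set \<Rightarrow> (fword \<Rightarrow>\<^sub>0 'k) set) set \<Rightarrow> bool" where
  "homologically_small n p G \<longleftrightarrow>
     (let R = sp_ring n p; S = skew_group_ring R G; I = averaging_ideal n p G in
      grade R (module_via (S Quot I) (\<lambda>r. I +>\<^bsub>S\<^esub> skew_emb R G r)) \<ge> 2)"


section \<open>Isomorphisms of graded algebras\<close>

text \<open>
  An algebra is a ring with a map from the base field, a grading is a family of
  subsets indexed by the degree.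
\<close>

definition graded_algebra_iso ::
  "('a, 'y) ring_scheme \<Rightarrow> ('k \<Rightarrow> 'a) \<Rightarrow> (int \<Rightarrow> 'a set) \<Rightarrow>
   ('b, 'z) ring_scheme \<Rightarrow> ('k \<Rightarrow> 'b) \<Rightarrow> (int \<Rightarrow> 'b set) \<Rightarrow> ('a \<Rightarrow> 'b) set" where
  "graded_algebra_iso A \<iota>\<^sub>A A\<^sub>d B \<iota>\<^sub>B B\<^sub>d = {h \<in> ring_iso A B.
     (\<forall>c. h (\<iota>\<^sub>A c) = \<iota>\<^sub>B c) \<and> (\<forall>d. h ` A\<^sub>d d = B\<^sub>d d)}"

definition natural_map_graded_iso ::
  "nat \<Rightarrow> (nat \<Rightarrow> nat \<Rightarrow> 'k::field) \<Rightarrow> ((fword \<Rightarrow>\<^sub>0 'k) set \<Rightarrow> (fword \<Rightarrow>\<^sub>0 'k) set) set \<Rightarrow> bool" where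
  "natural_map_graded_iso n p G \<longleftrightarrow>
     (let R = sp_ring n p; S = skew_group_ring R G;
          E = End_ring (fixed_ring R G) (module_via R (\<lambda>r. r)) in
      natural_map R G \<in> graded_algebra_iso
        S (\<lambda>c. skew_emb R G (sp_const n p c))
          (\<lambda>d. {a \<in> carrier S. \<forall>g \<in> G. a g \<in> sp_degree n p d})
        E (\<lambda>c. \<lambda>x \<in> carrier R. sp_const n p c \<otimes>\<^bsub>R\<^esub> x)
          (\<lambda>d. {f \<in> carrier E. \<forall>m. f ` sp_degree n p m \<subseteq> sp_degree n p (m + d)}))"

end

theory Submission
  imports Defs "HOL-Computational_Algebra.Polynomial"
begin

text \<open>
  Genericity makes \<open>G\<close> act diagonally, so every monomial \<open>x\<^sup>\<beta>\<close> spans a \<open>G\<close>-stable line and has a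
  weight, a character of \<open>G\<close>. By orthogonality and Artin's independence of characters, the absence
  of reflections means that for each variable \<open>x\<^sub>i\<close> every weight is already the weight of a monomial
  not involving \<open>x\<^sub>i\<close>. A homomorphism into \<open>R\<close>, either from the ideal of \<open>R * G\<close> generated by the
  averaging idempotent \<open>e\<close> or from \<open>R\<close> over \<open>R\<^sup>G\<close>, is on each weight a left multiplication by a
  fraction; coprimality of the monomials of that weight forces the fraction into \<open>R\<close>. This gives
  \<open>Ext\<^sup>1((R * G)/(e), R) = 0\<close> and the surjectivity of \<open>R * G \<rightarrow> End(R)\<close>. Conversely, a reflection
  \<open>h\<close> in the variable \<open>x\<^sub>i\<close> yields the map \<open>x\<^sub>i\<^sup>-\<^sup>1 (1 - h)\<close>, which obstructs both. The map
  \<open>R * G \<rightarrow> End(R)\<close> is always injective, and \<open>Hom((R * G)/(e), R)\<close> always vanishes.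
\<close>

section \<open>Modules and their homomorphisms\<close>

text \<open>\<open>Ext\<close> is computed from a resolution picked by \<open>SOME\<close> among
  modules on one fixed type, so nothing can be read off before a resolution on that type is shown to
  exist. After that only degrees 0 and 1 matter, and a comparison in the style of Schanuel replaces
  the unknown resolution by the map of \<open>R * G\<close> onto its quotient, \<open>R * G\<close>
  being free over \<open>R\<close> on the group elements.

  \<open>R\<close> is noncommutative and no ring of fractions is built: all denominators are
  monomials, which are regular, so a statement about a fraction becomes a cross-multiplied equation.
  The two homomorphism problems differ only in the factors available for this. In the ideal,
  \<open>x^\<beta> e x^\<beta>'\<close> and \<open>x^\<beta>' e x^\<beta>\<close> are proportional
  when the weights agree; over \<open>R^G\<close> only invariant monomials may be pulled out, which
  forces an extra exponent \<open>\<delta>\<close> completing both monomials to invariants.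

  Passing from one fraction per weight to one coefficient per group element is Fourier inversion,
  which divides by \<open>|G|\<close>. The field may lack roots of unity, but a diagonal action
  already has its eigenvalues there.\<close>

lemma mod_homI:
  assumes "f \<in> carrier M \<rightarrow>\<^sub>E carrier N"
    and "\<And>x y. x \<in> carrier M \<Longrightarrow> y \<in> carrier M \<Longrightarrow> f (x \<oplus>\<^bsub>M\<^esub> y) = f x \<oplus>\<^bsub>N\<^esub> f y"
    and "\<And>r x. r \<in> carrier R \<Longrightarrow> x \<in> carrier M \<Longrightarrow> f (r \<odot>\<^bsub>M\<^esub> x) = r \<odot>\<^bsub>N\<^esub> f x"
  shows "f \<in> mod_hom R M N"
  using assms by (simp add: mod_hom_def)

lemma mod_homD:
  assumes "f \<in> mod_hom R M N"
  shows "x \<in> carrier M \<Longrightarrow> f x \<in> carrier N"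
    and "x \<in> carrier M \<Longrightarrow> y \<in> carrier M \<Longrightarrow> f (x \<oplus>\<^bsub>M\<^esub> y) = f x \<oplus>\<^bsub>N\<^esub> f y"
    and "r \<in> carrier R \<Longrightarrow> x \<in> carrier M \<Longrightarrow> f (r \<odot>\<^bsub>M\<^esub> x) = r \<odot>\<^bsub>N\<^esub> f x"
    and "f \<in> extensional (carrier M)"
  using assms by (auto simp: mod_hom_def PiE_iff)

lemma mod_hom_eqI:
  assumes "f \<in> mod_hom R M N" "g \<in> mod_hom R M N" "\<And>x. x \<in> carrier M \<Longrightarrow> f x = g x"
  shows "f = g"
  by (rule extensionalityI[OF mod_homD(4)[OF assms(1)] mod_homD(4)[OF assms(2)] assms(3)])

lemma (in right_module) smult_zero:
  assumes "r \<in> carrier R" shows "r \<odot>\<^bsub>M\<^esub> \<zero>\<^bsub>M\<^esub> = \<zero>\<^bsub>M\<^esub>"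
proof -
  have "r \<odot>\<^bsub>M\<^esub> \<zero>\<^bsub>M\<^esub> \<oplus>\<^bsub>M\<^esub> r \<odot>\<^bsub>M\<^esub> \<zero>\<^bsub>M\<^esub> = r \<odot>\<^bsub>M\<^esub> \<zero>\<^bsub>M\<^esub>"
    using smult_add[OF assms, of "\<zero>\<^bsub>M\<^esub>" "\<zero>\<^bsub>M\<^esub>"] by simp
  then show ?thesis using smult_closed[OF assms, of "\<zero>\<^bsub>M\<^esub>"]
    by (metis M.add.l_cancel_one' M.zero_closed)
qed

lemma (in right_module) zero_smult:
  assumes "x \<in> carrier M" shows "\<zero>\<^bsub>R\<^esub> \<odot>\<^bsub>M\<^esub> x = \<zero>\<^bsub>M\<^esub>"
proof -
  have "\<zero>\<^bsub>R\<^esub> \<odot>\<^bsub>M\<^esub> x \<oplus>\<^bsub>M\<^esub> \<zero>\<^bsub>R\<^esub> \<odot>\<^bsub>M\<^esub> x = \<zero>\<^bsub>R\<^esub> \<odot>\<^bsub>M\<^esub> x"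
    using smult_add_scalar[OF R.zero_closed R.zero_closed assms] by simp
  then show ?thesis using smult_closed[OF R.zero_closed assms]
    by (metis M.add.l_cancel_one')
qed

lemma mod_hom_group_hom:
  assumes "right_module R M" "right_module R N" "f \<in> mod_hom R M N"
  shows "abelian_group_hom M N f"
proof -
  interpret M: right_module R M by fact
  interpret N: right_module R N by fact
  show ?thesis
    using mod_homD[OF assms(3)]
    by (intro abelian_group_homI M.M.abelian_group_axioms N.M.abelian_group_axioms)
      (auto simp: group_hom_def group_hom_axioms_def hom_def M.M.a_group N.M.a_group)
qed

lemma mod_hom_zero:
  assumes "right_module R M" "right_module R N" "f \<in> mod_hom R M N"
  shows "f \<zero>\<^bsub>M\<^esub> = \<zero>\<^bsub>N\<^esub>"
  using abelian_group_hom.hom_zero[OF mod_hom_group_hom[OF assms]] .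

lemma mod_hom_finsum:
  assumes "right_module R M" "right_module R N" "f \<in> mod_hom R M N" "t \<in> F \<rightarrow> carrier M"
  shows "f (\<Oplus>\<^bsub>M\<^esub>b\<in>F. t b) = (\<Oplus>\<^bsub>N\<^esub>b\<in>F. f (t b))"
proof -
  interpret M: right_module R M by fact
  interpret N: right_module R N by fact
  note z = mod_hom_zero[OF assms(1-3)]
  show ?thesis using assms(4)
  proof (induction F rule: infinite_finite_induct)
    case (insert a F)
    then show ?case
      using mod_homD[OF assms(3)] by (simp add: Pi_iff)
  qed (simp_all add: z)
qed

lemma mod_hom_compose:
  assumes "right_module R M" "f \<in> mod_hom R M N" "g \<in> mod_hom R N L"
  shows "compose (carrier M) g f \<in> mod_hom R M L"
proof -
  interpret M: right_module R M by fact
  show ?thesis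
    using mod_homD(1-3)[OF assms(2)] mod_homD(1-3)[OF assms(3)]
    by (intro mod_homI) (auto simp: compose_def M.smult_closed)
qed

lemma lin_zero_extend:
  assumes "right_module R M" "finite F" "S \<subseteq> F" "\<And>b. b \<in> F - S \<Longrightarrow> c b = \<zero>\<^bsub>R\<^esub>"
    "c \<in> F \<rightarrow> carrier R" "t \<in> F \<rightarrow> carrier M"
  shows "(\<Oplus>\<^bsub>M\<^esub>b\<in>S. c b \<odot>\<^bsub>M\<^esub> t b) = (\<Oplus>\<^bsub>M\<^esub>b\<in>F. c b \<odot>\<^bsub>M\<^esub> t b)"
proof -
  interpret M: right_module R M by fact
  show ?thesis
    using assms by (intro M.M.add.finprod_mono_neutral_cong_left)
     (auto simp: Pi_iff M.zero_smult M.smult_closed)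
qed

lemma lin_smult:
  assumes "right_module R M" "c \<in> F \<rightarrow> carrier R" "t \<in> F \<rightarrow> carrier M" "r \<in> carrier R"
  shows "r \<odot>\<^bsub>M\<^esub> (\<Oplus>\<^bsub>M\<^esub>b\<in>F. c b \<odot>\<^bsub>M\<^esub> t b) = (\<Oplus>\<^bsub>M\<^esub>b\<in>F. (c b \<otimes>\<^bsub>R\<^esub> r) \<odot>\<^bsub>M\<^esub> t b)"
proof -
  interpret M: right_module R M by fact
  show ?thesis using assms(2,3)
  proof (induction F rule: infinite_finite_induct)
    case (insert a F)
    have "(\<Oplus>\<^bsub>M\<^esub>b\<in>F. c b \<odot>\<^bsub>M\<^esub> t b) \<in> carrier M"
      using insert by (intro M.M.finsum_closed) (auto simp: Pi_iff M.smult_closed)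
    then show ?case
      using insert assms(4) by (simp add: Pi_iff M.smult_closed M.smult_add M.smult_mult)
  qed (simp_all add: M.smult_zero assms)
qed

lemma lin_add:
  assumes "right_module R M" "c \<in> F \<rightarrow> carrier R" "d \<in> F \<rightarrow> carrier R" "t \<in> F \<rightarrow> carrier M"
  shows "(\<Oplus>\<^bsub>M\<^esub>b\<in>F. c b \<odot>\<^bsub>M\<^esub> t b) \<oplus>\<^bsub>M\<^esub> (\<Oplus>\<^bsub>M\<^esub>b\<in>F. d b \<odot>\<^bsub>M\<^esub> t b)
    = (\<Oplus>\<^bsub>M\<^esub>b\<in>F. (c b \<oplus>\<^bsub>R\<^esub> d b) \<odot>\<^bsub>M\<^esub> t b)"
proof -
  interpret M: right_module R M by fact
  have "(\<Oplus>\<^bsub>M\<^esub>b\<in>F. (c b \<oplus>\<^bsub>R\<^esub> d b) \<odot>\<^bsub>M\<^esub> t b) = (\<Oplus>\<^bsub>M\<^esub>b\<in>F. c b \<odot>\<^bsub>M\<^esub> t b \<oplus>\<^bsub>M\<^esub> d b \<odot>\<^bsub>M\<^esub> t b)"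
    using assms(2-4) by (intro M.M.finsum_cong') (auto simp: Pi_iff M.smult_closed M.smult_add_scalar)
  also have "\<dots> = (\<Oplus>\<^bsub>M\<^esub>b\<in>F. c b \<odot>\<^bsub>M\<^esub> t b) \<oplus>\<^bsub>M\<^esub> (\<Oplus>\<^bsub>M\<^esub>b\<in>F. d b \<odot>\<^bsub>M\<^esub> t b)"
    using assms(2-4) by (intro M.M.finsum_addf) (auto simp: Pi_iff M.smult_closed)
  finally show ?thesis by simp
qed

section \<open>Finitely supported linear combinations\<close>

definition fin_supp :: "('r, 'z) ring_scheme \<Rightarrow> 'b set \<Rightarrow> ('b \<Rightarrow> 'r) set" where
  "fin_supp R B = {c \<in> B \<rightarrow>\<^sub>E carrier R. finite {b \<in> B. c b \<noteq> \<zero>\<^bsub>R\<^esub>}}"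

text \<open>A \<open>finsum\<close> over an infinite index set is \<open>\<zero>\<close> by
  convention, hence the restriction to the support. The indices have a type of their own, so that
  one coefficient function can be combined with different families \<open>t\<close>.\<close>

definition lin_comb :: "('r, 'z) ring_scheme \<Rightarrow> ('r, 'm) module \<Rightarrow> 'b set \<Rightarrow> ('b \<Rightarrow> 'm) \<Rightarrow> ('b \<Rightarrow> 'r) \<Rightarrow> 'm" where
  "lin_comb R M B t c = (\<Oplus>\<^bsub>M\<^esub>b\<in>{b \<in> B. c b \<noteq> \<zero>\<^bsub>R\<^esub>}. c b \<odot>\<^bsub>M\<^esub> t b)"

lemma fin_supp_add:
  assumes "ring R" "c \<in> fin_supp R B" "d \<in> fin_supp R B"
  shows "(\<lambda>b\<in>B. c b \<oplus>\<^bsub>R\<^esub> d b) \<in> fin_supp R B"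
proof -
  interpret ring R by fact
  have "{b \<in> B. (\<lambda>b\<in>B. c b \<oplus>\<^bsub>R\<^esub> d b) b \<noteq> \<zero>\<^bsub>R\<^esub>} \<subseteq> {b \<in> B. c b \<noteq> \<zero>\<^bsub>R\<^esub>} \<union> {b \<in> B. d b \<noteq> \<zero>\<^bsub>R\<^esub>}"
    by auto
  then show ?thesis
    using assms(2,3) by (auto simp: fin_supp_def PiE_iff intro: rev_finite_subset)
qed

lemma fin_supp_mult:
  assumes "ring R" "c \<in> fin_supp R B" "r \<in> carrier R"
  shows "(\<lambda>b\<in>B. c b \<otimes>\<^bsub>R\<^esub> r) \<in> fin_supp R B"
proof -
  interpret ring R by fact
  have "{b \<in> B. (\<lambda>b\<in>B. c b \<otimes>\<^bsub>R\<^esub> r) b \<noteq> \<zero>\<^bsub>R\<^esub>} \<subseteq> {b \<in> B. c b \<noteq> \<zero>\<^bsub>R\<^esub>}"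
    using assms(3) by auto
  then show ?thesis
    using assms(2,3) by (auto simp: fin_supp_def PiE_iff intro: rev_finite_subset)
qed

text \<open>The supports of two coefficient functions and of their sum differ, so they are enlarged
  to a common finite index set before sums are compared.\<close>

lemma lin_comb_superset:
  assumes "right_module R M" "c \<in> fin_supp R B" "t \<in> B \<rightarrow> carrier M"
    "finite F" "F \<subseteq> B" "{b \<in> B. c b \<noteq> \<zero>\<^bsub>R\<^esub>} \<subseteq> F"
  shows "lin_comb R M B t c = (\<Oplus>\<^bsub>M\<^esub>b\<in>F. c b \<odot>\<^bsub>M\<^esub> t b)"
  unfolding lin_comb_def using assms
  by (intro lin_zero_extend) (auto simp: fin_supp_def Pi_iff PiE_iff)

lemma lin_comb_closed:
  assumes "right_module R M" "c \<in> fin_supp R B" "t \<in> B \<rightarrow> carrier M"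
  shows "lin_comb R M B t c \<in> carrier M"
proof -
  interpret M: right_module R M by fact
  show ?thesis unfolding lin_comb_def using assms
    by (intro M.M.finsum_closed) (auto simp: fin_supp_def Pi_iff PiE_iff M.smult_closed)
qed

lemma lin_comb_add:
  assumes M: "right_module R M" and c: "c \<in> fin_supp R B" "d \<in> fin_supp R B" and t: "t \<in> B \<rightarrow> carrier M"
  shows "lin_comb R M B t (\<lambda>b\<in>B. c b \<oplus>\<^bsub>R\<^esub> d b) = lin_comb R M B t c \<oplus>\<^bsub>M\<^esub> lin_comb R M B t d"
proof -
  interpret M: right_module R M by fact
  let ?F = "{b \<in> B. c b \<noteq> \<zero>\<^bsub>R\<^esub>} \<union> {b \<in> B. d b \<noteq> \<zero>\<^bsub>R\<^esub>}"
  have F: "finite ?F" "?F \<subseteq> B" using c by (auto simp: fin_supp_def)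
  have cd: "(\<lambda>b\<in>B. c b \<oplus>\<^bsub>R\<^esub> d b) \<in> fin_supp R B"
    using fin_supp_add[OF M.R.ring_axioms c] .
  have "lin_comb R M B t (\<lambda>b\<in>B. c b \<oplus>\<^bsub>R\<^esub> d b) = (\<Oplus>\<^bsub>M\<^esub>b\<in>?F. (\<lambda>b\<in>B. c b \<oplus>\<^bsub>R\<^esub> d b) b \<odot>\<^bsub>M\<^esub> t b)"
    by (rule lin_comb_superset[OF M cd t F]) auto
  also have "\<dots> = (\<Oplus>\<^bsub>M\<^esub>b\<in>?F. (c b \<oplus>\<^bsub>R\<^esub> d b) \<odot>\<^bsub>M\<^esub> t b)"
    using c t by (intro M.M.finsum_cong') (auto simp: fin_supp_def Pi_iff PiE_iff intro!: M.smult_closed)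
  also have "\<dots> = (\<Oplus>\<^bsub>M\<^esub>b\<in>?F. c b \<odot>\<^bsub>M\<^esub> t b) \<oplus>\<^bsub>M\<^esub> (\<Oplus>\<^bsub>M\<^esub>b\<in>?F. d b \<odot>\<^bsub>M\<^esub> t b)"
    using c t by (intro lin_add[symmetric] M) (auto simp: fin_supp_def Pi_iff PiE_iff)
  also have "\<dots> = lin_comb R M B t c \<oplus>\<^bsub>M\<^esub> lin_comb R M B t d"
    using lin_comb_superset[OF M c(1) t F] lin_comb_superset[OF M c(2) t F] by simp
  finally show ?thesis .
qed

lemma lin_comb_smult:
  assumes M: "right_module R M" and c: "c \<in> fin_supp R B" and r: "r \<in> carrier R" and t: "t \<in> B \<rightarrow> carrier M"
  shows "lin_comb R M B t (\<lambda>b\<in>B. c b \<otimes>\<^bsub>R\<^esub> r) = r \<odot>\<^bsub>M\<^esub> lin_comb R M B t c"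
proof -
  interpret M: right_module R M by fact
  let ?F = "{b \<in> B. c b \<noteq> \<zero>\<^bsub>R\<^esub>}"
  have F: "finite ?F" "?F \<subseteq> B" using c by (auto simp: fin_supp_def)
  have "lin_comb R M B t (\<lambda>b\<in>B. c b \<otimes>\<^bsub>R\<^esub> r) = (\<Oplus>\<^bsub>M\<^esub>b\<in>?F. (\<lambda>b\<in>B. c b \<otimes>\<^bsub>R\<^esub> r) b \<odot>\<^bsub>M\<^esub> t b)"
    using r by (intro lin_comb_superset[OF M fin_supp_mult[OF M.R.ring_axioms c r] t F]) auto
  also have "\<dots> = (\<Oplus>\<^bsub>M\<^esub>b\<in>?F. (c b \<otimes>\<^bsub>R\<^esub> r) \<odot>\<^bsub>M\<^esub> t b)"
    using c t r by (intro M.M.finsum_cong') (auto simp: fin_supp_def Pi_iff PiE_iff intro!: M.smult_closed)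
  also have "\<dots> = r \<odot>\<^bsub>M\<^esub> lin_comb R M B t c"
    unfolding lin_comb_def
    using c t by (intro lin_smult[symmetric] M r) (auto simp: fin_supp_def Pi_iff PiE_iff)
  finally show ?thesis .
qed

lemma mod_hom_lin_comb:
  assumes "right_module R M" "right_module R N" "f \<in> mod_hom R M N" "c \<in> fin_supp R B" "t \<in> B \<rightarrow> carrier M"
  shows "f (lin_comb R M B t c) = lin_comb R N B (\<lambda>b. f (t b)) c"
proof -
  interpret M: right_module R M by fact
  interpret N: right_module R N by fact
  have *: "c b \<in> carrier R \<and> t b \<in> carrier M" if "b \<in> B" for b
    using that assms by (auto simp: fin_supp_def)
  have "f (lin_comb R M B t c) = (\<Oplus>\<^bsub>N\<^esub>b\<in>{b \<in> B. c b \<noteq> \<zero>\<^bsub>R\<^esub>}. f (c b \<odot>\<^bsub>M\<^esub> t b))"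
    unfolding lin_comb_def using * by (intro mod_hom_finsum[OF assms(1-3)]) (auto simp: M.smult_closed)
  also have "\<dots> = lin_comb R N B (\<lambda>b. f (t b)) c"
    unfolding lin_comb_def using * mod_homD[OF assms(3)]
    by (intro N.M.finsum_cong') (auto intro!: N.smult_closed)
  finally show ?thesis .
qed

lemma module_basis_iff:
  "module_basis R M B \<longleftrightarrow> B \<subseteq> carrier M \<and>
    (\<forall>x \<in> carrier M. \<exists>!c. c \<in> fin_supp R B \<and> x = lin_comb R M B (\<lambda>b. b) c)"
  by (simp add: module_basis_def fin_supp_def lin_comb_def conj_assoc)

text \<open>Freeness gives projectivity: basis elements go to chosen preimages under
  \<open>\<pi>\<close>. The coordinates \<open>co x\<close> are additive and homogeneous by their
  uniqueness, and \<open>u\<close> inherits linearity from them.\<close>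

lemma free_module_lift:
  assumes P: "free_module R P" and A: "right_module R A" and M: "right_module R M"
    and e: "\<epsilon> \<in> mod_hom R P M" and pi: "\<pi> \<in> mod_hom R A M" "\<pi> ` carrier A = carrier M"
  shows "\<exists>u \<in> mod_hom R P A. \<forall>x \<in> carrier P. \<pi> (u x) = \<epsilon> x"
proof -
  from P obtain B where P': "right_module R P" and B: "module_basis R P B"
    by (auto simp: free_module_def)
  interpret P: right_module R P by fact
  have BP: "B \<subseteq> carrier P" using B by (simp add: module_basis_iff)
  define co where "co x = (THE c. c \<in> fin_supp R B \<and> x = lin_comb R P B (\<lambda>b. b) c)" for x
  have co: "co x \<in> fin_supp R B" "lin_comb R P B (\<lambda>b. b) (co x) = x" if "x \<in> carrier P" for x
    using theI'[of "\<lambda>c. c \<in> fin_supp R B \<and> x = lin_comb R P B (\<lambda>b. b) c"] B that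
    unfolding co_def module_basis_iff by auto
  have co_eq: "co x = c" if "x \<in> carrier P" "c \<in> fin_supp R B" "lin_comb R P B (\<lambda>b. b) c = x" for x c
    using B that co[OF that(1)] unfolding module_basis_iff by metis
  have t': "\<exists>a. a \<in> carrier A \<and> \<pi> a = \<epsilon> b" if "b \<in> B" for b
  proof -
    have "\<epsilon> b \<in> \<pi> ` carrier A" unfolding pi(2) using mod_homD(1)[OF e] BP that by auto
    then show ?thesis by auto
  qed
  define t where "t b = (SOME a. a \<in> carrier A \<and> \<pi> a = \<epsilon> b)" for b
  have t: "t b \<in> carrier A" "\<pi> (t b) = \<epsilon> b" if "b \<in> B" for b
    using someI_ex[OF t'[OF that]] unfolding t_def by auto
  have tB: "t \<in> B \<rightarrow> carrier A" and iB: "(\<lambda>b. b) \<in> B \<rightarrow> carrier P" using t BP by auto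
  define u where "u = (\<lambda>x\<in>carrier P. lin_comb R A B t (co x))"
  have "u \<in> mod_hom R P A"
  proof (rule mod_homI)
    show "u \<in> carrier P \<rightarrow>\<^sub>E carrier A"
      using co lin_comb_closed[OF A _ tB] by (auto simp: u_def)
  next
    fix x y assume xy: "x \<in> carrier P" "y \<in> carrier P"
    have "co (x \<oplus>\<^bsub>P\<^esub> y) = (\<lambda>b\<in>B. co x b \<oplus>\<^bsub>R\<^esub> co y b)"
      using xy co by (intro co_eq fin_supp_add P.R.ring_axioms) (simp_all add: lin_comb_add[OF P' _ _ iB])
    then show "u (x \<oplus>\<^bsub>P\<^esub> y) = u x \<oplus>\<^bsub>A\<^esub> u y"
      using xy co by (simp add: u_def lin_comb_add[OF A _ _ tB])
  next
    fix r x assume xy: "r \<in> carrier R" "x \<in> carrier P"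
    have "co (r \<odot>\<^bsub>P\<^esub> x) = (\<lambda>b\<in>B. co x b \<otimes>\<^bsub>R\<^esub> r)"
      using xy co by (intro co_eq fin_supp_mult P.R.ring_axioms P.smult_closed)
        (simp_all add: lin_comb_smult[OF P' _ _ iB])
    then show "u (r \<odot>\<^bsub>P\<^esub> x) = r \<odot>\<^bsub>A\<^esub> u x"
      using xy co by (simp add: u_def P.smult_closed lin_comb_smult[OF A _ _ tB])
  qed
  moreover have "\<pi> (u x) = \<epsilon> x" if x: "x \<in> carrier P" for x
  proof -
    have "\<pi> (u x) = lin_comb R M B (\<lambda>b. \<pi> (t b)) (co x)"
      using x co by (simp add: u_def mod_hom_lin_comb[OF A M pi(1) _ tB])
    also have "\<dots> = lin_comb R M B (\<lambda>b. \<epsilon> b) (co x)"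
    proof -
      interpret M: right_module R M by fact
      show ?thesis unfolding lin_comb_def
        using co(1)[OF x] t BP mod_homD(1)[OF e]
        by (intro M.M.finsum_cong') (auto intro!: M.smult_closed simp: fin_supp_def)
    qed
    also have "\<dots> = \<epsilon> (lin_comb R P B (\<lambda>b. b) (co x))"
      using mod_hom_lin_comb[OF P' M e co(1)[OF x] iB] by simp
    finally show ?thesis using co(2)[OF x] by simp
  qed
  ultimately show ?thesis by blast
qed

lemma right_module_via:
  assumes "ring R" "ring S" "\<eta> \<in> ring_hom R S"
  shows "right_module R (module_via S \<eta>)"
proof -
  interpret R: ring R by fact
  interpret S: ring S by fact
  note h = ring_hom_closed[OF assms(3)] ring_hom_add[OF assms(3)] ring_hom_mult[OF assms(3)] ring_hom_one[OF assms(3)]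
  have "abelian_group (module_via S \<eta>)"
    by (rule abelian_groupI) (auto simp: module_via_def S.a_ac intro: S.add.l_inv_ex[simplified])
  then show ?thesis
    by (intro right_module.intro right_module_axioms.intro R.ring_axioms)
      (auto simp: module_via_def h S.l_distr S.r_distr S.m_assoc)
qed

lemma finsum_module_via: "finsum (module_via S \<eta>) = finsum S"
  by (intro ext) (simp add: finsum_def finprod_def module_via_def)

section \<open>Free covers and free resolutions\<close>

text \<open>The free module of coefficient functions, transported along an injection
  \<open>enc\<close>: all terms of a resolution have to share one type of elements, whereas the type
  of the functions grows at every stage.\<close>

definition free_on :: "('r, 'z) ring_scheme \<Rightarrow> 'b set \<Rightarrow> (('b \<Rightarrow> 'r) \<Rightarrow> 'p) \<Rightarrow> ('r, 'p) module" where
  "free_on R B enc = (let dec = inv_into (fin_supp R B) enc in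
     \<lparr>carrier = enc ` fin_supp R B, monoid.mult = undefined, one = undefined,
      ring.zero = enc (\<lambda>b\<in>B. \<zero>\<^bsub>R\<^esub>),
      add = (\<lambda>x y. enc (\<lambda>b\<in>B. dec x b \<oplus>\<^bsub>R\<^esub> dec y b)),
      module.smult = (\<lambda>r x. enc (\<lambda>b\<in>B. dec x b \<otimes>\<^bsub>R\<^esub> r))\<rparr>)"

locale encoded_free =
  fixes R :: "('r, 'z) ring_scheme" and B :: "'b set" and enc :: "('b \<Rightarrow> 'r) \<Rightarrow> 'p"
  assumes ring: "ring R" and nontrivial: "\<one>\<^bsub>R\<^esub> \<noteq> \<zero>\<^bsub>R\<^esub>" and inj: "inj_on enc (fin_supp R B)"
begin

abbreviation "F \<equiv> free_on R B enc"
abbreviation "FS \<equiv> fin_supp R B"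

definition unit :: "'b \<Rightarrow> 'b \<Rightarrow> 'r" where
  "unit b = (\<lambda>b'\<in>B. if b' = b then \<one>\<^bsub>R\<^esub> else \<zero>\<^bsub>R\<^esub>)"

lemma zero_FS: "(\<lambda>b\<in>B. \<zero>\<^bsub>R\<^esub>) \<in> FS" and unit_FS: "unit b \<in> FS"
proof -
  interpret ring R by (fact ring)
  show "(\<lambda>b\<in>B. \<zero>\<^bsub>R\<^esub>) \<in> FS" by (auto simp: fin_supp_def)
  have "{b' \<in> B. unit b b' \<noteq> \<zero>\<^bsub>R\<^esub>} \<subseteq> {b}" by (auto simp: unit_def)
  then show "unit b \<in> FS" using finite_subset by (auto simp: fin_supp_def unit_def)
qed

lemma carrier_F: "carrier F = enc ` FS"
  and zero_F: "\<zero>\<^bsub>F\<^esub> = enc (\<lambda>b\<in>B. \<zero>\<^bsub>R\<^esub>)"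
  and add_F: "c \<in> FS \<Longrightarrow> d \<in> FS \<Longrightarrow> enc c \<oplus>\<^bsub>F\<^esub> enc d = enc (\<lambda>b\<in>B. c b \<oplus>\<^bsub>R\<^esub> d b)"
  and smult_F: "c \<in> FS \<Longrightarrow> r \<odot>\<^bsub>F\<^esub> enc c = enc (\<lambda>b\<in>B. c b \<otimes>\<^bsub>R\<^esub> r)"
  by (simp_all add: free_on_def Let_def inv_into_f_f[OF inj])

lemma right_module_F: "right_module R F"
proof -
  interpret ring R by (fact ring)
  have FS: "c b \<in> carrier R" if "c \<in> FS" "b \<in> B" for c b
    using that by (auto simp: fin_supp_def)
  have ext: "c = restrict c B" if "c \<in> FS" for c
    using that by (auto simp: fin_supp_def PiE_iff extensional_restrict)
  note add_FS = fin_supp_add[OF ring] and mult_FS = fin_supp_mult[OF ring]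
  have grp: "abelian_group F"
  proof (rule abelian_groupI)
    fix x y assume "x \<in> carrier F" "y \<in> carrier F"
    then show "x \<oplus>\<^bsub>F\<^esub> y \<in> carrier F" by (auto simp: carrier_F add_F add_FS)
    show "x \<oplus>\<^bsub>F\<^esub> y = y \<oplus>\<^bsub>F\<^esub> x"
      using \<open>x \<in> carrier F\<close> \<open>y \<in> carrier F\<close>
      by (auto simp: carrier_F add_F FS a_comm intro!: arg_cong[where f = enc] restrict_ext)
  next
    show "\<zero>\<^bsub>F\<^esub> \<in> carrier F" by (simp add: carrier_F zero_F zero_FS)
  next
    fix x y z assume "x \<in> carrier F" "y \<in> carrier F" "z \<in> carrier F"
    then show "x \<oplus>\<^bsub>F\<^esub> y \<oplus>\<^bsub>F\<^esub> z = x \<oplus>\<^bsub>F\<^esub> (y \<oplus>\<^bsub>F\<^esub> z)"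
      by (auto simp: carrier_F add_F add_FS FS a_assoc intro!: arg_cong[where f = enc] restrict_ext)
  next
    fix x assume "x \<in> carrier F"
    then obtain c where c: "c \<in> FS" "x = enc c" by (auto simp: carrier_F)
    show "\<zero>\<^bsub>F\<^esub> \<oplus>\<^bsub>F\<^esub> x = x"
      unfolding c zero_F add_F[OF zero_FS c(1)]
      by (subst (2) ext[OF c(1)]) (intro arg_cong[where f = enc] restrict_ext, simp add: FS c)
    have "(\<lambda>b\<in>B. \<ominus>\<^bsub>R\<^esub> c b) \<in> FS"
    proof -
      have "{b \<in> B. (\<lambda>b\<in>B. \<ominus>\<^bsub>R\<^esub> c b) b \<noteq> \<zero>\<^bsub>R\<^esub>} \<subseteq> {b \<in> B. c b \<noteq> \<zero>\<^bsub>R\<^esub>}" by auto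
      then show ?thesis using c(1) by (auto simp: fin_supp_def PiE_iff intro: rev_finite_subset)
    qed
    moreover from this have "enc (\<lambda>b\<in>B. \<ominus>\<^bsub>R\<^esub> c b) \<oplus>\<^bsub>F\<^esub> x = \<zero>\<^bsub>F\<^esub>"
      unfolding c zero_F
      by (subst add_F[OF _ c(1)])
        (auto simp: FS[OF c(1)] l_neg intro!: arg_cong[where f = enc] restrict_ext)
    ultimately show "\<exists>y\<in>carrier F. y \<oplus>\<^bsub>F\<^esub> x = \<zero>\<^bsub>F\<^esub>"
      by (auto simp: carrier_F)
  qed
  show ?thesis
  proof (intro right_module.intro ring grp right_module_axioms.intro)
    fix r x assume "r \<in> carrier R" "x \<in> carrier F"
    then show "r \<odot>\<^bsub>F\<^esub> x \<in> carrier F" by (auto simp: carrier_F smult_F mult_FS)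
  next
    fix r s x assume "r \<in> carrier R" "s \<in> carrier R" "x \<in> carrier F"
    then show "(r \<oplus>\<^bsub>R\<^esub> s) \<odot>\<^bsub>F\<^esub> x = r \<odot>\<^bsub>F\<^esub> x \<oplus>\<^bsub>F\<^esub> s \<odot>\<^bsub>F\<^esub> x"
      and "(r \<otimes>\<^bsub>R\<^esub> s) \<odot>\<^bsub>F\<^esub> x = s \<odot>\<^bsub>F\<^esub> (r \<odot>\<^bsub>F\<^esub> x)"
      by (auto simp: carrier_F smult_F add_F mult_FS FS r_distr m_assoc
          intro!: arg_cong[where f = enc] restrict_ext)
  next
    fix r x y assume "r \<in> carrier R" "x \<in> carrier F" "y \<in> carrier F"
    then show "r \<odot>\<^bsub>F\<^esub> (x \<oplus>\<^bsub>F\<^esub> y) = r \<odot>\<^bsub>F\<^esub> x \<oplus>\<^bsub>F\<^esub> r \<odot>\<^bsub>F\<^esub> y"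
      by (auto simp: carrier_F smult_F add_F mult_FS add_FS FS l_distr
          intro!: arg_cong[where f = enc] restrict_ext)
  next
    fix x assume "x \<in> carrier F"
    then obtain c where c: "c \<in> FS" "x = enc c" by (auto simp: carrier_F)
    show "\<one>\<^bsub>R\<^esub> \<odot>\<^bsub>F\<^esub> x = x"
      unfolding c smult_F[OF c(1)]
      by (subst (2) ext[OF c(1)]) (intro arg_cong[where f = enc] restrict_ext, simp add: FS c)
  qed
qed

lemma finsum_F:
  assumes "finite S" "S \<subseteq> B" "c \<in> S \<rightarrow> carrier R"
  shows "(\<Oplus>\<^bsub>F\<^esub>b\<in>S. c b \<odot>\<^bsub>F\<^esub> enc (unit b)) = enc (\<lambda>b\<in>B. if b \<in> S then c b else \<zero>\<^bsub>R\<^esub>)"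
proof -
  interpret M: right_module R F by (fact right_module_F)
  have supp: "(\<lambda>b\<in>B. if b \<in> S then c b else \<zero>\<^bsub>R\<^esub>) \<in> FS"
    if "finite S" "c \<in> S \<rightarrow> carrier R" for S
  proof -
    have "{b \<in> B. (\<lambda>b\<in>B. if b \<in> S then c b else \<zero>\<^bsub>R\<^esub>) b \<noteq> \<zero>\<^bsub>R\<^esub>} \<subseteq> S" by auto
    then show ?thesis using that finite_subset by (auto simp: fin_supp_def Pi_iff)
  qed
  have cl: "c b \<odot>\<^bsub>F\<^esub> enc (unit b) \<in> carrier F" if "c b \<in> carrier R" for b
    using that unit_FS by (intro M.smult_closed) (auto simp: carrier_F)
  show ?thesis using assms
  proof (induction S rule: finite_induct)
    case empty
    then show ?case by (simp add: zero_F restrict_def)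
  next
    case (insert a S)
    have "(\<Oplus>\<^bsub>F\<^esub>b\<in>insert a S. c b \<odot>\<^bsub>F\<^esub> enc (unit b))
      = enc (\<lambda>b\<in>B. unit a b \<otimes>\<^bsub>R\<^esub> c a) \<oplus>\<^bsub>F\<^esub> enc (\<lambda>b\<in>B. if b \<in> S then c b else \<zero>\<^bsub>R\<^esub>)"
      using insert cl by (simp add: Pi_iff smult_F unit_FS restrict_def)
    also have "\<dots> = enc (\<lambda>b\<in>B. (\<lambda>b\<in>B. unit a b \<otimes>\<^bsub>R\<^esub> c a) b \<oplus>\<^bsub>R\<^esub> (\<lambda>b\<in>B. if b \<in> S then c b else \<zero>\<^bsub>R\<^esub>) b)"
      using insert by (intro add_F supp fin_supp_mult ring unit_FS) auto
    also have "\<dots> = enc (\<lambda>b\<in>B. if b \<in> insert a S then c b else \<zero>\<^bsub>R\<^esub>)"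
      using insert by (auto intro!: arg_cong[where f = enc] restrict_ext simp: unit_def Pi_iff)
    finally show ?case .
  qed
qed

lemma enc_unit_inj: "inj_on (\<lambda>b. enc (unit b)) B"
proof
  fix a b assume ab: "a \<in> B" "b \<in> B" "enc (unit a) = enc (unit b)"
  then have "unit a = unit b" using inj unit_FS by (auto dest: inj_onD)
  then have "unit a a = unit b a" by simp
  then show "a = b" using ab nontrivial by (auto simp: unit_def split: if_splits)
qed

text \<open>A basis is a subset of the module, so coordinates are indexed by the encoded unit
  vectors and not by \<open>B\<close>; the proof translates between the two along the injection
  \<open>\<lambda>b. enc (unit b)\<close>.\<close>

lemma free_module_F: "free_module R F"
proof -
  interpret M: right_module R F by (fact right_module_F)
  let ?e = "\<lambda>b. enc (unit b)"
  let ?E = "?e ` B"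
  have lc: "lin_comb R F ?E (\<lambda>x. x) c = enc (\<lambda>b\<in>B. c (?e b))" if c: "c \<in> fin_supp R ?E" for c
  proof -
    let ?S = "{b \<in> B. c (?e b) \<noteq> \<zero>\<^bsub>R\<^esub>}"
    have eq: "{x \<in> ?E. c x \<noteq> \<zero>\<^bsub>R\<^esub>} = ?e ` ?S" by auto
    have inj': "inj_on ?e ?S" using enc_unit_inj by (rule inj_on_subset) auto
    have fin: "finite ?S"
      using c finite_imageD[OF _ inj'] by (simp add: fin_supp_def flip: eq)
    have cR: "c (?e b) \<in> carrier R" if "b \<in> B" for b using c that by (auto simp: fin_supp_def)
    have "lin_comb R F ?E (\<lambda>x. x) c = (\<Oplus>\<^bsub>F\<^esub>b\<in>?S. c (?e b) \<odot>\<^bsub>F\<^esub> ?e b)"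
      unfolding lin_comb_def eq using cR unit_FS
      by (subst M.M.finsum_reindex[OF _ inj']) (auto intro!: M.smult_closed simp: carrier_F[THEN eqset_imp_iff])
    also have "\<dots> = enc (\<lambda>b\<in>B. if b \<in> ?S then c (?e b) else \<zero>\<^bsub>R\<^esub>)"
      using fin cR by (intro finsum_F) auto
    also have "\<dots> = enc (\<lambda>b\<in>B. c (?e b))"
      by (intro arg_cong[where f = enc] restrict_ext) auto
    finally show ?thesis .
  qed
  have "\<exists>!c. c \<in> fin_supp R ?E \<and> x = lin_comb R F ?E (\<lambda>x. x) c" if x: "x \<in> carrier F" for x
  proof -
    obtain d where d: "d \<in> FS" "x = enc d" using x by (auto simp: carrier_F)
    define c where "c = (\<lambda>y\<in>?E. d (inv_into B ?e y))"
    have ce: "c (?e b) = d b" if "b \<in> B" for b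
      using inv_into_f_f[OF enc_unit_inj that] that by (simp add: c_def)
    have "c \<in> fin_supp R ?E"
    proof -
      have eq: "{x \<in> ?E. c x \<noteq> \<zero>\<^bsub>R\<^esub>} = ?e ` {b \<in> B. d b \<noteq> \<zero>\<^bsub>R\<^esub>}" using ce by auto
      have "c \<in> ?E \<rightarrow>\<^sub>E carrier R"
        using d ce by (auto simp: fin_supp_def PiE_iff) (simp add: c_def)
      then show ?thesis using d(1) by (simp add: fin_supp_def eq)
    qed
    moreover have "enc (\<lambda>b\<in>B. c (?e b)) = x"
      using d ce by (auto intro!: arg_cong[where f = enc] simp: fin_supp_def PiE_iff extensional_def)
    moreover have "c' = c" if c': "c' \<in> fin_supp R ?E" "x = enc (\<lambda>b\<in>B. c' (?e b))" for c'
    proof -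
      have "(\<lambda>b\<in>B. c' (?e b)) \<in> FS"
      proof -
        have eq: "{x \<in> ?E. c' x \<noteq> \<zero>\<^bsub>R\<^esub>} = ?e ` {b \<in> B. c' (?e b) \<noteq> \<zero>\<^bsub>R\<^esub>}" by auto
        have "finite {b \<in> B. c' (?e b) \<noteq> \<zero>\<^bsub>R\<^esub>}"
          using c'(1) finite_imageD[OF _ inj_on_subset[OF enc_unit_inj, of "{b \<in> B. c' (?e b) \<noteq> \<zero>\<^bsub>R\<^esub>}"]]
          by (simp add: fin_supp_def flip: eq)
        moreover have "{b \<in> B. (\<lambda>b\<in>B. c' (?e b)) b \<noteq> \<zero>\<^bsub>R\<^esub>} = {b \<in> B. c' (?e b) \<noteq> \<zero>\<^bsub>R\<^esub>}" by auto
        ultimately show ?thesis using c'(1) by (auto simp: fin_supp_def)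
      qed
      then have "(\<lambda>b\<in>B. c' (?e b)) = d" using c'(2) d by (intro inj_onD[OF inj]) auto
      then have eq: "c' (?e b) = c (?e b)" if "b \<in> B" for b
        using ce[OF that] that by (metis (mono_tags, lifting) restrict_apply')
      show ?thesis
      proof (rule extensionalityI[of _ ?E])
        show "c' \<in> extensional ?E" using c'(1) by (simp add: fin_supp_def PiE_iff)
        show "c \<in> extensional ?E" by (simp add: c_def)
        fix x assume "x \<in> ?E"
        then obtain b where "b \<in> B" "x = ?e b" by (rule imageE)
        then show "c' x = c x" using eq by simp
      qed
    qed
    ultimately show ?thesis
    proof (intro ex1I[of _ c])
      assume c: "c \<in> fin_supp R ?E" "enc (\<lambda>b\<in>B. c (?e b)) = x"
      show "c \<in> fin_supp R ?E \<and> x = lin_comb R F ?E (\<lambda>x. x) c"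
        unfolding lc[OF c(1)] using c by simp
    next
      fix c'
      assume *: "\<And>c'. c' \<in> fin_supp R ?E \<Longrightarrow> x = enc (\<lambda>b\<in>B. c' (?e b)) \<Longrightarrow> c' = c"
        and c': "c' \<in> fin_supp R ?E \<and> x = lin_comb R F ?E (\<lambda>x. x) c'"
      show "c' = c" using *[of c'] c' unfolding lc[OF conjunct1[OF c']] by blast
    qed
  qed
  then show ?thesis
    unfolding free_module_def module_basis_iff using right_module_F unit_FS
    by (intro conjI exI[of _ ?E]) (auto simp: carrier_F)
qed

end

text \<open>The generators are all elements of \<open>M\<close>, and the unit vector of
  \<open>x\<close> is sent to \<open>x\<close>. Since \<open>\<one> \<noteq> \<zero>\<close>, the
  support of that vector is exactly \<open>{x}\<close>.\<close>

lemma free_cover: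
  fixes enc :: "('m \<Rightarrow> 'r) \<Rightarrow> 'p"
  assumes M: "right_module R M" and nt: "\<one>\<^bsub>R\<^esub> \<noteq> \<zero>\<^bsub>R\<^esub>" and inj: "inj_on enc (fin_supp R (carrier M))"
  shows "\<exists>(P :: ('r, 'p) module) \<epsilon>. free_module R P \<and> \<epsilon> \<in> mod_hom R P M \<and> \<epsilon> ` carrier P = carrier M"
proof -
  interpret M: right_module R M by fact
  interpret encoded_free R "carrier M" enc
    using M.R.ring_axioms nt inj by unfold_locales
  define \<epsilon> where "\<epsilon> = (\<lambda>x\<in>carrier F. lin_comb R M (carrier M) (\<lambda>x. x) (inv_into FS enc x))"
  have id: "(\<lambda>x. x) \<in> carrier M \<rightarrow> carrier M" by auto
  have e: "\<epsilon> (enc c) = lin_comb R M (carrier M) (\<lambda>x. x) c" if "c \<in> FS" for c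
    using that by (simp add: \<epsilon>_def carrier_F inv_into_f_f[OF inj])
  have "\<epsilon> \<in> mod_hom R F M"
  proof (rule mod_homI)
    show "\<epsilon> \<in> carrier F \<rightarrow>\<^sub>E carrier M"
      using e lin_comb_closed[OF M _ id] by (auto simp: carrier_F) (simp add: \<epsilon>_def carrier_F)
  next
    fix x y assume "x \<in> carrier F" "y \<in> carrier F"
    then show "\<epsilon> (x \<oplus>\<^bsub>F\<^esub> y) = \<epsilon> x \<oplus>\<^bsub>M\<^esub> \<epsilon> y"
      by (auto simp: carrier_F add_F e fin_supp_add[OF M.R.ring_axioms] lin_comb_add[OF M _ _ id])
  next
    fix r x assume "r \<in> carrier R" "x \<in> carrier F"
    then show "\<epsilon> (r \<odot>\<^bsub>F\<^esub> x) = r \<odot>\<^bsub>M\<^esub> \<epsilon> x"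
      by (auto simp: carrier_F smult_F e fin_supp_mult[OF M.R.ring_axioms] lin_comb_smult[OF M _ _ id])
  qed
  moreover have "x \<in> \<epsilon> ` carrier F" if x: "x \<in> carrier M" for x
  proof -
    have "{b \<in> carrier M. unit x b \<noteq> \<zero>\<^bsub>R\<^esub>} = {x}" using x nt by (auto simp: unit_def)
    then have "\<epsilon> (enc (unit x)) = unit x x \<odot>\<^bsub>M\<^esub> x"
      using x by (simp add: e unit_FS lin_comb_def) (simp add: unit_def M.smult_closed)
    then have "x = \<epsilon> (enc (unit x))" using x by (simp add: unit_def M.smult_one)
    then show ?thesis by (rule image_eqI) (simp add: unit_FS carrier_F)
  qed
  ultimately show ?thesis
    using free_module_F mod_homD(1)[of \<epsilon> R F M] by blast
qed

text \<open>
  A self-delimiting code of lists of lists: it keeps all terms of a resolution within the type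
  \<open>('m \<times> 'r) list\<close> prescribed by \<open>Ext\<close>.
\<close>

fun flatten :: "'a \<Rightarrow> 'a \<Rightarrow> 'a list list \<Rightarrow> 'a list" where
  "flatten a b [] = []"
| "flatten a b (xs # xss) = concat (map (\<lambda>x. [a, x]) xs) @ b # flatten a b xss"

text \<open>The code is read two symbols at a time: \<open>a\<close> announces one more entry,
  \<open>b\<close> closes the block. An entry may itself equal \<open>a\<close> or \<open>b\<close>,
  but it stands where no marker is expected.\<close>

lemma flatten_block:
  assumes "a \<noteq> b"
  shows "concat (map (\<lambda>x. [a, x]) xs) @ b # us = concat (map (\<lambda>x. [a, x]) ys) @ b # vs
    \<Longrightarrow> xs = ys \<and> us = vs"
proof (induction xs arbitrary: ys)
  case Nil
  then show ?case using assms by (cases ys) auto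
next
  case (Cons x xs)
  then show ?case using assms by (cases ys) auto
qed

lemma flatten_inj:
  assumes "a \<noteq> b"
  shows "flatten a b xss = flatten a b yss \<Longrightarrow> xss = yss"
proof (induction xss arbitrary: yss)
  case Nil
  then show ?case by (cases yss) auto
next
  case (Cons xs xss)
  then obtain ys yss' where yss: "yss = ys # yss'" by (cases yss) auto
  from flatten_block[OF assms, of xs "flatten a b xss" ys "flatten a b yss'"] Cons.prems
  have "xs = ys" "flatten a b xss = flatten a b yss'" by (simp_all add: yss)
  then show ?case using Cons.IH by (simp add: yss)
qed

text \<open>A list enumerating the graph over the support determines the function: off the support
  the value is \<open>\<zero>\<close>, and outside \<open>B\<close> extensionality fixes it.\<close>

lemma fin_supp_encode: "\<exists>enc :: ('b \<Rightarrow> 'r) \<Rightarrow> ('b \<times> 'r) list. inj_on enc (fin_supp R B)"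
proof -
  let ?g = "\<lambda>c. (\<lambda>b. (b, c b)) ` {b \<in> B. c b \<noteq> \<zero>\<^bsub>R\<^esub>}"
  define enc where "enc c = (SOME xs. set xs = ?g c)" for c
  have enc: "set (enc c) = ?g c" if "c \<in> fin_supp R B" for c
    unfolding enc_def by (rule someI_ex, rule finite_list) (use that in \<open>simp add: fin_supp_def\<close>)
  have "c = d" if cd: "c \<in> fin_supp R B" "d \<in> fin_supp R B" "enc c = enc d" for c d
  proof (rule extensionalityI[of _ B])
    fix b assume "b \<in> B"
    have "?g c = ?g d" using enc[OF cd(1)] enc[OF cd(2)] cd(3) by simp
    then have "(b, c b) \<in> ?g d \<or> c b = \<zero>\<^bsub>R\<^esub>" "(b, d b) \<in> ?g c \<or> d b = \<zero>\<^bsub>R\<^esub>"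
      using \<open>b \<in> B\<close> by blast+
    then show "c b = d b" by auto
  qed (use cd in \<open>auto simp: fin_supp_def PiE_iff\<close>)
  then show ?thesis by (intro exI[of _ enc] inj_onI)
qed

lemma right_module_subset:
  assumes "right_module R M" "K \<subseteq> carrier M" "\<zero>\<^bsub>M\<^esub> \<in> K"
    "\<And>x y. x \<in> K \<Longrightarrow> y \<in> K \<Longrightarrow> x \<oplus>\<^bsub>M\<^esub> y \<in> K"
    "\<And>r x. r \<in> carrier R \<Longrightarrow> x \<in> K \<Longrightarrow> r \<odot>\<^bsub>M\<^esub> x \<in> K"
  shows "right_module R (M\<lparr>carrier := K\<rparr>)"
proof -
  interpret M: right_module R M by fact
  have sub: "x \<in> K \<Longrightarrow> x \<in> carrier M" for x using assms(2) by auto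
  \<comment> \<open>Negatives come from the action of \<open>-1\<close>.\<close>
  have neg: "\<exists>y\<in>K. y \<oplus>\<^bsub>M\<^esub> x = \<zero>\<^bsub>M\<^esub>" if "x \<in> K" for x
  proof -
    have "(\<ominus>\<^bsub>R\<^esub> \<one>\<^bsub>R\<^esub>) \<odot>\<^bsub>M\<^esub> x \<oplus>\<^bsub>M\<^esub> \<one>\<^bsub>R\<^esub> \<odot>\<^bsub>M\<^esub> x = \<zero>\<^bsub>M\<^esub>"
      using sub[OF that] by (simp add: M.R.l_neg M.zero_smult flip: M.smult_add_scalar)
    then show ?thesis using assms(5) that sub by (metis M.R.a_inv_closed M.R.one_closed M.smult_one)
  qed
  have "abelian_group (M\<lparr>carrier := K\<rparr>)"
    by (rule abelian_groupI) (use assms(3,4) sub neg in \<open>auto simp: M.M.a_ac\<close>)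
  then show ?thesis
    by (intro right_module.intro M.R.ring_axioms right_module_axioms.intro)
      (use assms(5) sub in \<open>auto simp: M.smult_add M.smult_add_scalar M.smult_mult M.smult_one\<close>)
qed

definition hom_ker :: "('r, 'm) module \<Rightarrow> ('r, 'n) module \<Rightarrow> ('m \<Rightarrow> 'n) \<Rightarrow> 'm set" where
  "hom_ker M N f = {x \<in> carrier M. f x = \<zero>\<^bsub>N\<^esub>}"

lemma right_module_ker:
  assumes "right_module R M" "right_module R N" "f \<in> mod_hom R M N"
  shows "right_module R (M\<lparr>carrier := hom_ker M N f\<rparr>)"
proof -
  interpret M: right_module R M by fact
  interpret N: right_module R N by fact
  show ?thesis
    using mod_hom_zero[OF assms] mod_homD[OF assms(3)]
    by (intro right_module_subset assms) (auto simp: hom_ker_def M.smult_closed N.smult_zero)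
qed

text \<open>The homomorphism theorem for the surjection \<open>\<epsilon>\<close>. The section
  \<open>s\<close> is only a map of sets; \<open>f\<close> composed with it is linear because
  \<open>f\<close> does not see the kernel.\<close>

lemma mod_hom_factor:
  assumes P: "right_module R P" and M: "right_module R M" and N: "right_module R N"
    and e: "\<epsilon> \<in> mod_hom R P M" "\<epsilon> ` carrier P = carrier M"
    and f: "f \<in> mod_hom R P N" "\<And>k. k \<in> hom_ker P M \<epsilon> \<Longrightarrow> f k = \<zero>\<^bsub>N\<^esub>"
  shows "\<exists>h \<in> mod_hom R M N. \<forall>x \<in> carrier P. h (\<epsilon> x) = f x"
proof -
  interpret P: right_module R P by fact
  interpret M: right_module R M by fact
  interpret N: right_module R N by fact
  interpret e: abelian_group_hom P M \<epsilon> by (rule mod_hom_group_hom[OF P M e(1)])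
  interpret f: abelian_group_hom P N f by (rule mod_hom_group_hom[OF P N f(1)])
  note De = mod_homD(1-3)[OF e(1)] and Df = mod_homD(1-3)[OF f(1)]
  have wd: "f x = f y" if xy: "x \<in> carrier P" "y \<in> carrier P" "\<epsilon> x = \<epsilon> y" for x y
  proof -
    have "f (x \<ominus>\<^bsub>P\<^esub> y) = \<zero>\<^bsub>N\<^esub>"
      using xy by (intro f(2)) (simp add: hom_ker_def P.M.minus_eq M.M.r_neg)
    then have "f x \<oplus>\<^bsub>N\<^esub> \<ominus>\<^bsub>N\<^esub> f y = \<zero>\<^bsub>N\<^esub>"
      using xy by (simp add: P.M.minus_eq)
    then show ?thesis using xy Df by (metis N.M.minus_equality N.M.minus_minus N.M.a_inv_closed)
  qed
  define s where "s x = (SOME y. y \<in> carrier P \<and> \<epsilon> y = x)" for x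
  have s: "s x \<in> carrier P" "\<epsilon> (s x) = x" if "x \<in> carrier M" for x
  proof -
    have "\<exists>y. y \<in> carrier P \<and> \<epsilon> y = x" using that unfolding e(2)[symmetric] by auto
    from someI_ex[OF this] show "s x \<in> carrier P" "\<epsilon> (s x) = x" unfolding s_def by auto
  qed
  have "(\<lambda>x\<in>carrier M. f (s x)) \<in> mod_hom R M N"
  proof (rule mod_homI)
    show "(\<lambda>x\<in>carrier M. f (s x)) \<in> carrier M \<rightarrow>\<^sub>E carrier N" using s Df by auto
  next
    fix x y assume xy: "x \<in> carrier M" "y \<in> carrier M"
    have "f (s (x \<oplus>\<^bsub>M\<^esub> y)) = f (s x \<oplus>\<^bsub>P\<^esub> s y)"
      using xy s by (intro wd) auto
    then show "(\<lambda>x\<in>carrier M. f (s x)) (x \<oplus>\<^bsub>M\<^esub> y) = (\<lambda>x\<in>carrier M. f (s x)) x \<oplus>\<^bsub>N\<^esub> (\<lambda>x\<in>carrier M. f (s x)) y"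
      using xy s by simp
  next
    fix r x assume xy: "r \<in> carrier R" "x \<in> carrier M"
    have "f (s (r \<odot>\<^bsub>M\<^esub> x)) = f (r \<odot>\<^bsub>P\<^esub> s x)"
      using xy s De by (intro wd) (auto simp: M.smult_closed P.smult_closed)
    then show "(\<lambda>x\<in>carrier M. f (s x)) (r \<odot>\<^bsub>M\<^esub> x) = r \<odot>\<^bsub>N\<^esub> (\<lambda>x\<in>carrier M. f (s x)) x"
      using xy s Df by (simp add: M.smult_closed)
  qed
  moreover have "f (s (\<epsilon> x)) = f x" if "x \<in> carrier P" for x
    using that s De by (intro wd) auto
  ultimately show ?thesis
    using De(1) by (intro bexI[of _ "\<lambda>x\<in>carrier M. f (s x)"]) auto
qed

text \<open>\<open>Ext\<close> picks a resolution by \<open>SOME\<close>, so its properties are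
  available only once one exists on the prescribed type. Each kernel is covered by the free module
  on all its elements, recoded into the same type of lists.\<close>

lemma free_resolution_exists:
  fixes R :: "('r, 'z) ring_scheme" and M :: "('r, 'm) module"
  assumes M: "right_module R M" and nt: "\<one>\<^bsub>R\<^esub> \<noteq> \<zero>\<^bsub>R\<^esub>"
  shows "\<exists>(P :: nat \<Rightarrow> ('r, ('m \<times> 'r) list) module) d \<epsilon>. free_resolution R M P d \<epsilon>"
proof -
  \<comment> \<open>The two markers of the code; they differ because
    \<open>\<one> \<noteq> \<zero>\<close>, whatever the type \<open>'m\<close> is.\<close>
  let ?a = "(undefined, \<one>\<^bsub>R\<^esub>) :: 'm \<times> 'r" and ?b = "(undefined, \<zero>\<^bsub>R\<^esub>) :: 'm \<times> 'r"
  have ab: "?a \<noteq> ?b" using nt by simp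
  have cover: "\<exists>(P' :: ('r, ('m \<times> 'r) list) module) \<epsilon>.
      free_module R P' \<and> \<epsilon> \<in> mod_hom R P' P \<and> \<epsilon> ` carrier P' = carrier P"
    if P: "right_module R P" for P :: "('r, ('m \<times> 'r) list) module"
  proof -
    obtain enc :: "(('m \<times> 'r) list \<Rightarrow> 'r) \<Rightarrow> (('m \<times> 'r) list \<times> 'r) list"
      where enc: "inj_on enc (fin_supp R (carrier P))" using fin_supp_encode by blast
    \<comment> \<open>An entry of the graph pairs a list \<open>l\<close> with a coefficient
      \<open>r\<close>. Prepending \<open>r\<close>, in a pair with a dummy first component, makes
      it one list, and the list of these lists is flattened to a single one of the original
      type.\<close>
    have "inj_on (\<lambda>c. flatten ?a ?b (map (\<lambda>(l, r). (undefined, r) # l) (enc c))) (fin_supp R (carrier P))"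
    proof (rule inj_onI)
      fix c d assume cd: "c \<in> fin_supp R (carrier P)" "d \<in> fin_supp R (carrier P)"
        "flatten ?a ?b (map (\<lambda>(l, r). (undefined, r) # l) (enc c))
          = flatten ?a ?b (map (\<lambda>(l, r). (undefined, r) # l) (enc d))"
      have "inj (\<lambda>(l, r). (undefined :: 'm, r :: 'r) # l)" by (auto intro: injI)
      then have "enc c = enc d"
        using flatten_inj[OF ab cd(3)] by (metis inj_map_eq_map)
      then show "c = d" using enc cd by (auto dest: inj_onD)
    qed
    from free_cover[OF P nt this] show ?thesis .
  qed
  obtain enc :: "('m \<Rightarrow> 'r) \<Rightarrow> ('m \<times> 'r) list" where enc: "inj_on enc (fin_supp R (carrier M))"
    using fin_supp_encode by blast
  obtain P0 :: "('r, ('m \<times> 'r) list) module" and \<epsilon> where P0: "free_module R P0"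
    "\<epsilon> \<in> mod_hom R P0 M" "\<epsilon> ` carrier P0 = carrier M"
    using free_cover[OF M nt enc] by blast
  have P0': "right_module R P0" using P0(1) by (simp add: free_module_def)
  \<comment> \<open>A state of the recursion holds a term of the resolution, the kernel that the
    next term has to cover, and the differential leaving this term. The kernel is required to be a
    module because it is the next object to be covered.\<close>
  define Q where "Q i x = (case x of (P, K, d) \<Rightarrow> free_module R P \<and> K \<subseteq> carrier P \<and>
      right_module R (P\<lparr>carrier := K\<rparr>) \<and> (i = (0::nat) \<longrightarrow> P = P0 \<and> K = hom_ker P0 M \<epsilon>))"
    for i and x :: "('r, ('m \<times> 'r) list) module \<times> ('m \<times> 'r) list set \<times> (('m \<times> 'r) list \<Rightarrow> ('m \<times> 'r) list)"
  define S where "S i x y = (case x of (P, K, d) \<Rightarrow> case y of (P', K', d') \<Rightarrow>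
      d' \<in> mod_hom R P' P \<and> d' ` carrier P' = K \<and> K' = hom_ker P' P d')"
    for i :: nat and x y :: "('r, ('m \<times> 'r) list) module \<times> ('m \<times> 'r) list set \<times> (('m \<times> 'r) list \<Rightarrow> ('m \<times> 'r) list)"
  have "\<exists>f. \<forall>n. Q n (f n) \<and> S n (f n) (f (Suc n))"
  proof (rule dependent_nat_choice)
    show "\<exists>x. Q 0 x"
      using P0 right_module_ker[OF P0' M P0(2)]
      by (intro exI[of _ "(P0, hom_ker P0 M \<epsilon>, undefined)"]) (auto simp: Q_def hom_ker_def)
  next
    fix x n assume "Q n x"
    then obtain P K d where x: "x = (P, K, d)" and Q: "free_module R P" "K \<subseteq> carrier P"
      "right_module R (P\<lparr>carrier := K\<rparr>)" by (cases x) (auto simp: Q_def)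
    have P: "right_module R P" using Q(1) by (simp add: free_module_def)
    obtain P' \<delta> where P': "free_module R (P' :: ('r, ('m \<times> 'r) list) module)"
      "\<delta> \<in> mod_hom R P' (P\<lparr>carrier := K\<rparr>)" "\<delta> ` carrier P' = K"
      using cover[OF Q(3)] by auto
    have \<delta>: "\<delta> \<in> mod_hom R P' P" using P'(2) Q(2) by (auto simp: mod_hom_def PiE_iff)
    have "right_module R P'" using P'(1) by (simp add: free_module_def)
    then have "Q (Suc n) (P', hom_ker P' P \<delta>, \<delta>)"
      using P'(1) right_module_ker[OF _ P \<delta>] by (auto simp: Q_def hom_ker_def)
    moreover have "S n x (P', hom_ker P' P \<delta>, \<delta>)" using P' \<delta> by (simp add: S_def x)
    ultimately show "\<exists>y. Q (Suc n) y \<and> S n x y" by blast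
  qed
  then obtain f where f: "\<And>n. Q n (f n)" "\<And>n. S n (f n) (f (Suc n))" by blast
  define P where "P n = fst (f n)" for n
  define K where "K n = fst (snd (f n))" for n
  \<comment> \<open>The differential stored in state \<open>Suc n\<close> leaves
    \<open>P (Suc n)\<close>; in the indexing of resolutions it is \<open>d n\<close>.\<close>
  define d where "d n = snd (snd (f (Suc n)))" for n
  have Q: "free_module R (P n)" "n = 0 \<Longrightarrow> P n = P0 \<and> K n = hom_ker P0 M \<epsilon>" for n
    using f(1)[of n] by (auto simp: Q_def P_def K_def split: prod.splits)
  have S: "d n \<in> mod_hom R (P (Suc n)) (P n)" "d n ` carrier (P (Suc n)) = K n"
    "K (Suc n) = hom_ker (P (Suc n)) (P n) (d n)" for n
    using f(2)[of n] by (auto simp: S_def P_def K_def d_def split: prod.splits)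
  have "free_resolution R M P d \<epsilon>"
    unfolding free_resolution_def using Q(1) S P0 Q(2)[of 0] S(2)[of 0] S(2)[of "Suc i" for i]
    by (auto simp: hom_ker_def)
  then show ?thesis by blast
qed

section \<open>Ext in degrees zero and one\<close>

lemma group_hom_group:
  assumes M: "right_module R M" and N: "right_module R N"
  shows "comm_group (hom_group R M N)"
proof -
  interpret M: right_module R M by fact
  interpret N: right_module R N by fact
  note D = mod_homD(1-3)
  have m: "f \<otimes>\<^bsub>hom_group R M N\<^esub> g = (\<lambda>x\<in>carrier M. f x \<oplus>\<^bsub>N\<^esub> g x)" for f g
    by (simp add: hom_group_def)
  have c: "carrier (hom_group R M N) = mod_hom R M N" by (simp add: hom_group_def)
  have o: "\<one>\<^bsub>hom_group R M N\<^esub> = (\<lambda>x\<in>carrier M. \<zero>\<^bsub>N\<^esub>)" by (simp add: hom_group_def)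
  show ?thesis
  proof (rule comm_groupI, unfold m c o)
    fix f g assume f: "f \<in> mod_hom R M N" and g: "g \<in> mod_hom R M N"
    show "(\<lambda>x\<in>carrier M. f x \<oplus>\<^bsub>N\<^esub> g x) \<in> mod_hom R M N"
      using D[OF f] D[OF g]
      by (intro mod_homI) (auto simp: M.smult_closed N.smult_add N.M.a_ac)
    show "(\<lambda>x\<in>carrier M. f x \<oplus>\<^bsub>N\<^esub> g x) = (\<lambda>x\<in>carrier M. g x \<oplus>\<^bsub>N\<^esub> f x)"
      using D[OF f] D[OF g] by (auto intro!: restrict_ext simp: N.M.a_comm)
  next
    fix f g h assume "f \<in> mod_hom R M N" "g \<in> mod_hom R M N" "h \<in> mod_hom R M N"
    note D = this[THEN D(1)]
    show "(\<lambda>x\<in>carrier M. (\<lambda>x\<in>carrier M. f x \<oplus>\<^bsub>N\<^esub> g x) x \<oplus>\<^bsub>N\<^esub> h x)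
      = (\<lambda>x\<in>carrier M. f x \<oplus>\<^bsub>N\<^esub> (\<lambda>x\<in>carrier M. g x \<oplus>\<^bsub>N\<^esub> h x) x)"
      by (intro restrict_ext) (simp add: D N.M.a_assoc)
  next
    show "(\<lambda>x\<in>carrier M. \<zero>\<^bsub>N\<^esub>) \<in> mod_hom R M N"
      by (intro mod_homI) (auto simp: M.smult_closed N.smult_zero)
  next
    fix f assume f: "f \<in> mod_hom R M N"
    show "(\<lambda>x\<in>carrier M. (\<lambda>x\<in>carrier M. \<zero>\<^bsub>N\<^esub>) x \<oplus>\<^bsub>N\<^esub> f x) = f"
      using D[OF f] mod_homD(4)[OF f] by (intro extensionalityI[of _ "carrier M"]) auto
    have "(\<lambda>x\<in>carrier M. \<ominus>\<^bsub>N\<^esub> f x) \<in> mod_hom R M N"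
    proof (intro mod_homI)
      fix r x assume rx: "r \<in> carrier R" "x \<in> carrier M"
      have "r \<odot>\<^bsub>N\<^esub> (\<ominus>\<^bsub>N\<^esub> f x) \<oplus>\<^bsub>N\<^esub> r \<odot>\<^bsub>N\<^esub> f x = \<zero>\<^bsub>N\<^esub>"
        using rx D[OF f] by (simp add: N.M.l_neg N.smult_zero flip: N.smult_add)
      then have "\<ominus>\<^bsub>N\<^esub> (r \<odot>\<^bsub>N\<^esub> f x) = r \<odot>\<^bsub>N\<^esub> (\<ominus>\<^bsub>N\<^esub> f x)"
        using rx D[OF f] by (intro N.M.minus_equality) (auto simp: N.smult_closed)
      then show "(\<lambda>x\<in>carrier M. \<ominus>\<^bsub>N\<^esub> f x) (r \<odot>\<^bsub>M\<^esub> x) = r \<odot>\<^bsub>N\<^esub> (\<lambda>x\<in>carrier M. \<ominus>\<^bsub>N\<^esub> f x) x"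
        using rx D[OF f] by (simp add: M.smult_closed)
    qed (use D[OF f] in \<open>auto simp: N.M.minus_add\<close>)
    moreover have "(\<lambda>x\<in>carrier M. (\<lambda>x\<in>carrier M. \<ominus>\<^bsub>N\<^esub> f x) x \<oplus>\<^bsub>N\<^esub> f x) = (\<lambda>x\<in>carrier M. \<zero>\<^bsub>N\<^esub>)"
      using D[OF f] by (intro restrict_ext) (simp add: N.M.l_neg)
    ultimately show "\<exists>f'\<in>mod_hom R M N. (\<lambda>x\<in>carrier M. f' x \<oplus>\<^bsub>N\<^esub> f x) = (\<lambda>x\<in>carrier M. \<zero>\<^bsub>N\<^esub>)"
      by (intro bexI[of _ "\<lambda>x\<in>carrier M. \<ominus>\<^bsub>N\<^esub> f x"])
  qed
qed

lemma precompose_group_hom: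
  assumes P: "right_module R P" and Q: "right_module R Q" and N: "right_module R N" and d: "d \<in> mod_hom R Q P"
  shows "group_hom (hom_group R P N) (hom_group R Q N) (\<lambda>f. compose (carrier Q) f d)"
proof -
  have "(\<lambda>f. compose (carrier Q) f d) \<in> hom (hom_group R P N) (hom_group R Q N)"
    using mod_hom_compose[OF Q d] mod_homD(1)[OF d]
    by (auto simp: hom_group_def compose_def intro!: homI restrict_ext)
  then show ?thesis
    using group_hom_group[OF P N] group_hom_group[OF Q N]
    by (simp add: group_hom_def group_hom_axioms_def comm_group.axioms(2))
qed

lemma trivial_hom_quotient:
  assumes M: "right_module R M" and N: "right_module R N"
    and H: "subgroup H (hom_group R M N)" and C: "subgroup C (hom_group R M N)" "C \<subseteq> H"
  shows "trivial_group ((hom_group R M N)\<lparr>carrier := H\<rparr> Mod C) \<longleftrightarrow> H \<subseteq> C"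
proof -
  interpret G: comm_group "hom_group R M N" by (rule group_hom_group[OF M N])
  let ?H = "(hom_group R M N)\<lparr>carrier := H\<rparr>"
  interpret H: comm_group ?H
    using subgroup.subset[OF H]
    by (intro group.group_comm_groupI subgroup.subgroup_is_group[OF H] G.group_axioms)
      (auto simp: G.m_comm subset_iff)
  have CH: "subgroup C ?H" using G.subgroup_incl[OF C(1) H C(2)] .
  have nor: "C \<lhd> ?H" using H.subgroup_imp_normal[OF CH] .
  have grp: "group (?H Mod C)" using nor by (rule normal.factorgroup_is_group)
  show ?thesis
  proof
    assume "trivial_group (?H Mod C)"
    then have car: "carrier (?H Mod C) = {C}" by (simp add: trivial_group_def FactGroup_def)
    show "H \<subseteq> C"
    proof
      fix f assume f: "f \<in> H"
      then have "C #>\<^bsub>?H\<^esub> f \<in> carrier (?H Mod C)" by (auto simp: FactGroup_def RCOSETS_def)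
      then have "C #>\<^bsub>?H\<^esub> f = C" using car by blast
      then show "f \<in> C" using H.rcos_self[OF _ CH, of f] f by simp
    qed
  next
    assume "H \<subseteq> C"
    then have "H = C" using C by blast
    have "C #>\<^bsub>?H\<^esub> f = C" if "f \<in> H" for f
      using that \<open>H = C\<close> H.coset_join2[OF _ CH, of f] by simp
    moreover have "H \<noteq> {}" using subgroup.one_closed[OF H] by blast
    ultimately have "carrier (?H Mod C) = {C}" by (auto simp: FactGroup_def RCOSETS_def)
    then show "trivial_group (?H Mod C)" using grp by (simp add: trivial_group_def FactGroup_def)
  qed
qed

text \<open>For projective \<open>A\<close> this is the vanishing of \<open>Ext^1(A/K, N)\<close>:
  the long exact sequence presents that group as the cokernel of the restriction from
  \<open>Hom(A, N)\<close> to \<open>Hom(K, N)\<close>.\<close>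

definition extends_from_ker ::
  "('r, 'z) ring_scheme \<Rightarrow> ('r, 'a) module \<Rightarrow> 'a set \<Rightarrow> ('r, 'n) module \<Rightarrow> bool" where
  "extends_from_ker R A K N \<longleftrightarrow>
    (\<forall>h \<in> mod_hom R (A\<lparr>carrier := K\<rparr>) N. \<exists>H \<in> mod_hom R A N. \<forall>k \<in> K. H k = h k)"

text \<open>Schanuel's argument: \<open>H (u x) + h (x - v (u x))\<close> extends \<open>h\<close>.\<close>

lemma extends_from_ker_transfer:
  assumes A: "right_module R A" and B: "right_module R B" and M: "right_module R M" and N: "right_module R N"
    and \<alpha>: "\<alpha> \<in> mod_hom R A M" and \<beta>: "\<beta> \<in> mod_hom R B M"
    and u: "u \<in> mod_hom R A B" "\<And>x. x \<in> carrier A \<Longrightarrow> \<beta> (u x) = \<alpha> x"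
    and v: "v \<in> mod_hom R B A" "\<And>x. x \<in> carrier B \<Longrightarrow> \<alpha> (v x) = \<beta> x"
    and ext: "extends_from_ker R B (hom_ker B M \<beta>) N"
  shows "extends_from_ker R A (hom_ker A M \<alpha>) N"
  unfolding extends_from_ker_def
proof
  interpret A: right_module R A by fact
  interpret B: right_module R B by fact
  interpret M: right_module R M by fact
  interpret N: right_module R N by fact
  let ?KA = "hom_ker A M \<alpha>" and ?KB = "hom_ker B M \<beta>"
  fix h assume h: "h \<in> mod_hom R (A\<lparr>carrier := ?KA\<rparr>) N"
  note ha = mod_homD(1)[OF h, simplified] and hb = mod_homD(2)[OF h, simplified]
    and hc = mod_homD(3)[OF h, simplified]
  note D\<alpha> = mod_homD(1-3)[OF \<alpha>] and D\<beta> = mod_homD(1-3)[OF \<beta>] and Du = mod_homD(1-3)[OF u(1)] and Dv = mod_homD(1-3)[OF v(1)]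
  have vK: "v x \<in> ?KA" if "x \<in> ?KB" for x using that v(2) Dv by (auto simp: hom_ker_def)
  have uK: "u x \<in> ?KB" if "x \<in> ?KA" for x using that u(2) Du by (auto simp: hom_ker_def)
  \<comment> \<open>\<open>v\<close> carries the kernel of \<open>\<beta>\<close> into the kernel of
    \<open>\<alpha>\<close>, so \<open>h\<close> can be pulled back to the side where extension is
    assumed.\<close>
  have "(\<lambda>x\<in>?KB. h (v x)) \<in> mod_hom R (B\<lparr>carrier := ?KB\<rparr>) N"
  proof (rule mod_homI)
    show "(\<lambda>x\<in>?KB. h (v x)) \<in> carrier (B\<lparr>carrier := ?KB\<rparr>) \<rightarrow>\<^sub>E carrier N"
      using vK ha by simp
  next
    fix x y assume "x \<in> carrier (B\<lparr>carrier := ?KB\<rparr>)" "y \<in> carrier (B\<lparr>carrier := ?KB\<rparr>)"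
    then have xy: "x \<in> ?KB" "y \<in> ?KB" "x \<in> carrier B" "y \<in> carrier B" by (auto simp: hom_ker_def)
    moreover have "x \<oplus>\<^bsub>B\<^esub> y \<in> ?KB" using xy D\<beta> by (auto simp: hom_ker_def)
    ultimately show "(\<lambda>x\<in>?KB. h (v x)) (x \<oplus>\<^bsub>B\<lparr>carrier := ?KB\<rparr>\<^esub> y)
        = (\<lambda>x\<in>?KB. h (v x)) x \<oplus>\<^bsub>N\<^esub> (\<lambda>x\<in>?KB. h (v x)) y"
      by (simp add: Dv vK hb)
  next
    fix r x assume "r \<in> carrier R" "x \<in> carrier (B\<lparr>carrier := ?KB\<rparr>)"
    then have xy: "r \<in> carrier R" "x \<in> ?KB" "x \<in> carrier B" by (auto simp: hom_ker_def)
    moreover have "r \<odot>\<^bsub>B\<^esub> x \<in> ?KB" using xy D\<beta> by (auto simp: hom_ker_def M.smult_zero B.smult_closed)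
    ultimately show "(\<lambda>x\<in>?KB. h (v x)) (r \<odot>\<^bsub>B\<lparr>carrier := ?KB\<rparr>\<^esub> x) = r \<odot>\<^bsub>N\<^esub> (\<lambda>x\<in>?KB. h (v x)) x"
      by (simp add: Dv vK hc)
  qed
  from bspec[OF ext[unfolded extends_from_ker_def] this]
  obtain H where H: "H \<in> mod_hom R B N" "\<And>k. k \<in> ?KB \<Longrightarrow> H k = h (v k)"
    by auto
  note DH = mod_homD(1-3)[OF H(1)]
  interpret va: abelian_group_hom B A v by (rule mod_hom_group_hom[OF B A v(1)])
  interpret \<alpha>a: abelian_group_hom A M \<alpha> by (rule mod_hom_group_hom[OF A M \<alpha>])
  define w where "w x = x \<ominus>\<^bsub>A\<^esub> v (u x)" for x
  have wc: "w x \<in> carrier A" if "x \<in> carrier A" for x using that by (simp add: w_def Du Dv)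
  have w: "w x \<in> ?KA" if "x \<in> carrier A" for x
  proof -
    have "\<alpha> (w x) = \<alpha> x \<ominus>\<^bsub>M\<^esub> \<alpha> (v (u x))"
      using that by (simp add: w_def A.M.minus_eq M.M.minus_eq Du Dv)
    then show ?thesis using that by (simp add: hom_ker_def wc u(2) v(2) Du D\<alpha> M.M.r_neg M.M.minus_eq)
  qed
  have w_add: "w (x \<oplus>\<^bsub>A\<^esub> y) = w x \<oplus>\<^bsub>A\<^esub> w y" if "x \<in> carrier A" "y \<in> carrier A" for x y
    using that by (simp add: w_def A.M.minus_eq Du Dv A.M.minus_add A.M.a_ac)
  have w_smult: "w (r \<odot>\<^bsub>A\<^esub> x) = r \<odot>\<^bsub>A\<^esub> w x" if "r \<in> carrier R" "x \<in> carrier A" for r x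
  proof -
    have "r \<odot>\<^bsub>A\<^esub> w x \<oplus>\<^bsub>A\<^esub> r \<odot>\<^bsub>A\<^esub> v (u x) = r \<odot>\<^bsub>A\<^esub> (w x \<oplus>\<^bsub>A\<^esub> v (u x))"
      using that by (simp add: wc Du Dv A.smult_add)
    also have "w x \<oplus>\<^bsub>A\<^esub> v (u x) = x"
      using that by (simp add: w_def A.M.minus_eq Du Dv A.M.a_assoc A.M.l_neg)
    finally have eq: "r \<odot>\<^bsub>A\<^esub> w x \<oplus>\<^bsub>A\<^esub> r \<odot>\<^bsub>A\<^esub> v (u x) = r \<odot>\<^bsub>A\<^esub> x" .
    have "w (r \<odot>\<^bsub>A\<^esub> x) = (r \<odot>\<^bsub>A\<^esub> w x \<oplus>\<^bsub>A\<^esub> r \<odot>\<^bsub>A\<^esub> v (u x)) \<ominus>\<^bsub>A\<^esub> r \<odot>\<^bsub>A\<^esub> v (u x)"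
      unfolding eq using that by (simp add: w_def Du Dv)
    then show ?thesis
      using that by (simp add: A.M.minus_eq A.smult_closed wc Du Dv A.M.a_assoc A.M.r_neg)
  qed
  define E where "E = (\<lambda>x\<in>carrier A. H (u x) \<oplus>\<^bsub>N\<^esub> h (w x))"
  have "E \<in> mod_hom R A N"
  proof (rule mod_homI)
    show "E \<in> carrier A \<rightarrow>\<^sub>E carrier N" using w by (auto simp: E_def DH Du ha)
  next
    fix x y assume xy: "x \<in> carrier A" "y \<in> carrier A"
    then have *: "H (u x) \<in> carrier N" "H (u y) \<in> carrier N" "h (w x) \<in> carrier N" "h (w y) \<in> carrier N"
      using w by (auto simp: DH Du ha)
    have "E (x \<oplus>\<^bsub>A\<^esub> y) = (H (u x) \<oplus>\<^bsub>N\<^esub> H (u y)) \<oplus>\<^bsub>N\<^esub> (h (w x) \<oplus>\<^bsub>N\<^esub> h (w y))"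
      using xy w by (simp add: E_def w_add DH Du hb)
    also have "\<dots> = E x \<oplus>\<^bsub>N\<^esub> E y"
      using * xy by (simp add: E_def N.M.a_ac)
    finally show "E (x \<oplus>\<^bsub>A\<^esub> y) = E x \<oplus>\<^bsub>N\<^esub> E y" .
  next
    fix r x assume "r \<in> carrier R" "x \<in> carrier A"
    then show "E (r \<odot>\<^bsub>A\<^esub> x) = r \<odot>\<^bsub>N\<^esub> E x"
      using w by (simp add: E_def w_smult DH Du hc ha A.smult_closed N.smult_add)
  qed
  moreover have "E k = h k" if k: "k \<in> ?KA" for k
  proof -
    have kc: "k \<in> carrier A" using k by (simp add: hom_ker_def)
    have "E k = h (v (u k)) \<oplus>\<^bsub>N\<^esub> h (w k)" using kc k by (simp add: E_def H(2) uK)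
    also have "\<dots> = h (v (u k) \<oplus>\<^bsub>A\<^esub> w k)" using k kc by (simp add: hb vK uK w)
    also have "v (u k) \<oplus>\<^bsub>A\<^esub> w k = k"
    proof -
      have "v (u k) \<in> carrier A" using kc by (simp add: Du Dv)
      then show ?thesis
        using kc by (simp add: w_def A.M.minus_eq A.M.a_lcomm A.M.r_neg)
    qed
    finally show ?thesis .
  qed
  ultimately show "\<exists>H\<in>mod_hom R A N. \<forall>k\<in>?KA. H k = h k" by blast
qed

lemma subgroup_hom_cocycles:
  assumes P: "\<And>i. right_module R (P i)" and N: "right_module R N" and d: "\<And>i. d i \<in> mod_hom R (P (Suc i)) (P i)"
  shows "subgroup (hom_cocycles R P d N i) (hom_group R (P i) N)"
proof -
  have "compose (carrier (P (Suc i))) f (d i) = (\<lambda>x\<in>carrier (P (Suc i)). \<zero>\<^bsub>N\<^esub>) \<longleftrightarrow>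
      (\<forall>x \<in> carrier (P (Suc i)). f (d i x) = \<zero>\<^bsub>N\<^esub>)" for f
    by (auto simp: compose_def fun_eq_iff restrict_def)
  then have "hom_cocycles R P d N i =
      kernel (hom_group R (P i) N) (hom_group R (P (Suc i)) N) (\<lambda>f. compose (carrier (P (Suc i))) f (d i))"
    by (simp add: hom_cocycles_def kernel_def hom_group_def)
  then show ?thesis using group_hom.subgroup_kernel[OF precompose_group_hom[OF P P N d]] by simp
qed

lemma subgroup_hom_coboundaries:
  assumes P: "\<And>i. right_module R (P i)" and N: "right_module R N" and d: "\<And>i. d i \<in> mod_hom R (P (Suc i)) (P i)"
  shows "subgroup (hom_coboundaries R P d N i) (hom_group R (P i) N)"
proof (cases i)
  case 0
  interpret comm_group "hom_group R (P i) N" by (rule group_hom_group[OF P N])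
  show ?thesis using triv_subgroup 0 by (simp add: hom_coboundaries_def)
next
  case (Suc j)
  show ?thesis
    using group_hom.img_is_subgroup[OF precompose_group_hom[where d = "d j", OF P P N d]]
    by (simp add: Suc hom_coboundaries_def) (simp add: hom_group_def)
qed

context
  fixes R :: "('r, 'z) ring_scheme" and M :: "('r, 'm) module" and P :: "nat \<Rightarrow> ('r, 'p) module" and d \<epsilon>
    and N :: "('r, 'n) module"
  assumes M: "right_module R M" and N: "right_module R N" and res: "free_resolution R M P d \<epsilon>"
begin

lemma resolution_facts:
  shows "right_module R (P i)" "d i \<in> mod_hom R (P (Suc i)) (P i)" "\<epsilon> \<in> mod_hom R (P 0) M"
    "\<epsilon> ` carrier (P 0) = carrier M" "d 0 ` carrier (P (Suc 0)) = hom_ker (P 0) M \<epsilon>"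
    "d (Suc i) ` carrier (P (Suc (Suc i))) = hom_ker (P (Suc i)) (P i) (d i)"
  using res by (auto simp: free_resolution_def free_module_def hom_ker_def)

lemma coboundary_is_cocycle: "hom_coboundaries R P d N i \<subseteq> hom_cocycles R P d N i"
proof (cases i)
  case 0
  have "\<one>\<^bsub>hom_group R (P 0) N\<^esub> \<in> hom_cocycles R P d N 0"
    by (rule subgroup.one_closed[OF subgroup_hom_cocycles[where P = P and d = d, OF resolution_facts(1) N resolution_facts(2)]])
  then show ?thesis by (simp add: 0 hom_coboundaries_def)
next
  case (Suc j)
  have dd: "d j (d (Suc j) x) = \<zero>\<^bsub>P j\<^esub>" "d (Suc j) x \<in> carrier (P (Suc j))" if "x \<in> carrier (P (Suc (Suc j)))" for x
    using that resolution_facts(6)[of j] by (auto simp: hom_ker_def)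
  show ?thesis
  proof
    fix f assume "f \<in> hom_coboundaries R P d N i"
    then obtain f' where f': "f' \<in> mod_hom R (P j) N" "f = compose (carrier (P (Suc j))) f' (d j)"
      by (auto simp: hom_coboundaries_def Suc)
    have "f \<in> mod_hom R (P (Suc j)) N"
      unfolding f'(2) by (rule mod_hom_compose[OF resolution_facts(1,2) f'(1)])
    moreover have "f (d (Suc j) x) = \<zero>\<^bsub>N\<^esub>" if "x \<in> carrier (P (Suc (Suc j)))" for x
      using dd[OF that] mod_hom_zero[OF resolution_facts(1) N f'(1)] by (simp add: f'(2) compose_def)
    ultimately show "f \<in> hom_cocycles R P d N i" by (simp add: hom_cocycles_def Suc)
  qed
qed

lemma trivial_cohomology_iff:
  "trivial_group (hom_cohomology R P d N i) \<longleftrightarrow> hom_cocycles R P d N i \<subseteq> hom_coboundaries R P d N i"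
  unfolding hom_cohomology_def
  by (rule trivial_hom_quotient[OF resolution_facts(1) N subgroup_hom_cocycles[where P = P and d = d, OF resolution_facts(1) N resolution_facts(2)]
        subgroup_hom_coboundaries[where P = P and d = d, OF resolution_facts(1) N resolution_facts(2)] coboundary_is_cocycle])

text \<open>Left exactness of \<open>Hom\<close>: as the resolution is exact at \<open>P 0\<close>
  and at \<open>M\<close>, the cocycles of degree 0 are the composites of \<open>\<epsilon>\<close>
  with homomorphisms from \<open>M\<close> to \<open>N\<close>, and the only coboundary is
  zero.\<close>

lemma trivial_cohomology_0:
  "trivial_group (hom_cohomology R P d N 0) \<longleftrightarrow> (\<forall>f \<in> mod_hom R M N. \<forall>x \<in> carrier M. f x = \<zero>\<^bsub>N\<^esub>)"
  unfolding trivial_cohomology_iff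
proof
  note e = mod_homD(1-3)[OF resolution_facts(3)]
  assume *: "hom_cocycles R P d N 0 \<subseteq> hom_coboundaries R P d N 0"
  show "\<forall>f \<in> mod_hom R M N. \<forall>x \<in> carrier M. f x = \<zero>\<^bsub>N\<^esub>"
  proof (intro ballI)
    fix f x assume f: "f \<in> mod_hom R M N" and "x \<in> carrier M"
    then obtain y where y: "y \<in> carrier (P 0)" "x = \<epsilon> y" using resolution_facts(4) by auto
    have "\<epsilon> (d 0 x) = \<zero>\<^bsub>M\<^esub> \<and> d 0 x \<in> carrier (P 0)" if "x \<in> carrier (P (Suc 0))" for x
      using imageI[OF that, of "d 0"] unfolding resolution_facts(5) by (simp add: hom_ker_def)
    then have "compose (carrier (P 0)) f \<epsilon> \<in> hom_cocycles R P d N 0"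
      using mod_hom_compose[OF resolution_facts(1,3) f] mod_hom_zero[OF M N f]
      by (auto simp: hom_cocycles_def compose_def hom_ker_def)
    with * have "compose (carrier (P 0)) f \<epsilon> = (\<lambda>x\<in>carrier (P 0). \<zero>\<^bsub>N\<^esub>)"
      by (auto simp: hom_coboundaries_def hom_group_def)
    from fun_cong[OF this, of y] show "f x = \<zero>\<^bsub>N\<^esub>" using y by (simp add: compose_def)
  qed
next
  assume *: "\<forall>f \<in> mod_hom R M N. \<forall>x \<in> carrier M. f x = \<zero>\<^bsub>N\<^esub>"
  show "hom_cocycles R P d N 0 \<subseteq> hom_coboundaries R P d N 0"
  proof
    fix f assume fc: "f \<in> hom_cocycles R P d N 0"
    then have f: "f \<in> mod_hom R (P 0) N" by (simp add: hom_cocycles_def)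
    have fker: "f k = \<zero>\<^bsub>N\<^esub>" if "k \<in> hom_ker (P 0) M \<epsilon>" for k
      using that fc unfolding resolution_facts(5)[symmetric] by (auto simp: hom_cocycles_def)
    obtain h where h: "h \<in> mod_hom R M N" "\<And>x. x \<in> carrier (P 0) \<Longrightarrow> h (\<epsilon> x) = f x"
      using mod_hom_factor[OF resolution_facts(1) M N resolution_facts(3,4) f fker] by blast
    have "f = (\<lambda>x\<in>carrier (P 0). \<zero>\<^bsub>N\<^esub>)"
    proof (rule extensionalityI[OF mod_homD(4)[OF f]])
      fix x assume x: "x \<in> carrier (P 0)"
      then show "f x = (\<lambda>x\<in>carrier (P 0). \<zero>\<^bsub>N\<^esub>) x"
        using * h(1) h(2)[OF x] mod_homD(1)[OF resolution_facts(3) x] by simp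
    qed simp
    then show "f \<in> hom_coboundaries R P d N 0" by (simp add: hom_coboundaries_def hom_group_def)
  qed
qed

text \<open>\<open>d 0\<close> maps onto the kernel of \<open>\<epsilon>\<close>, and its own kernel
  is the image of \<open>d 1\<close>, so cocycles of degree 1 are homomorphisms on the kernel of
  \<open>\<epsilon>\<close>. The coboundaries are those that extend to \<open>P 0\<close>.\<close>

lemma trivial_cohomology_1:
  "trivial_group (hom_cohomology R P d N 1) \<longleftrightarrow> extends_from_ker R (P 0) (hom_ker (P 0) M \<epsilon>) N"
  unfolding trivial_cohomology_iff
proof
  let ?K = "hom_ker (P 0) M \<epsilon>"
  interpret P1: right_module R "P (Suc 0)" by (rule resolution_facts)
  have dm: "d 0 \<in> mod_hom R (P (Suc 0)) (P 0)" by (rule resolution_facts)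
  note Dd = mod_homD(1-3)[OF dm] and dK = resolution_facts(5)
  have dmem: "d 0 x \<in> ?K" if "x \<in> carrier (P (Suc 0))" for x
    using that unfolding dK[symmetric] by (rule imageI)
  have K: "right_module R (P 0\<lparr>carrier := ?K\<rparr>)"
    by (rule right_module_ker[OF resolution_facts(1) M resolution_facts(3)])
  {
    assume *: "hom_cocycles R P d N 1 \<subseteq> hom_coboundaries R P d N 1"
    show "extends_from_ker R (P 0) ?K N"
      unfolding extends_from_ker_def
    proof
      fix h assume h: "h \<in> mod_hom R (P 0\<lparr>carrier := ?K\<rparr>) N"
      note Dh = mod_homD(1-3)[OF h, simplified]
      define f where "f = (\<lambda>x\<in>carrier (P (Suc 0)). h (d 0 x))"
      have "f \<in> mod_hom R (P (Suc 0)) N"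
        by (rule mod_homI) (auto simp: f_def dmem Dh Dd P1.smult_closed)
      moreover have "f (d (Suc 0) x) = \<zero>\<^bsub>N\<^esub>" if "x \<in> carrier (P (Suc (Suc 0)))" for x
      proof -
        have dx: "d (Suc 0) x \<in> carrier (P (Suc 0))" "d 0 (d (Suc 0) x) = \<zero>\<^bsub>P 0\<^esub>"
          using that resolution_facts(6)[of 0] by (auto simp: hom_ker_def)
        then show ?thesis using mod_hom_zero[OF K N h] by (simp add: f_def)
      qed
      ultimately have "f \<in> hom_coboundaries R P d N (Suc 0)"
        using * by (auto simp: hom_cocycles_def)
      then obtain H where H: "H \<in> mod_hom R (P 0) N" "f = compose (carrier (P (Suc 0))) H (d 0)"
        by (auto simp: hom_coboundaries_def)
      have "H k = h k" if k: "k \<in> ?K" for k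
      proof -
        obtain y where y: "y \<in> carrier (P (Suc 0))" "k = d 0 y" using k unfolding dK[symmetric] by auto
        have "f y = H (d 0 y)" using y H(2) by (simp add: compose_def)
        then show ?thesis using y by (simp add: f_def)
      qed
      then show "\<exists>H\<in>mod_hom R (P 0) N. \<forall>k\<in>?K. H k = h k" using H(1) by blast
    qed
  next
    assume *: "extends_from_ker R (P 0) ?K N"
    show "hom_cocycles R P d N 1 \<subseteq> hom_coboundaries R P d N 1"
    proof
      fix f assume fc: "f \<in> hom_cocycles R P d N 1"
      then have f: "f \<in> mod_hom R (P (Suc 0)) N" by (simp add: hom_cocycles_def)
      have dK': "d 0 \<in> mod_hom R (P (Suc 0)) (P 0\<lparr>carrier := ?K\<rparr>)"
        "d 0 ` carrier (P (Suc 0)) = carrier (P 0\<lparr>carrier := ?K\<rparr>)"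
        using Dd dmem mod_homD(4)[OF dm] dK by (auto intro!: mod_homI simp: PiE_iff extensional_def)
      have "f k = \<zero>\<^bsub>N\<^esub>" if "k \<in> hom_ker (P (Suc 0)) (P 0\<lparr>carrier := ?K\<rparr>) (d 0)" for k
      proof -
        have "k \<in> d (Suc 0) ` carrier (P (Suc (Suc 0)))"
          using that unfolding resolution_facts(6) by (simp add: hom_ker_def)
        then show ?thesis using fc by (auto simp: hom_cocycles_def)
      qed
      from mod_hom_factor[OF resolution_facts(1) K N dK' f this]
      obtain h where h: "h \<in> mod_hom R (P 0\<lparr>carrier := ?K\<rparr>) N" "\<And>x. x \<in> carrier (P (Suc 0)) \<Longrightarrow> h (d 0 x) = f x"
        by blast
      from bspec[OF *[unfolded extends_from_ker_def] h(1)]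
      obtain H where H: "H \<in> mod_hom R (P 0) N" "\<And>k. k \<in> ?K \<Longrightarrow> H k = h k" by auto
      have "f = compose (carrier (P (Suc 0))) H (d 0)"
        by (rule extensionalityI[OF mod_homD(4)[OF f]]) (simp_all add: compose_def H(2) dmem h(2))
      then show "f \<in> hom_coboundaries R P d N 1" using H(1) by (simp add: hom_coboundaries_def)
    qed
  }
qed

end

text \<open>The first term \<open>P 0\<close> of the chosen resolution and \<open>S\<close> map to
  each other over \<open>M\<close>, one way by freeness and the other by \<open>proj\<close>, so
  either of them decides whether homomorphisms extend from the kernel. Lifting is demanded only
  against modules on the type used by \<open>Ext\<close>, which is where \<open>P 0\<close>
  lives.\<close>

lemma grade_ge_2_iff:
  fixes R :: "('r, 'z) ring_scheme" and M :: "('r, 'm) module" and S :: "('r, 's) module"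
  assumes M: "right_module R M" and N: "right_module R (module_via R (\<lambda>r. r))"
    and S: "right_module R S" and nt: "\<one>\<^bsub>R\<^esub> \<noteq> \<zero>\<^bsub>R\<^esub>"
    and \<pi>: "\<pi> \<in> mod_hom R S M" "\<pi> ` carrier S = carrier M"
    and proj: "\<And>(P :: ('r, ('m \<times> 'r) list) module) \<epsilon>. right_module R P \<Longrightarrow> \<epsilon> \<in> mod_hom R P M \<Longrightarrow>
      \<epsilon> ` carrier P = carrier M \<Longrightarrow> \<exists>v \<in> mod_hom R S P. \<forall>x \<in> carrier S. \<epsilon> (v x) = \<pi> x"
  shows "grade R M \<ge> 2 \<longleftrightarrow> (\<forall>f \<in> mod_hom R M (module_via R (\<lambda>r. r)). \<forall>x \<in> carrier M. f x = \<zero>\<^bsub>R\<^esub>)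
    \<and> extends_from_ker R S (hom_ker S M \<pi>) (module_via R (\<lambda>r. r))"
proof -
  let ?N = "module_via R (\<lambda>r. r)"
  obtain P d where X: "(SOME (P, d). \<exists>\<epsilon>. free_resolution R M P d \<epsilon>)
      = (P :: nat \<Rightarrow> ('r, ('m \<times> 'r) list) module, d)" by fastforce
  have "\<exists>x :: (nat \<Rightarrow> ('r, ('m \<times> 'r) list) module) \<times> _. case x of (P, d) \<Rightarrow> \<exists>\<epsilon>. free_resolution R M P d \<epsilon>"
    using free_resolution_exists[OF M nt] by auto
  from someI_ex[OF this] have "\<exists>\<epsilon>. free_resolution R M P d \<epsilon>"
    unfolding X by simp
  then obtain \<epsilon> where res: "free_resolution R M P d \<epsilon>" by blast
  have Ext: "Ext R M ?N i = hom_cohomology R P d ?N i" for i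
    unfolding Ext_def X by simp
  note facts = resolution_facts[OF M N res]
  obtain v where v: "v \<in> mod_hom R S (P 0)" "\<And>x. x \<in> carrier S \<Longrightarrow> \<epsilon> (v x) = \<pi> x"
    using proj[OF facts(1,3,4)] by blast
  have "free_module R (P 0)" using res by (simp add: free_resolution_def)
  from free_module_lift[OF this S M facts(3) \<pi>]
  obtain u where u: "u \<in> mod_hom R (P 0) S" "\<And>x. x \<in> carrier (P 0) \<Longrightarrow> \<pi> (u x) = \<epsilon> x" by blast
  have "extends_from_ker R (P 0) (hom_ker (P 0) M \<epsilon>) ?N \<longleftrightarrow> extends_from_ker R S (hom_ker S M \<pi>) ?N"
    using extends_from_ker_transfer[OF facts(1) S M N facts(3) \<pi>(1) u v]
      extends_from_ker_transfer[OF S facts(1) M N \<pi>(1) facts(3) v u] by blast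
  then have 1: "trivial_group (Ext R M ?N 1) \<longleftrightarrow> extends_from_ker R S (hom_ker S M \<pi>) ?N"
    using trivial_cohomology_1[OF M N res] by (simp add: Ext)
  have 0: "trivial_group (Ext R M ?N 0) \<longleftrightarrow> (\<forall>f \<in> mod_hom R M ?N. \<forall>x \<in> carrier M. f x = \<zero>\<^bsub>R\<^esub>)"
    unfolding Ext trivial_cohomology_0[OF M N res] by (simp add: module_via_def)
  \<comment> \<open>\<open>grade\<close> is an infimum in \<open>enat\<close>, hence infinite when
    all the groups are trivial; a value of at least 2 excludes just the indices 0 and 1.\<close>
  have "grade R M \<ge> 2 \<longleftrightarrow> trivial_group (Ext R M ?N 0) \<and> trivial_group (Ext R M ?N 1)"
  proof -
    have 2: "2 \<le> enat i \<longleftrightarrow> i \<noteq> 0 \<and> i \<noteq> 1" for i :: nat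
      by (auto simp: numeral_eq_enat)
    have "2 \<le> Inf {enat i |i. Q i} \<longleftrightarrow> (\<forall>i. Q i \<longrightarrow> i \<noteq> 0 \<and> i \<noteq> 1)" for Q
      unfolding le_Inf_iff 2[symmetric] by blast
    moreover have "(\<forall>i. \<not> T i \<longrightarrow> i \<noteq> 0 \<and> i \<noteq> 1) \<longleftrightarrow> T 0 \<and> T 1" for T :: "nat \<Rightarrow> bool"
      by metis
    ultimately show ?thesis unfolding grade_def by simp
  qed
  then show ?thesis using 0 1 by simp
qed

section \<open>Rings with a monomial basis\<close>

text \<open>Exponents of monomials are multisets of indices of variables; \<open>mono c \<alpha>\<close> stands for \<open>c x\<^sup>\<alpha>\<close>.\<close>

locale monomial_ring = ring R for R :: "('a, 'z) ring_scheme" (structure) +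
  fixes V :: "nat set" and coef :: "'a \<Rightarrow> nat multiset \<Rightarrow> 'k::field"
    and mono :: "'k \<Rightarrow> nat multiset \<Rightarrow> 'a" and b :: "nat multiset \<Rightarrow> nat multiset \<Rightarrow> 'k"
  assumes mono_closed [simp]: "set_mset \<alpha> \<subseteq> V \<Longrightarrow> mono c \<alpha> \<in> carrier R"
    and coef_mono: "set_mset \<alpha> \<subseteq> V \<Longrightarrow> coef (mono c \<alpha>) \<beta> = (if \<beta> = \<alpha> then c else 0)"
    and coef_add: "r \<in> carrier R \<Longrightarrow> s \<in> carrier R \<Longrightarrow> coef (r \<oplus> s) \<alpha> = coef r \<alpha> + coef s \<alpha>"
    and coef_eqI: "r \<in> carrier R \<Longrightarrow> s \<in> carrier R \<Longrightarrow> (\<And>\<alpha>. coef r \<alpha> = coef s \<alpha>) \<Longrightarrow> r = s"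
    and coef_finite: "r \<in> carrier R \<Longrightarrow> finite {\<alpha>. coef r \<alpha> \<noteq> 0}"
    and coef_supp: "r \<in> carrier R \<Longrightarrow> coef r \<alpha> \<noteq> 0 \<Longrightarrow> set_mset \<alpha> \<subseteq> V"
    and mono_mult: "set_mset \<alpha> \<subseteq> V \<Longrightarrow> set_mset \<beta> \<subseteq> V \<Longrightarrow>
      mono c \<alpha> \<otimes> mono d \<beta> = mono (c * d * b \<alpha> \<beta>) (\<alpha> + \<beta>)"
    and b_nonzero: "set_mset \<alpha> \<subseteq> V \<Longrightarrow> set_mset \<beta> \<subseteq> V \<Longrightarrow> b \<alpha> \<beta> \<noteq> 0"
    and mono_one: "mono 1 {#} = \<one>"
begin

lemma coef_zero [simp]: "coef \<zero> \<alpha> = 0"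
proof -
  have "coef (\<zero> \<oplus> \<zero>) \<alpha> = coef \<zero> \<alpha> + coef \<zero> \<alpha>" by (rule coef_add) auto
  then show ?thesis by (metis add_cancel_left_right l_zero zero_closed)
qed

lemma coef_uminus: "r \<in> carrier R \<Longrightarrow> coef (\<ominus> r) \<alpha> = - coef r \<alpha>"
  using coef_add[of "\<ominus> r" r \<alpha>] by (simp add: l_neg eq_neg_iff_add_eq_0)

lemma coef_minus: "r \<in> carrier R \<Longrightarrow> s \<in> carrier R \<Longrightarrow> coef (r \<ominus> s) \<alpha> = coef r \<alpha> - coef s \<alpha>"
  by (simp add: minus_eq coef_add coef_uminus)

lemma coef_finsum: "(\<And>i. i \<in> A \<Longrightarrow> t i \<in> carrier R) \<Longrightarrow> coef (\<Oplus>i\<in>A. t i) \<alpha> = (\<Sum>i\<in>A. coef (t i) \<alpha>)"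
proof (induction A rule: infinite_finite_induct)
  case (insert x F)
  then show ?case by (subst finsum_insert) (auto simp: coef_add)
qed (simp_all)

text \<open>Identities between sums in \<open>R\<close> are tested on coefficients, where they
  become identities between sums in a field.\<close>

lemma finsum_swap:
  "(\<And>i j. i \<in> A \<Longrightarrow> j \<in> C \<Longrightarrow> t i j \<in> carrier R) \<Longrightarrow> (\<Oplus>i\<in>A. \<Oplus>j\<in>C. t i j) = (\<Oplus>j\<in>C. \<Oplus>i\<in>A. t i j)"
  by (rule coef_eqI) (auto intro!: finsum_closed simp: coef_finsum intro: sum.swap)

lemma finsum_bij_betw:
  "bij_betw f A C \<Longrightarrow> (\<And>i. i \<in> C \<Longrightarrow> t i \<in> carrier R) \<Longrightarrow> (\<Oplus>i\<in>A. t (f i)) = (\<Oplus>i\<in>C. t i)"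
proof (rule coef_eqI)
  assume *: "bij_betw f A C" "\<And>i. i \<in> C \<Longrightarrow> t i \<in> carrier R"
  then have "t (f i) \<in> carrier R" if "i \<in> A" for i using that by (auto dest: bij_betwE)
  then show "(\<Oplus>i\<in>A. t (f i)) \<in> carrier R" "coef (\<Oplus>i\<in>A. t (f i)) \<alpha> = coef (\<Oplus>i\<in>C. t i) \<alpha>" for \<alpha>
    using * sum.reindex_bij_betw[OF *(1), of "\<lambda>i. coef (t i) \<alpha>"] by (auto simp: coef_finsum intro!: finsum_closed)
  show "(\<Oplus>i\<in>C. t i) \<in> carrier R" using * by (auto intro!: finsum_closed)
qed

lemma mono_zero: "set_mset \<alpha> \<subseteq> V \<Longrightarrow> mono 0 \<alpha> = \<zero>"
  by (rule coef_eqI) (auto simp: coef_mono)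

lemma coef_one: "coef \<one> \<alpha> = (if \<alpha> = {#} then 1 else 0)"
  using coef_mono[of "{#}" 1] by (simp add: mono_one)

lemma one_neq_zero: "\<one> \<noteq> \<zero>"
  using coef_one[of "{#}"] by auto

lemma b_empty [simp]:
  assumes "set_mset \<alpha> \<subseteq> V" shows "b {#} \<alpha> = 1" "b \<alpha> {#} = 1"
proof -
  have "mono 1 {#} \<otimes> mono 1 \<alpha> = mono 1 \<alpha>" "mono 1 \<alpha> \<otimes> mono 1 {#} = mono 1 \<alpha>"
    using assms by (simp_all add: mono_one)
  from this[THEN arg_cong[where f = "\<lambda>r. coef r \<alpha>"]] assms show "b {#} \<alpha> = 1" "b \<alpha> {#} = 1"
    by (simp_all add: mono_mult coef_mono)
qed

lemma mono_scale: "set_mset \<alpha> \<subseteq> V \<Longrightarrow> mono c {#} \<otimes> mono d \<alpha> = mono (c * d) \<alpha>"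
  "set_mset \<alpha> \<subseteq> V \<Longrightarrow> mono d \<alpha> \<otimes> mono c {#} = mono (d * c) \<alpha>"
  by (simp_all add: mono_mult)

lemma monomial_induct [consumes 1, case_names mono add]:
  assumes r: "r \<in> carrier R"
    and mono: "\<And>c \<alpha>. set_mset \<alpha> \<subseteq> V \<Longrightarrow> P (mono c \<alpha>)"
    and add: "\<And>r s. r \<in> carrier R \<Longrightarrow> s \<in> carrier R \<Longrightarrow> P r \<Longrightarrow> P s \<Longrightarrow> P (r \<oplus> s)"
  shows "P r"
  using r
proof (induction "card {\<alpha>. coef r \<alpha> \<noteq> 0}" arbitrary: r rule: less_induct)
  case less
  show ?case
  proof (cases "\<exists>\<alpha>. coef r \<alpha> \<noteq> 0")
    case False
    then have "r = mono 0 {#}" using less.prems by (intro coef_eqI) (auto simp: coef_mono)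
    then show ?thesis using mono[of "{#}" 0] by simp
  next
    case True
    then obtain \<alpha> where \<alpha>: "coef r \<alpha> \<noteq> 0" by blast
    have V: "set_mset \<alpha> \<subseteq> V" using coef_supp[OF less.prems \<alpha>] .
    let ?m = "mono (coef r \<alpha>) \<alpha>" and ?s = "r \<ominus> mono (coef r \<alpha>) \<alpha>"
    have s: "?s \<in> carrier R" using less.prems V by simp
    have eq: "{\<beta>. coef ?s \<beta> \<noteq> 0} = {\<beta>. coef r \<beta> \<noteq> 0} - {\<alpha>}"
      using less.prems V by (auto simp: coef_minus coef_mono split: if_splits)
    have "card {\<beta>. coef ?s \<beta> \<noteq> 0} < card {\<beta>. coef r \<beta> \<noteq> 0}"
      unfolding eq using coef_finite[OF less.prems] \<alpha> by (intro card_Diff1_less) simp_all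
    then have "P ?s" using less.hyps s by blast
    moreover have "?s \<oplus> ?m = r" using less.prems V by (simp add: minus_eq a_assoc l_neg)
    ultimately show ?thesis using add[OF s mono_closed[OF V] _ mono[OF V], of "coef r \<alpha>"] by simp
  qed
qed

section \<open>Multiplication and division by monomials\<close>

text \<open>Adding \<open>\<beta>\<close> to exponents is injective, so at most one coefficient of
  \<open>r\<close> reaches the exponent \<open>\<gamma>\<close>.\<close>

lemma coef_mult_mono:
  assumes r: "r \<in> carrier R" and \<beta>: "set_mset \<beta> \<subseteq> V"
  shows "coef (r \<otimes> mono c \<beta>) \<gamma> = (if \<beta> \<subseteq># \<gamma> then coef r (\<gamma> - \<beta>) * c * b (\<gamma> - \<beta>) \<beta> else 0)"
  using r
proof (induction r rule: monomial_induct)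
  case (mono d \<alpha>)
  show ?case
  proof (cases "\<gamma> = \<alpha> + \<beta>")
    case True
    then show ?thesis using mono \<beta> by (simp add: mono_mult coef_mono)
  next
    case False
    then have "\<beta> \<subseteq># \<gamma> \<Longrightarrow> \<gamma> - \<beta> \<noteq> \<alpha>" by (metis subset_mset.diff_add)
    then show ?thesis using False mono \<beta> by (simp add: mono_mult coef_mono)
  qed
next
  case (add r s)
  then show ?case using \<beta> by (simp add: l_distr coef_add algebra_simps)
qed

lemma coef_mono_mult:
  assumes r: "r \<in> carrier R" and \<beta>: "set_mset \<beta> \<subseteq> V"
  shows "coef (mono c \<beta> \<otimes> r) \<gamma> = (if \<beta> \<subseteq># \<gamma> then c * coef r (\<gamma> - \<beta>) * b \<beta> (\<gamma> - \<beta>) else 0)"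
  using r
proof (induction r rule: monomial_induct)
  case (mono d \<alpha>)
  show ?case
  proof (cases "\<gamma> = \<beta> + \<alpha>")
    case True
    then show ?thesis using mono \<beta> by (simp add: mono_mult coef_mono)
  next
    case False
    then have "\<beta> \<subseteq># \<gamma> \<Longrightarrow> \<gamma> - \<beta> \<noteq> \<alpha>" by (metis subset_mset.add_diff_inverse)
    then show ?thesis using False mono \<beta> by (simp add: mono_mult coef_mono)
  qed
next
  case (add r s)
  then show ?case using \<beta> by (simp add: r_distr coef_add algebra_simps)
qed

lemma coef_mult_mono_add:
  assumes "r \<in> carrier R" "set_mset \<beta> \<subseteq> V"
  shows "coef (r \<otimes> mono c \<beta>) (\<gamma> + \<beta>) = coef r \<gamma> * c * b \<gamma> \<beta>"
  using assms by (simp add: coef_mult_mono)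

lemma coef_scale: "r \<in> carrier R \<Longrightarrow> coef (mono c {#} \<otimes> r) \<gamma> = c * coef r \<gamma>"
proof (cases "coef r \<gamma> = 0")
  case False
  assume r: "r \<in> carrier R"
  then show ?thesis using coef_supp[OF r False] by (simp add: coef_mono_mult)
qed (simp add: coef_mono_mult)

text \<open>Monomials are regular: their shift of exponents is injective and \<open>b\<close> takes
  nonzero values on exponents over \<open>V\<close>. This stands in for a ring of fractions.\<close>

lemma mult_mono_cancel:
  assumes "r \<in> carrier R" "s \<in> carrier R" "set_mset \<beta> \<subseteq> V" "c \<noteq> 0" "r \<otimes> mono c \<beta> = s \<otimes> mono c \<beta>"
  shows "r = s"
proof (rule coef_eqI[OF assms(1,2)])
  fix \<gamma>
  show "coef r \<gamma> = coef s \<gamma>"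
  proof (cases "coef r \<gamma> = 0 \<and> coef s \<gamma> = 0")
    case False
    then have "set_mset \<gamma> \<subseteq> V" using coef_supp assms by blast
    then have "b \<gamma> \<beta> \<noteq> 0" using b_nonzero assms by blast
    moreover have "coef r \<gamma> * c * b \<gamma> \<beta> = coef s \<gamma> * c * b \<gamma> \<beta>"
      using arg_cong[OF assms(5), of "\<lambda>r. coef r (\<gamma> + \<beta>)"] assms(1-3) by (simp add: coef_mult_mono_add)
    ultimately show ?thesis using assms(4) by simp
  qed simp
qed

lemma mono_mult_cancel:
  assumes "r \<in> carrier R" "s \<in> carrier R" "set_mset \<beta> \<subseteq> V" "mono 1 \<beta> \<otimes> r = mono 1 \<beta> \<otimes> s"
  shows "r = s"
proof (rule coef_eqI[OF assms(1,2)])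
  fix \<gamma>
  show "coef r \<gamma> = coef s \<gamma>"
  proof (cases "coef r \<gamma> = 0 \<and> coef s \<gamma> = 0")
    case False
    then have "set_mset \<gamma> \<subseteq> V" using coef_supp assms by blast
    then have "b \<beta> \<gamma> \<noteq> 0" using b_nonzero assms by blast
    then show ?thesis
      using arg_cong[OF assms(4), of "\<lambda>r. coef r (\<beta> + \<gamma>)"] assms(1-3) by (simp add: coef_mono_mult)
  qed simp
qed

lemma exists_coef:
  assumes "finite A" "\<And>\<alpha>. \<alpha> \<in> A \<Longrightarrow> set_mset \<alpha> \<subseteq> V"
  shows "\<exists>r \<in> carrier R. \<forall>\<alpha>. coef r \<alpha> = (if \<alpha> \<in> A then c \<alpha> else 0)"
proof (intro bexI[of _ "\<Oplus>\<alpha>\<in>A. mono (c \<alpha>) \<alpha>"] allI)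
  fix \<alpha>
  have "coef (\<Oplus>\<alpha>\<in>A. mono (c \<alpha>) \<alpha>) \<alpha> = (\<Sum>\<beta>\<in>A. if \<beta> = \<alpha> then c \<beta> else 0)"
    using assms by (subst coef_finsum) (auto simp: coef_mono intro!: sum.cong)
  then show "coef (\<Oplus>\<alpha>\<in>A. mono (c \<alpha>) \<alpha>) \<alpha> = (if \<alpha> \<in> A then c \<alpha> else 0)"
    using assms(1) by (simp add: sum.delta')
qed (use assms in \<open>auto intro!: finsum_closed\<close>)

lemma right_divisible:
  assumes u: "u \<in> carrier R" and \<beta>: "set_mset \<beta> \<subseteq> V" and div: "\<And>\<alpha>. coef u \<alpha> \<noteq> 0 \<Longrightarrow> \<beta> \<subseteq># \<alpha>"
  shows "\<exists>r \<in> carrier R. u = r \<otimes> mono 1 \<beta>"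
proof -
  let ?A = "(\<lambda>\<alpha>. \<alpha> - \<beta>) ` {\<alpha>. coef u \<alpha> \<noteq> 0}"
  have A: "finite ?A" "\<And>\<alpha>. \<alpha> \<in> ?A \<Longrightarrow> set_mset \<alpha> \<subseteq> V"
    using coef_finite[OF u] coef_supp[OF u] by (auto dest: in_diffD)
  \<comment> \<open>Dividing by \<open>b \<alpha> \<beta>\<close> undoes the constant that
    multiplication by \<open>x^\<beta>\<close> produces.\<close>
  from exists_coef[OF A, of "\<lambda>\<alpha>. coef u (\<alpha> + \<beta>) / b \<alpha> \<beta>"] obtain r where r: "r \<in> carrier R"
    "\<And>\<alpha>. coef r \<alpha> = (if \<alpha> \<in> ?A then coef u (\<alpha> + \<beta>) / b \<alpha> \<beta> else 0)" by auto
  have "u = r \<otimes> mono 1 \<beta>"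
  proof (rule coef_eqI)
    fix \<gamma>
    show "coef u \<gamma> = coef (r \<otimes> mono 1 \<beta>) \<gamma>"
    proof (cases "coef u \<gamma> = 0")
      case True
      have "coef r (\<gamma> - \<beta>) = 0" if "\<beta> \<subseteq># \<gamma>" using that True by (simp add: r(2))
      then show ?thesis using True by (simp add: coef_mult_mono r(1) \<beta>)
    next
      case False
      then have "\<gamma> - \<beta> \<in> ?A" "\<beta> \<subseteq># \<gamma>" using div by auto
      then show ?thesis using A(2)[of "\<gamma> - \<beta>"] b_nonzero[of "\<gamma> - \<beta>" \<beta>]
        by (simp add: coef_mult_mono r \<beta>)
    qed
  qed (use u r \<beta> in auto)
  then show ?thesis using r(1) by blast
qed

lemma left_divisible:
  assumes u: "u \<in> carrier R" and \<beta>: "set_mset \<beta> \<subseteq> V" and div: "\<And>\<alpha>. coef u \<alpha> \<noteq> 0 \<Longrightarrow> \<beta> \<subseteq># \<alpha>"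
  shows "\<exists>r \<in> carrier R. u = mono 1 \<beta> \<otimes> r"
proof -
  let ?A = "(\<lambda>\<alpha>. \<alpha> - \<beta>) ` {\<alpha>. coef u \<alpha> \<noteq> 0}"
  have A: "finite ?A" "\<And>\<alpha>. \<alpha> \<in> ?A \<Longrightarrow> set_mset \<alpha> \<subseteq> V"
    using coef_finite[OF u] coef_supp[OF u] by (auto dest: in_diffD)
  from exists_coef[OF A, of "\<lambda>\<alpha>. coef u (\<alpha> + \<beta>) / b \<beta> \<alpha>"] obtain r where r: "r \<in> carrier R"
    "\<And>\<alpha>. coef r \<alpha> = (if \<alpha> \<in> ?A then coef u (\<alpha> + \<beta>) / b \<beta> \<alpha> else 0)" by auto
  have "u = mono 1 \<beta> \<otimes> r"
  proof (rule coef_eqI)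
    fix \<gamma>
    show "coef u \<gamma> = coef (mono 1 \<beta> \<otimes> r) \<gamma>"
    proof (cases "coef u \<gamma> = 0")
      case True
      have "coef r (\<gamma> - \<beta>) = 0" if "\<beta> \<subseteq># \<gamma>" using that True by (simp add: r(2))
      then show ?thesis using True by (simp add: coef_mono_mult r(1) \<beta>)
    next
      case False
      then have "\<gamma> - \<beta> \<in> ?A" "\<beta> \<subseteq># \<gamma>" using div by auto
      then show ?thesis using A(2)[of "\<gamma> - \<beta>"] b_nonzero[of \<beta> "\<gamma> - \<beta>"]
        by (simp add: coef_mono_mult r \<beta>)
    qed
  qed (use u r \<beta> in auto)
  then show ?thesis using r(1) by blast
qed

text \<open>
  A homomorphism on the module spanned by the monomials with exponents in \<open>B\<close> is left
  multiplication by a fraction \<open>u \<beta> / x\<^sup>\<beta>\<close>, and the fraction lies in \<open>R\<close> because no variable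
  divides all these monomials.
\<close>

lemma common_left_factor:
  assumes BV: "\<And>\<beta>. \<beta> \<in> B \<Longrightarrow> set_mset \<beta> \<subseteq> V" and B: "B \<noteq> {}"
    and coprime: "\<And>i. i \<in> V \<Longrightarrow> \<exists>\<beta> \<in> B. i \<notin># \<beta>"
    and u: "\<And>\<beta>. \<beta> \<in> B \<Longrightarrow> u \<beta> \<in> carrier R"
    and rel: "\<And>\<beta> \<beta>'. \<beta> \<in> B \<Longrightarrow> \<beta>' \<in> B \<Longrightarrow> \<exists>\<delta> e e'. set_mset \<delta> \<subseteq> V \<and> e \<noteq> 0 \<and> e' \<noteq> 0 \<and>
      mono 1 \<beta> \<otimes> mono e (\<delta> + \<beta>') = mono 1 \<beta>' \<otimes> mono e' (\<delta> + \<beta>) \<and>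
      u \<beta> \<otimes> mono e (\<delta> + \<beta>') = u \<beta>' \<otimes> mono e' (\<delta> + \<beta>)"
  shows "\<exists>r \<in> carrier R. \<forall>\<beta> \<in> B. u \<beta> = r \<otimes> mono 1 \<beta>"
proof -
  obtain \<beta> where \<beta>: "\<beta> \<in> B" using B by blast
  note bV = BV[OF \<beta>] and ub = u[OF \<beta>]
  \<comment> \<open>\<open>x^\<beta>\<close> divides \<open>u \<beta>\<close>: the exponent of each
    variable \<open>i\<close> is bounded with the help of a monomial of \<open>B\<close> that lacks
    \<open>i\<close>.\<close>
  have "\<beta> \<subseteq># \<alpha>" if \<alpha>: "coef (u \<beta>) \<alpha> \<noteq> 0" for \<alpha>
  proof (rule mset_subset_eqI)
    fix i
    show "count \<beta> i \<le> count \<alpha> i"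
    proof (cases "i \<in> V")
      case False
      then have "i \<notin># \<beta>" using bV by blast
      then show ?thesis by (simp add: not_in_iff)
    next
      case True
      then obtain \<beta>' where \<beta>': "\<beta>' \<in> B" "i \<notin># \<beta>'" using coprime by blast
      obtain \<delta> e e' where \<delta>: "set_mset \<delta> \<subseteq> V" "e \<noteq> 0" "u \<beta> \<otimes> mono e (\<delta> + \<beta>') = u \<beta>' \<otimes> mono e' (\<delta> + \<beta>)"
        using rel[OF \<beta> \<beta>'(1)] by blast
      have V': "set_mset (\<delta> + \<beta>') \<subseteq> V" "set_mset (\<delta> + \<beta>) \<subseteq> V" using \<delta> bV BV[OF \<beta>'(1)] by auto
      \<comment> \<open>The term of exponent \<open>\<alpha>\<close> survives multiplication by a
        monomial, while the other side of the relation has only exponents containing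
        \<open>\<delta> + \<beta>\<close>. At \<open>i\<close> the share of \<open>\<delta>\<close>
        cancels and \<open>\<beta>'\<close> contributes nothing.\<close>
      have "coef (u \<beta> \<otimes> mono e (\<delta> + \<beta>')) (\<alpha> + (\<delta> + \<beta>')) \<noteq> 0"
        unfolding coef_mult_mono_add[OF ub V'(1)]
        using \<alpha> \<delta>(2) b_nonzero[OF coef_supp[OF ub \<alpha>] V'(1)] by simp
      then have "\<delta> + \<beta> \<subseteq># \<alpha> + (\<delta> + \<beta>')"
        unfolding \<delta>(3) coef_mult_mono[OF u[OF \<beta>'(1)] V'(2)] by (metis (full_types))
      from mset_subset_eq_count[OF this, of i] show ?thesis using \<beta>'(2) by (simp add: not_in_iff)
    qed
  qed
  from right_divisible[OF ub bV this] obtain r where r: "r \<in> carrier R" "u \<beta> = r \<otimes> mono 1 \<beta>" by blast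
  \<comment> \<open>The factor found for \<open>\<beta>\<close> serves every
    \<open>\<beta>'\<close>: inserted into the relation, it leaves the same regular monomial at the
    right end of both sides, and this cancels.\<close>
  have "u \<beta>' = r \<otimes> mono 1 \<beta>'" if \<beta>': "\<beta>' \<in> B" for \<beta>'
  proof -
    obtain \<delta> e e' where \<delta>: "set_mset \<delta> \<subseteq> V" "e' \<noteq> 0"
      "mono 1 \<beta> \<otimes> mono e (\<delta> + \<beta>') = mono 1 \<beta>' \<otimes> mono e' (\<delta> + \<beta>)"
      "u \<beta> \<otimes> mono e (\<delta> + \<beta>') = u \<beta>' \<otimes> mono e' (\<delta> + \<beta>)"
      using rel[OF \<beta> \<beta>'] by blast
    have V': "set_mset (\<delta> + \<beta>') \<subseteq> V" "set_mset (\<delta> + \<beta>) \<subseteq> V" using \<delta> bV BV[OF \<beta>'] by auto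
    have "u \<beta>' \<otimes> mono e' (\<delta> + \<beta>) = r \<otimes> (mono 1 \<beta> \<otimes> mono e (\<delta> + \<beta>'))"
      using r bV V' by (simp add: m_assoc flip: \<delta>(4))
    also have "\<dots> = (r \<otimes> mono 1 \<beta>') \<otimes> mono e' (\<delta> + \<beta>)"
      unfolding \<delta>(3) using r BV[OF \<beta>'] V' by (simp add: m_assoc)
    finally show ?thesis
      using mult_mono_cancel[OF u[OF \<beta>'] _ V'(2) \<delta>(2)] r(1) BV[OF \<beta>'] by simp
  qed
  then show ?thesis using r(1) by blast
qed

end

section \<open>Characters\<close>

text \<open>Artin's argument: the relation at \<open>\<alpha> + \<beta>\<close> minus
  \<open>f h \<alpha>\<close> times the relation at \<open>\<beta>\<close> loses the term of
  \<open>h\<close>. The values are taken on a submonoid \<open>M\<close>, which may consist of the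
  exponents that avoid one variable.\<close>

lemma characters_independent:
  fixes f :: "'c \<Rightarrow> 'm::monoid_add \<Rightarrow> 'k::field"
  assumes "finite A"
    and mult: "\<And>g \<alpha> \<beta>. g \<in> A \<Longrightarrow> \<alpha> \<in> M \<Longrightarrow> \<beta> \<in> M \<Longrightarrow> f g (\<alpha> + \<beta>) = f g \<alpha> * f g \<beta>"
    and one: "\<And>g. g \<in> A \<Longrightarrow> f g 0 = 1"
    and M: "0 \<in> M" "\<And>\<alpha> \<beta>. \<alpha> \<in> M \<Longrightarrow> \<beta> \<in> M \<Longrightarrow> \<alpha> + \<beta> \<in> M"
    and distinct: "\<And>g h. g \<in> A \<Longrightarrow> h \<in> A \<Longrightarrow> g \<noteq> h \<Longrightarrow> \<exists>\<alpha> \<in> M. f g \<alpha> \<noteq> f h \<alpha>"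
    and sum: "\<And>\<beta>. \<beta> \<in> M \<Longrightarrow> (\<Sum>g\<in>A. a g * f g \<beta>) = 0"
    and g: "g \<in> A"
  shows "a g = 0"
  using assms(1) mult one distinct sum g
proof (induction A arbitrary: a g rule: finite_induct)
  case empty
  then show ?case by simp
next
  case (insert h A)
  have A: "a g = 0" if g: "g \<in> A" for g
  proof -
    obtain \<alpha> where \<alpha>: "\<alpha> \<in> M" "f g \<alpha> \<noteq> f h \<alpha>" using insert.prems(3)[of g h] insert.hyps(2) g by auto
    have "a g * (f g \<alpha> - f h \<alpha>) = 0"
    proof (rule insert.IH[where a = "\<lambda>g. a g * (f g \<alpha> - f h \<alpha>)" and g = g])
      fix \<beta> assume \<beta>: "\<beta> \<in> M"
      have "(\<Sum>g\<in>insert h A. a g * f g (\<alpha> + \<beta>)) - f h \<alpha> * (\<Sum>g\<in>insert h A. a g * f g \<beta>) = 0"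
        using insert.prems(4)[of "\<alpha> + \<beta>"] insert.prems(4)[of \<beta>] M(2) \<alpha> \<beta> by simp
      moreover have "(\<Sum>g\<in>insert h A. a g * f g (\<alpha> + \<beta>)) - f h \<alpha> * (\<Sum>g\<in>insert h A. a g * f g \<beta>)
        = (\<Sum>g\<in>insert h A. a g * (f g \<alpha> - f h \<alpha>) * f g \<beta>)"
        unfolding sum_distrib_left sum_subtractf[symmetric]
        using \<alpha> \<beta> by (intro sum.cong) (auto simp: insert.prems(1) algebra_simps)
      ultimately show "(\<Sum>g\<in>A. a g * (f g \<alpha> - f h \<alpha>) * f g \<beta>) = 0"
        using insert.hyps by simp
    qed (use insert.prems g in auto)
    then show ?thesis using \<alpha> by simp
  qed
  have "a h = 0"
    using insert.prems(4)[OF M(1)] insert.hyps A by (simp add: insert.prems(2))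
  then show ?case using A insert.prems(5) by auto
qed

lemma finite_roots_of_unity:
  assumes "n > 0" shows "finite {z :: 'k::field. z ^ n = 1}"
proof -
  have "coeff (Polynomial.monom 1 n - 1 :: 'k poly) n \<noteq> 0" using assms by simp
  then have "Polynomial.monom 1 n - 1 \<noteq> (0 :: 'k poly)" by (metis coeff_0)
  from poly_roots_finite[OF this] show ?thesis by (simp add: poly_monom)
qed

section \<open>Diagonal group actions\<close>

text \<open>What genericity supplies, in abstract form: a finite group of ring automorphisms acting
  diagonally, with eigenvalue \<open>\<chi> g i\<close> on the variable \<open>x_i\<close>. The last
  assumption is semisimplicity of the group algebra.\<close>

locale monomial_action = monomial_ring R V coef mono b
  for R :: "('a, 'z) ring_scheme" (structure) and V and coef :: "'a \<Rightarrow> nat multiset \<Rightarrow> 'k::field"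
    and mono b +
  fixes G :: "('a \<Rightarrow> 'a) set" and \<chi> :: "('a \<Rightarrow> 'a) \<Rightarrow> nat \<Rightarrow> 'k"
  assumes finite_G: "finite G"
    and subgroup_G: "subgroup G (BijGroup (carrier R))"
    and hom_G: "g \<in> G \<Longrightarrow> g \<in> ring_hom R R"
    and act_mono: "g \<in> G \<Longrightarrow> set_mset \<alpha> \<subseteq> V \<Longrightarrow> g (mono c \<alpha>) = mono (c * (\<Prod>i\<in>#\<alpha>. \<chi> g i)) \<alpha>"
    and card_G: "(of_nat (card G) :: 'k) \<noteq> 0"
begin

definition wt :: "('a \<Rightarrow> 'a) \<Rightarrow> nat multiset \<Rightarrow> 'k" where "wt g \<alpha> = (\<Prod>i\<in>#\<alpha>. \<chi> g i)"

abbreviation gmult (infixl \<open>\<cdot>\<close> 75) where "g \<cdot> h \<equiv> g \<otimes>\<^bsub>BijGroup (carrier R)\<^esub> h"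
abbreviation ginv where "ginv g \<equiv> inv\<^bsub>BijGroup (carrier R)\<^esub> g"
abbreviation gone where "gone \<equiv> \<one>\<^bsub>BijGroup (carrier R)\<^esub>"

interpretation B: group "BijGroup (carrier R)" by (rule group_BijGroup)

lemma G_closed [simp]:
  "g \<in> G \<Longrightarrow> h \<in> G \<Longrightarrow> g \<cdot> h \<in> G" "g \<in> G \<Longrightarrow> ginv g \<in> G" "gone \<in> G"
  using subgroup_G by (auto simp: subgroup.m_closed subgroup.m_inv_closed subgroup.one_closed)

lemma G_carrier [simp]: "g \<in> G \<Longrightarrow> g \<in> carrier (BijGroup (carrier R))"
  using subgroup.subset[OF subgroup_G] by auto

lemma G_Bij: "g \<in> G \<Longrightarrow> g \<in> Bij (carrier R)"
  using G_carrier by (simp add: BijGroup_def)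

lemma act_closed [simp]: "g \<in> G \<Longrightarrow> x \<in> carrier R \<Longrightarrow> g x \<in> carrier R"
  using ring_hom_closed[OF hom_G] .

lemma act_add: "g \<in> G \<Longrightarrow> x \<in> carrier R \<Longrightarrow> y \<in> carrier R \<Longrightarrow> g (x \<oplus> y) = g x \<oplus> g y"
  and act_mult: "g \<in> G \<Longrightarrow> x \<in> carrier R \<Longrightarrow> y \<in> carrier R \<Longrightarrow> g (x \<otimes> y) = g x \<otimes> g y"
  and act_one: "g \<in> G \<Longrightarrow> g \<one> = \<one>"
  using hom_G by (simp_all add: ring_hom_add ring_hom_mult ring_hom_one)

lemma gmult_apply [simp]: "g \<in> G \<Longrightarrow> h \<in> G \<Longrightarrow> x \<in> carrier R \<Longrightarrow> (g \<cdot> h) x = g (h x)"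
  using G_Bij by (simp add: BijGroup_def compose_eq)

lemma gone_apply [simp]: "x \<in> carrier R \<Longrightarrow> gone x = x"
  by (simp add: BijGroup_def)

lemma ginv_apply [simp]:
  assumes "g \<in> G" "x \<in> carrier R" shows "g (ginv g x) = x" "ginv g (g x) = x"
  using assms by (simp_all flip: gmult_apply)

lemma G_eqI: "g \<in> G \<Longrightarrow> h \<in> G \<Longrightarrow> (\<And>x. x \<in> carrier R \<Longrightarrow> g x = h x) \<Longrightarrow> g = h"
  using G_Bij by (auto simp: Bij_def intro: extensionalityI)

lemma act_zero: "g \<in> G \<Longrightarrow> g \<zero> = \<zero>"
  using act_add[of g \<zero> \<zero>] by (metis act_closed add.l_cancel_one' l_zero zero_closed)

lemma act_finsum:
  "g \<in> G \<Longrightarrow> (\<And>i. i \<in> A \<Longrightarrow> t i \<in> carrier R) \<Longrightarrow> g (\<Oplus>i\<in>A. t i) = (\<Oplus>i\<in>A. g (t i))"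
  by (induction A rule: infinite_finite_induct) (simp_all add: act_zero act_add Pi_iff)

lemma act_mono_wt [simp]: "g \<in> G \<Longrightarrow> set_mset \<alpha> \<subseteq> V \<Longrightarrow> g (mono c \<alpha>) = mono (c * wt g \<alpha>) \<alpha>"
  by (simp add: act_mono wt_def)

lemma coef_act: "g \<in> G \<Longrightarrow> r \<in> carrier R \<Longrightarrow> coef (g r) \<alpha> = wt g \<alpha> * coef r \<alpha>"
proof -
  assume g: "g \<in> G" and r: "r \<in> carrier R"
  show ?thesis using r
    by (induction r rule: monomial_induct) (simp_all add: g coef_mono coef_add act_add algebra_simps)
qed

lemma wt_empty [simp]: "wt g {#} = 1" and wt_add: "wt g (\<alpha> + \<beta>) = wt g \<alpha> * wt g \<beta>"
  and wt_single: "wt g {#i#} = \<chi> g i"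
  by (simp_all add: wt_def)

lemma wt_gmult: "g \<in> G \<Longrightarrow> h \<in> G \<Longrightarrow> set_mset \<alpha> \<subseteq> V \<Longrightarrow> wt (g \<cdot> h) \<alpha> = wt g \<alpha> * wt h \<alpha>"
  using arg_cong[OF gmult_apply[of g h "mono 1 \<alpha>"], of "\<lambda>r. coef r \<alpha>"]
  by (simp add: coef_mono del: gmult_apply)

lemma wt_gone: "set_mset \<alpha> \<subseteq> V \<Longrightarrow> wt gone \<alpha> = 1"
  using arg_cong[OF gone_apply[of "mono 1 \<alpha>"], of "\<lambda>r. coef r \<alpha>"]
  by (simp add: coef_mono del: gone_apply)

lemma wt_ginv_mult: "g \<in> G \<Longrightarrow> set_mset \<alpha> \<subseteq> V \<Longrightarrow> wt (ginv g) \<alpha> * wt g \<alpha> = 1"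
  using wt_gmult[of "ginv g" g \<alpha>] by (simp add: wt_gone)

lemma wt_nonzero: "g \<in> G \<Longrightarrow> set_mset \<alpha> \<subseteq> V \<Longrightarrow> wt g \<alpha> \<noteq> 0"
  using wt_ginv_mult[of g \<alpha>] by auto

lemma wt_ginv: "g \<in> G \<Longrightarrow> set_mset \<alpha> \<subseteq> V \<Longrightarrow> wt (ginv g) \<alpha> = inverse (wt g \<alpha>)"
  using wt_ginv_mult[of g \<alpha>] wt_nonzero[of g \<alpha>] by (simp add: field_simps)

lemma wt_eqI: "g \<in> G \<Longrightarrow> h \<in> G \<Longrightarrow> (\<And>\<alpha>. set_mset \<alpha> \<subseteq> V \<Longrightarrow> wt g \<alpha> = wt h \<alpha>) \<Longrightarrow> g = h"
proof (rule G_eqI)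
  fix x assume *: "g \<in> G" "h \<in> G" "\<And>\<alpha>. set_mset \<alpha> \<subseteq> V \<Longrightarrow> wt g \<alpha> = wt h \<alpha>" and x: "x \<in> carrier R"
  have "coef (g x) \<alpha> = coef (h x) \<alpha>" for \<alpha>
    using * x coef_supp[OF x, of \<alpha>] by (cases "coef x \<alpha> = 0") (simp_all add: coef_act)
  then show "g x = h x" using * x by (intro coef_eqI) auto
qed

lemma wt_separates:
  "g \<in> G \<Longrightarrow> h \<in> G \<Longrightarrow> g \<noteq> h \<Longrightarrow> \<exists>\<alpha> \<in> {\<alpha>. set_mset \<alpha> \<subseteq> V}. wt g \<alpha> \<noteq> wt h \<alpha>"
  using wt_eqI by blast

lemma bij_ginv: "bij_betw ginv G G"
  by (rule bij_betw_byWitness[where f' = ginv]) auto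

lemma bij_gmult: "k \<in> G \<Longrightarrow> bij_betw (\<lambda>g. k \<cdot> g) G G" "k \<in> G \<Longrightarrow> bij_betw (\<lambda>g. g \<cdot> k) G G"
  by (rule bij_betw_byWitness[where f' = "\<lambda>g. ginv k \<cdot> g"], auto simp flip: B.m_assoc)
    (rule bij_betw_byWitness[where f' = "\<lambda>g. g \<cdot> ginv k"], auto simp: B.m_assoc)

section \<open>Orthogonality and realization of characters\<close>

lemma character_sum:
  assumes mult: "\<And>g h. g \<in> G \<Longrightarrow> h \<in> G \<Longrightarrow> \<psi> (g \<cdot> h) = \<psi> g * \<psi> h" and k: "k \<in> G" "\<psi> k \<noteq> 1"
  shows "(\<Sum>g\<in>G. \<psi> g) = (0::'k)"
proof -
  have "(\<Sum>g\<in>G. \<psi> g) = (\<Sum>g\<in>G. \<psi> (k \<cdot> g))"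
    by (rule sum.reindex_bij_betw[OF bij_gmult(1)[OF k(1)], symmetric])
  also have "\<dots> = \<psi> k * (\<Sum>g\<in>G. \<psi> g)"
    using mult k by (simp add: sum_distrib_left)
  finally show ?thesis using k(2) by (metis mult_cancel_right1)
qed

lemma wt_orthogonal:
  assumes "set_mset \<alpha> \<subseteq> V" "set_mset \<beta> \<subseteq> V"
  shows "(\<Sum>g\<in>G. wt g \<alpha> * wt (ginv g) \<beta>) = (if \<forall>g\<in>G. wt g \<alpha> = wt g \<beta> then of_nat (card G) else 0)"
proof (cases "\<forall>g\<in>G. wt g \<alpha> = wt g \<beta>")
  case True
  then show ?thesis using assms by (simp add: wt_ginv wt_nonzero)
next
  case False
  then obtain k where k: "k \<in> G" "wt k \<alpha> \<noteq> wt k \<beta>" by blast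
  have "(\<Sum>g\<in>G. wt g \<alpha> * wt (ginv g) \<beta>) = 0"
  proof (rule character_sum[OF _ k(1)])
    show "wt k \<alpha> * wt (ginv k) \<beta> \<noteq> 1"
      using k assms by (simp add: wt_ginv wt_nonzero field_simps)
  qed (use assms in \<open>simp add: wt_gmult wt_ginv\<close>)
  then show ?thesis using False by auto
qed

text \<open>
  A character of \<open>G\<close> not of this form would be orthogonal to all the weights \<open>wt _ \<alpha>\<close>,
  contradicting Artin's theorem.
\<close>

lemma character_realized:
  assumes M: "{#} \<in> M" "\<And>\<alpha> \<beta>. \<alpha> \<in> M \<Longrightarrow> \<beta> \<in> M \<Longrightarrow> \<alpha> + \<beta> \<in> M" "\<And>\<alpha>. \<alpha> \<in> M \<Longrightarrow> set_mset \<alpha> \<subseteq> V"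
    and separating: "\<And>g h. g \<in> G \<Longrightarrow> h \<in> G \<Longrightarrow> g \<noteq> h \<Longrightarrow> \<exists>\<alpha> \<in> M. wt g \<alpha> \<noteq> wt h \<alpha>"
    and mult: "\<And>g h. g \<in> G \<Longrightarrow> h \<in> G \<Longrightarrow> \<psi> (g \<cdot> h) = \<psi> g * \<psi> h" and nz: "\<And>g. g \<in> G \<Longrightarrow> \<psi> g \<noteq> 0"
  shows "\<exists>\<alpha> \<in> M. \<forall>g \<in> G. wt g \<alpha> = \<psi> g"
proof (rule ccontr)
  assume *: "\<not> ?thesis"
  have "inverse (\<psi> gone) = 0"
  proof (rule characters_independent[OF finite_G, where f = wt and M = M and a = "\<lambda>g. inverse (\<psi> g)"])
    fix \<alpha> assume \<alpha>: "\<alpha> \<in> M"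
    then obtain k where k: "k \<in> G" "wt k \<alpha> \<noteq> \<psi> k" using * by blast
    show "(\<Sum>g\<in>G. inverse (\<psi> g) * wt g \<alpha>) = 0"
      by (rule character_sum[OF _ k(1)])
        (use k nz mult M(3)[OF \<alpha>] in \<open>simp_all add: wt_gmult field_simps\<close>)
  qed (use M separating in \<open>simp_all add: wt_add\<close>)
  then show False using nz[of gone] by simp
qed

text \<open>Exponents have no negatives, yet the inverse of a weight is a weight. This completes
  \<open>x^\<alpha>\<close> to an invariant monomial \<open>x^(\<delta> + \<alpha>)\<close>.\<close>

lemma wt_inverse_realized:
  assumes "set_mset \<alpha> \<subseteq> V" shows "\<exists>\<delta>. set_mset \<delta> \<subseteq> V \<and> (\<forall>g\<in>G. wt g \<delta> = inverse (wt g \<alpha>))"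
proof -
  have "\<exists>\<delta> \<in> {\<alpha>. set_mset \<alpha> \<subseteq> V}. \<forall>g \<in> G. wt g \<delta> = inverse (wt g \<alpha>)"
    by (rule character_realized) (simp_all add: assms wt_separates[simplified] wt_gmult wt_nonzero)
  then show ?thesis by blast
qed

text \<open>The condition to which all three statements of the theorem are reduced. A diagonal
  element that fixes a hyperplane pointwise has at most one eigenvalue different from 1, and the
  corresponding variable is \<open>i\<close>.\<close>

definition reflection_free :: bool where
  "reflection_free \<longleftrightarrow> (\<forall>i\<in>V. \<forall>g\<in>G. (\<forall>j\<in>V - {i}. \<chi> g j = 1) \<longrightarrow> g = gone)"

text \<open>If the monomials without \<open>x_i\<close> failed to separate \<open>g\<close> and
  \<open>h\<close>, the element \<open>g h^-1\<close> would fix all other variables. Being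
  reflection-free is therefore exactly the separation that \<open>character_realized\<close> asks
  for.\<close>

lemma wt_realized_avoiding:
  assumes rf: reflection_free and \<beta>: "set_mset \<beta> \<subseteq> V" and i: "i \<in> V"
  shows "\<exists>\<alpha>. set_mset \<alpha> \<subseteq> V \<and> i \<notin># \<alpha> \<and> (\<forall>g\<in>G. wt g \<alpha> = wt g \<beta>)"
proof -
  have "\<exists>\<alpha> \<in> {\<alpha>. set_mset \<alpha> \<subseteq> V \<and> i \<notin># \<alpha>}. \<forall>g \<in> G. wt g \<alpha> = wt g \<beta>"
  proof (rule character_realized)
    fix g h assume gh: "g \<in> G" "h \<in> G" "g \<noteq> h"
    have "g = h" if "g \<cdot> ginv h = gone"
      using B.inv_equality[OF that] gh by simp
    then obtain j where j: "j \<in> V - {i}" "\<chi> (g \<cdot> ginv h) j \<noteq> 1"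
      using rf[unfolded reflection_free_def, rule_format, OF i, of "g \<cdot> ginv h"] gh by auto
    then have "wt (g \<cdot> ginv h) {#j#} \<noteq> 1" by (simp add: wt_single)
    then have "wt g {#j#} \<noteq> wt h {#j#}" using j gh by (auto simp: wt_gmult wt_ginv wt_nonzero)
    then show "\<exists>\<alpha>\<in>{\<alpha>. set_mset \<alpha> \<subseteq> V \<and> i \<notin># \<alpha>}. wt g \<alpha> \<noteq> wt h \<alpha>" using j by (intro bexI[of _ "{#j#}"]) auto
  qed (use \<beta> in \<open>auto simp: wt_gmult wt_nonzero\<close>)
  then show ?thesis by blast
qed

lemma independent_wt:
  assumes "\<And>\<beta>. set_mset \<beta> \<subseteq> V \<Longrightarrow> (\<Sum>g\<in>G. a g * wt g \<beta>) = 0" "g \<in> G"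
  shows "a g = 0"
  by (rule characters_independent[OF finite_G, where f = wt and M = "{\<beta>. set_mset \<beta> \<subseteq> V}"])
    (simp_all add: assms wt_separates[simplified] wt_add)

text \<open>Translation by \<open>g\<close> permutes the factors of the product over
  \<open>G\<close>. Weights thus take values among finitely many roots of unity.\<close>

lemma wt_power_card: "g \<in> G \<Longrightarrow> set_mset \<alpha> \<subseteq> V \<Longrightarrow> wt g \<alpha> ^ card G = 1"
proof -
  assume g: "g \<in> G" and \<alpha>: "set_mset \<alpha> \<subseteq> V"
  have "(\<Prod>h\<in>G. wt h \<alpha>) = (\<Prod>h\<in>G. wt (g \<cdot> h) \<alpha>)"
    by (rule prod.reindex_bij_betw[OF bij_gmult(1)[OF g], symmetric])
  also have "\<dots> = wt g \<alpha> ^ card G * (\<Prod>h\<in>G. wt h \<alpha>)"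
    using g \<alpha> by (simp add: wt_gmult prod.distrib)
  finally show ?thesis
    using finite_G \<alpha> wt_nonzero by (simp add: prod_zero_iff)
qed

text \<open>Restriction to \<open>G\<close> makes weights extensional: those agreeing on
  \<open>G\<close> are equal, and all lie in a finite set of functions into roots of unity.\<close>

definition weights :: "(('a \<Rightarrow> 'a) \<Rightarrow> 'k) set" where
  "weights = (\<lambda>\<alpha>. restrict (\<lambda>g. wt g \<alpha>) G) ` {\<alpha>. set_mset \<alpha> \<subseteq> V}"

lemma finite_weights: "finite weights"
proof -
  have m: "card G > 0" using card_G by (metis gr0I of_nat_0)
  have "finite {z :: 'k. z ^ card G = 1}" by (rule finite_roots_of_unity[OF m])
  then have "finite (G \<rightarrow>\<^sub>E {z :: 'k. z ^ card G = 1})" by (rule finite_PiE[OF finite_G])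
  then show ?thesis
    by (rule rev_finite_subset) (auto simp: weights_def wt_power_card)
qed

text \<open>The witness is the inverse Fourier transform of \<open>r\<close>.\<close>

lemma prescribed_transform:
  assumes r: "\<And>\<psi>. \<psi> \<in> weights \<Longrightarrow> r \<psi> \<in> carrier R"
  shows "\<exists>c. (\<forall>g\<in>G. c g \<in> carrier R) \<and> (\<forall>\<beta> \<gamma>. set_mset \<beta> \<subseteq> V \<longrightarrow>
    (\<Sum>g\<in>G. coef (c g) \<gamma> * wt g \<beta>) = coef (r (restrict (\<lambda>g. wt g \<beta>) G)) \<gamma>)"
proof -
  let ?q = "inverse (of_nat (card G)) :: 'k"
  \<comment> \<open>Fourier inversion over \<open>G\<close>: \<open>?q\<close> is the normalization
    by the group order, and \<open>ginv\<close> takes the part of complex conjugation.\<close>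
  define c where "c g = (\<Oplus>\<psi>\<in>weights. mono (?q * \<psi> (ginv g)) {#} \<otimes> r \<psi>)" for g
  have "(\<Sum>g\<in>G. coef (c g) \<gamma> * wt g \<beta>) = coef (r (restrict (\<lambda>g. wt g \<beta>) G)) \<gamma>"
    if \<beta>: "set_mset \<beta> \<subseteq> V" for \<beta> \<gamma>
  proof -
    let ?w = "restrict (\<lambda>g. wt g \<beta>) G"
    have w: "?w \<in> weights" using \<beta> by (auto simp: weights_def)
    have "(\<Sum>g\<in>G. coef (c g) \<gamma> * wt g \<beta>)
      = (\<Sum>g\<in>G. \<Sum>\<psi>\<in>weights. ?q * \<psi> (ginv g) * coef (r \<psi>) \<gamma> * wt g \<beta>)"
      unfolding c_def using r by (intro sum.cong) (simp_all add: coef_finsum coef_scale sum_distrib_right)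
    also have "\<dots> = (\<Sum>\<psi>\<in>weights. ?q * coef (r \<psi>) \<gamma> * (\<Sum>g\<in>G. wt g \<beta> * \<psi> (ginv g)))"
      by (subst sum.swap) (simp add: sum_distrib_left mult_ac)
    also have "\<dots> = (\<Sum>\<psi>\<in>weights. if \<psi> = ?w then coef (r \<psi>) \<gamma> else 0)"
    proof (rule sum.cong[OF refl])
      fix \<psi> assume "\<psi> \<in> weights"
      then obtain \<alpha> where \<alpha>: "set_mset \<alpha> \<subseteq> V" "\<psi> = restrict (\<lambda>g. wt g \<alpha>) G" by (auto simp: weights_def)
      have "(\<Sum>g\<in>G. wt g \<beta> * \<psi> (ginv g)) = (\<Sum>g\<in>G. wt g \<beta> * wt (ginv g) \<alpha>)"
        by (rule sum.cong) (simp_all add: \<alpha>(2))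
      moreover have "(\<forall>g\<in>G. wt g \<beta> = wt g \<alpha>) \<longleftrightarrow> \<psi> = ?w"
        unfolding \<alpha>(2) by (auto simp: fun_eq_iff restrict_def)
      ultimately show "?q * coef (r \<psi>) \<gamma> * (\<Sum>g\<in>G. wt g \<beta> * \<psi> (ginv g)) = (if \<psi> = ?w then coef (r \<psi>) \<gamma> else 0)"
        using card_G by (simp add: wt_orthogonal[OF \<beta> \<alpha>(1)])
    qed
    also have "\<dots> = coef (r ?w) \<gamma>" using finite_weights w by simp
    finally show ?thesis .
  qed
  moreover have "c g \<in> carrier R" for g unfolding c_def using r by (intro finsum_closed) auto
  ultimately show ?thesis by blast
qed

section \<open>The skew group ring\<close>

abbreviation S where "S \<equiv> skew_group_ring R G"
abbreviation N where "N \<equiv> natural_map R G"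
abbreviation emb where "emb \<equiv> skew_emb R G"

lemma S_carrier: "carrier S = G \<rightarrow>\<^sub>E carrier R"
  and S_mult: "a \<otimes>\<^bsub>S\<^esub> c = (\<lambda>h \<in> G. \<Oplus>g \<in> G. a g \<otimes> g (c (ginv g \<cdot> h)))"
  and S_one: "\<one>\<^bsub>S\<^esub> = (\<lambda>g \<in> G. if g = gone then \<one> else \<zero>)"
  and S_zero: "\<zero>\<^bsub>S\<^esub> = (\<lambda>g \<in> G. \<zero>)"
  and S_add: "a \<oplus>\<^bsub>S\<^esub> c = (\<lambda>g \<in> G. a g \<oplus> c g)"
  by (simp_all add: skew_group_ring_def)

lemma S_component [simp]: "a \<in> carrier S \<Longrightarrow> g \<in> G \<Longrightarrow> a g \<in> carrier R"
  by (auto simp: S_carrier)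

lemma S_eqI: "a \<in> carrier S \<Longrightarrow> c \<in> carrier S \<Longrightarrow> (\<And>g. g \<in> G \<Longrightarrow> a g = c g) \<Longrightarrow> a = c"
  by (auto simp: S_carrier intro: PiE_ext)

lemma N_apply: "x \<in> carrier R \<Longrightarrow> N a x = (\<Oplus>g\<in>G. a g \<otimes> g x)"
  by (simp add: natural_map_def)

lemma N_closed [simp]: "a \<in> carrier S \<Longrightarrow> x \<in> carrier R \<Longrightarrow> N a x \<in> carrier R"
  by (auto simp: N_apply intro!: finsum_closed)

lemma coef_N_mono:
  assumes "a \<in> carrier S" "set_mset \<beta> \<subseteq> V"
  shows "coef (N a (mono 1 \<beta>)) (\<gamma> + \<beta>) = (\<Sum>g\<in>G. coef (a g) \<gamma> * wt g \<beta>) * b \<gamma> \<beta>"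
  using assms by (simp add: N_apply coef_finsum coef_mult_mono_add sum_distrib_right)

text \<open>The coefficient of \<open>N a (x^\<beta>)\<close> at \<open>\<gamma> + \<beta>\<close>
  is, up to the nonzero \<open>b \<gamma> \<beta>\<close>, the value at \<open>\<beta>\<close> of a
  combination of the characters \<open>wt g\<close> with coefficients
  \<open>coef (a g) \<gamma>\<close>. Independence recovers these coefficients as
  \<open>\<beta>\<close> varies.\<close>

lemma N_inj:
  assumes a: "a \<in> carrier S" "c \<in> carrier S" and eq: "\<And>x. x \<in> carrier R \<Longrightarrow> N a x = N c x"
  shows "a = c"
proof (rule S_eqI[OF a], rule coef_eqI)
  fix g \<gamma> assume g: "g \<in> G"
  show "coef (a g) \<gamma> = coef (c g) \<gamma>"
  proof (cases "set_mset \<gamma> \<subseteq> V")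
    case True
    have "coef (a g) \<gamma> - coef (c g) \<gamma> = 0"
    proof (rule independent_wt[OF _ g])
      fix \<beta> assume \<beta>: "set_mset \<beta> \<subseteq> V"
      have "(\<Sum>g\<in>G. coef (a g) \<gamma> * wt g \<beta>) * b \<gamma> \<beta> = (\<Sum>g\<in>G. coef (c g) \<gamma> * wt g \<beta>) * b \<gamma> \<beta>"
        using \<beta> by (simp add: eq a flip: coef_N_mono)
      then show "(\<Sum>g\<in>G. (coef (a g) \<gamma> - coef (c g) \<gamma>) * wt g \<beta>) = 0"
        using b_nonzero[OF True \<beta>] by (simp add: left_diff_distrib sum_subtractf)
    qed
    then show ?thesis by simp
  next
    case False
    then have "coef (a g) \<gamma> = 0" "coef (c g) \<gamma> = 0" using coef_supp a g S_component by blast+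
    then show ?thesis by simp
  qed
qed (use a in auto)

lemma S_mult_closed: "a \<in> carrier S \<Longrightarrow> c \<in> carrier S \<Longrightarrow> a \<otimes>\<^bsub>S\<^esub> c \<in> carrier S"
  by (subst S_carrier) (auto simp: S_mult intro!: finsum_closed)

lemma S_add_closed: "a \<in> carrier S \<Longrightarrow> c \<in> carrier S \<Longrightarrow> a \<oplus>\<^bsub>S\<^esub> c \<in> carrier S"
  by (subst S_carrier) (auto simp: S_add)

lemma N_add: "a \<in> carrier S \<Longrightarrow> c \<in> carrier S \<Longrightarrow> x \<in> carrier R \<Longrightarrow> N (a \<oplus>\<^bsub>S\<^esub> c) x = N a x \<oplus> N c x"
  by (rule coef_eqI) (auto simp: S_add_closed N_apply S_add coef_finsum l_distr coef_add sum.distrib intro!: finsum_closed)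

lemma N_additive: "a \<in> carrier S \<Longrightarrow> x \<in> carrier R \<Longrightarrow> y \<in> carrier R \<Longrightarrow> N a (x \<oplus> y) = N a x \<oplus> N a y"
  by (rule coef_eqI) (auto simp: N_apply act_add coef_finsum r_distr coef_add sum.distrib intro!: finsum_closed)

lemma N_mult:
  assumes a: "a \<in> carrier S" and c: "c \<in> carrier S" and x: "x \<in> carrier R"
  shows "N (a \<otimes>\<^bsub>S\<^esub> c) x = N a (N c x)"
proof -
  have "N (a \<otimes>\<^bsub>S\<^esub> c) x = (\<Oplus>h\<in>G. (\<Oplus>g\<in>G. a g \<otimes> g (c (ginv g \<cdot> h))) \<otimes> h x)"
    unfolding N_apply[OF x] using a c x
    by (intro finsum_cong') (auto simp: S_mult intro!: finsum_closed)
  also have "\<dots> = (\<Oplus>h\<in>G. \<Oplus>g\<in>G. a g \<otimes> g (c (ginv g \<cdot> h)) \<otimes> h x)"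
    using a c x finite_G
    by (intro finsum_cong') (auto intro!: finsum_closed finsum_ldistr)
  also have "\<dots> = (\<Oplus>g\<in>G. \<Oplus>h\<in>G. a g \<otimes> g (c (ginv g \<cdot> h)) \<otimes> h x)"
    using a c x by (intro finsum_swap) auto
  also have "\<dots> = (\<Oplus>g\<in>G. a g \<otimes> g (N c x))"
  proof (intro finsum_cong')
    fix g assume g: "g \<in> G"
    have "(\<Oplus>h\<in>G. a g \<otimes> g (c (ginv g \<cdot> h)) \<otimes> h x) = (\<Oplus>h\<in>G. a g \<otimes> g (c (ginv g \<cdot> (g \<cdot> h))) \<otimes> (g \<cdot> h) x)"
      using a c x g by (intro finsum_bij_betw[symmetric] bij_gmult) auto
    also have "\<dots> = (\<Oplus>h\<in>G. a g \<otimes> g (c h \<otimes> h x))"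
      using a c x g by (intro finsum_cong') (auto simp: act_mult m_assoc simp flip: B.m_assoc)
    also have "\<dots> = a g \<otimes> g (N c x)"
      unfolding N_apply[OF x] using a c x g finite_G
      by (subst act_finsum) (auto intro!: finsum_rdistr[symmetric])
    finally show "(\<Oplus>h\<in>G. a g \<otimes> g (c (ginv g \<cdot> h)) \<otimes> h x) = a g \<otimes> g (N c x)" .
  qed (use a c x in auto)
  also have "\<dots> = N a (N c x)" using c x by (simp add: N_apply[of "N c x"])
  finally show ?thesis .
qed

text \<open>\<open>sg g r\<close> is the element \<open>r * g\<close>.\<close>

definition sg :: "('a \<Rightarrow> 'a) \<Rightarrow> 'a \<Rightarrow> ('a \<Rightarrow> 'a) \<Rightarrow> 'a" where
  "sg g r = (\<lambda>h\<in>G. if h = g then r else \<zero>)"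

lemma sg_closed [simp]: "r \<in> carrier R \<Longrightarrow> sg g r \<in> carrier S"
  by (auto simp: S_carrier sg_def)

lemma finsum_delta: "g \<in> G \<Longrightarrow> (\<And>h. h \<in> G \<Longrightarrow> t h \<in> carrier R) \<Longrightarrow> (\<Oplus>h\<in>G. if h = g then t h else \<zero>) = t g"
  using add.finprod_singleton_swap[of g G t] finite_G by auto

lemma N_sg: "g \<in> G \<Longrightarrow> r \<in> carrier R \<Longrightarrow> x \<in> carrier R \<Longrightarrow> N (sg g r) x = r \<otimes> g x"
proof -
  assume *: "g \<in> G" "r \<in> carrier R" "x \<in> carrier R"
  then have "N (sg g r) x = (\<Oplus>h\<in>G. if h = g then r \<otimes> h x else \<zero>)"
    unfolding N_apply[OF *(3)] by (intro finsum_cong') (auto simp: sg_def)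
  also have "\<dots> = r \<otimes> g x" using * by (intro finsum_delta) auto
  finally show ?thesis .
qed

lemma emb_sg: "emb r = sg gone r" and S_one_sg: "\<one>\<^bsub>S\<^esub> = sg gone \<one>"
  by (simp_all add: skew_emb_def sg_def S_one)

lemma N_emb: "r \<in> carrier R \<Longrightarrow> x \<in> carrier R \<Longrightarrow> N (emb r) x = r \<otimes> x"
  by (simp add: emb_sg N_sg)

lemma emb_closed [simp]: "r \<in> carrier R \<Longrightarrow> emb r \<in> carrier S"
  by (simp add: emb_sg)

lemma S_one_closed: "\<one>\<^bsub>S\<^esub> \<in> carrier S"
  by (simp add: S_one_sg)

lemma N_one: "x \<in> carrier R \<Longrightarrow> N \<one>\<^bsub>S\<^esub> x = x"
  by (simp add: S_one_sg N_sg)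

lemma N_zero: "x \<in> carrier R \<Longrightarrow> N \<zero>\<^bsub>S\<^esub> x = \<zero>"
  by (rule coef_eqI) (auto simp: N_apply S_zero coef_finsum intro!: finsum_closed)

lemma S_zero_closed: "\<zero>\<^bsub>S\<^esub> \<in> carrier S"
  by (auto simp: S_zero S_carrier)

lemma S_neg: "a \<in> carrier S \<Longrightarrow> (\<lambda>g\<in>G. \<ominus> a g) \<in> carrier S \<and> (\<lambda>g\<in>G. \<ominus> a g) \<oplus>\<^bsub>S\<^esub> a = \<zero>\<^bsub>S\<^esub>"
  by (auto simp: S_carrier S_add S_zero l_neg intro!: restrict_ext)

text \<open>The ring axioms are pulled back along the injective map \<open>N\<close>.\<close>

lemma ring_S: "ring S"
proof (rule ringI)
  show "abelian_group S"
  proof (rule abelian_groupI)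
    show "\<exists>y\<in>carrier S. y \<oplus>\<^bsub>S\<^esub> x = \<zero>\<^bsub>S\<^esub>" if "x \<in> carrier S" for x
      using S_neg[OF that] by blast
  qed (auto simp: S_add_closed S_zero_closed intro!: N_inj,
      auto simp: S_add_closed S_zero_closed N_add N_zero a_ac)
  show "Group.monoid S"
    by (rule monoidI)
      (auto simp: S_mult_closed S_one_closed intro!: N_inj, auto simp: S_mult_closed S_one_closed N_mult N_one)
qed (auto simp: S_add_closed S_mult_closed intro!: N_inj, auto simp: S_add_closed S_mult_closed N_mult N_add N_additive)

interpretation S: ring S by (rule ring_S)

lemma emb_hom: "emb \<in> ring_hom R S"
  by (rule ring_hom_memI, auto simp: S_add_closed S_mult_closed intro!: N_inj)
    (auto simp: N_add N_mult N_emb N_one l_distr m_assoc)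

section \<open>The skew group ring as a right module over \<open>R\<close>\<close>

abbreviation SM where "SM \<equiv> module_via S emb"

lemma SM: "right_module R SM"
  by (rule right_module_via[OF ring_axioms ring_S emb_hom])

lemma SM_carrier: "carrier SM = carrier S" and SM_add: "x \<oplus>\<^bsub>SM\<^esub> y = x \<oplus>\<^bsub>S\<^esub> y"
  and SM_zero: "\<zero>\<^bsub>SM\<^esub> = \<zero>\<^bsub>S\<^esub>" and SM_smult: "r \<odot>\<^bsub>SM\<^esub> x = x \<otimes>\<^bsub>S\<^esub> emb r"
  by (simp_all add: module_via_def)

lemma S_mult_emb: "a \<in> carrier S \<Longrightarrow> r \<in> carrier R \<Longrightarrow> a \<otimes>\<^bsub>S\<^esub> emb r = (\<lambda>g\<in>G. a g \<otimes> g r)"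
proof (rule N_inj)
  assume *: "a \<in> carrier S" "r \<in> carrier R"
  show cl: "(\<lambda>g\<in>G. a g \<otimes> g r) \<in> carrier S" using * by (auto simp: S_carrier)
  fix x assume x: "x \<in> carrier R"
  show "N (a \<otimes>\<^bsub>S\<^esub> emb r) x = N (\<lambda>g\<in>G. a g \<otimes> g r) x"
    unfolding N_mult[OF *(1) emb_closed[OF *(2)] x] N_emb[OF *(2) x] using * x
    by (subst (1 2) N_apply) (auto simp: act_mult m_assoc intro!: finsum_cong')
qed auto

lemma finsum_S_component:
  "(\<And>i. i \<in> A \<Longrightarrow> t i \<in> carrier S) \<Longrightarrow> h \<in> G \<Longrightarrow> (\<Oplus>\<^bsub>S\<^esub>i\<in>A. t i) h = (\<Oplus>i\<in>A. t i h)"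
  by (induction A rule: infinite_finite_induct) (simp_all add: S_zero S_add Pi_iff)

lemma S_decomp: "a \<in> carrier S \<Longrightarrow> a = (\<Oplus>\<^bsub>S\<^esub>g\<in>G. sg g (a g))"
proof (rule S_eqI)
  assume a: "a \<in> carrier S"
  show "(\<Oplus>\<^bsub>S\<^esub>g\<in>G. sg g (a g)) \<in> carrier S" using a by (intro S.finsum_closed) auto
  fix h assume h: "h \<in> G"
  have "(\<Oplus>\<^bsub>S\<^esub>g\<in>G. sg g (a g)) h = (\<Oplus>g\<in>G. if g = h then a g else \<zero>)"
    using a h by (subst finsum_S_component[OF sg_closed]) (auto simp: sg_def intro!: finsum_cong')
  then show "a h = (\<Oplus>\<^bsub>S\<^esub>g\<in>G. sg g (a g)) h" using finsum_delta[OF h, of a] a by simp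
qed

text \<open>In the skew group ring \<open>(1 * g)(r * 1) = g(r) * g\<close>, so the coordinate of
  \<open>r * g\<close> at the right basis element \<open>1 * g\<close> is \<open>ginv g r\<close>.
  This is the origin of \<open>ginv\<close> in all formulas for homomorphisms out of
  \<open>S\<close>.\<close>

lemma sg_smult: "g \<in> G \<Longrightarrow> r \<in> carrier R \<Longrightarrow> sg g \<one> \<otimes>\<^bsub>S\<^esub> emb (ginv g r) = sg g r"
  by (rule N_inj) (auto simp: N_mult N_sg N_emb act_mult)

lemma SM_hom_formula:
  assumes P: "right_module R P" and f: "f \<in> mod_hom R SM P" and a: "a \<in> carrier S"
  shows "f a = (\<Oplus>\<^bsub>P\<^esub>g\<in>G. ginv g (a g) \<odot>\<^bsub>P\<^esub> f (sg g \<one>))"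
proof -
  interpret P: right_module R P by fact
  have "f a = f (\<Oplus>\<^bsub>SM\<^esub>g\<in>G. sg g (a g))" using S_decomp[OF a] by (simp add: finsum_module_via)
  also have "\<dots> = (\<Oplus>\<^bsub>P\<^esub>g\<in>G. f (sg g (a g)))"
    using a by (intro mod_hom_finsum[OF SM P f]) (auto simp: SM_carrier)
  also have "\<dots> = (\<Oplus>\<^bsub>P\<^esub>g\<in>G. ginv g (a g) \<odot>\<^bsub>P\<^esub> f (sg g \<one>))"
  proof (intro P.M.finsum_cong')
    fix g assume g: "g \<in> G"
    show "f (sg g (a g)) = ginv g (a g) \<odot>\<^bsub>P\<^esub> f (sg g \<one>)"
      using mod_homD(3)[OF f, of "ginv g (a g)" "sg g \<one>"] g a by (simp add: SM_carrier SM_smult sg_smult)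
  qed (use a mod_homD(1)[OF f] in \<open>auto simp: SM_carrier intro!: P.smult_closed\<close>)
  finally show ?thesis .
qed

lemma SM_hom_exists:
  assumes P: "right_module R P" and p: "\<And>g. g \<in> G \<Longrightarrow> p g \<in> carrier P"
  shows "(\<lambda>a\<in>carrier S. \<Oplus>\<^bsub>P\<^esub>g\<in>G. ginv g (a g) \<odot>\<^bsub>P\<^esub> p g) \<in> mod_hom R SM P"
proof (rule mod_homI)
  interpret P: right_module R P by fact
  interpret SM: right_module R SM by (rule SM)
  show "(\<lambda>a\<in>carrier S. \<Oplus>\<^bsub>P\<^esub>g\<in>G. ginv g (a g) \<odot>\<^bsub>P\<^esub> p g) \<in> carrier SM \<rightarrow>\<^sub>E carrier P"
    using p by (auto simp: SM_carrier intro!: P.M.finsum_closed P.smult_closed)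
next
  fix x y assume xy: "x \<in> carrier SM" "y \<in> carrier SM"
  have "(\<Oplus>\<^bsub>P\<^esub>g\<in>G. ginv g ((x \<oplus>\<^bsub>S\<^esub> y) g) \<odot>\<^bsub>P\<^esub> p g) = (\<Oplus>\<^bsub>P\<^esub>g\<in>G. (ginv g (x g) \<oplus> ginv g (y g)) \<odot>\<^bsub>P\<^esub> p g)"
  proof -
    interpret P: right_module R P by fact
    show ?thesis using xy p by (intro P.M.finsum_cong') (auto simp: S_add act_add SM_carrier intro!: P.smult_closed)
  qed
  also have "\<dots> = (\<Oplus>\<^bsub>P\<^esub>g\<in>G. ginv g (x g) \<odot>\<^bsub>P\<^esub> p g) \<oplus>\<^bsub>P\<^esub> (\<Oplus>\<^bsub>P\<^esub>g\<in>G. ginv g (y g) \<odot>\<^bsub>P\<^esub> p g)"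
    using xy p by (intro lin_add[OF P, symmetric]) (auto simp: SM_carrier)
  finally show "(\<lambda>a\<in>carrier S. \<Oplus>\<^bsub>P\<^esub>g\<in>G. ginv g (a g) \<odot>\<^bsub>P\<^esub> p g) (x \<oplus>\<^bsub>SM\<^esub> y)
    = (\<lambda>a\<in>carrier S. \<Oplus>\<^bsub>P\<^esub>g\<in>G. ginv g (a g) \<odot>\<^bsub>P\<^esub> p g) x \<oplus>\<^bsub>P\<^esub> (\<lambda>a\<in>carrier S. \<Oplus>\<^bsub>P\<^esub>g\<in>G. ginv g (a g) \<odot>\<^bsub>P\<^esub> p g) y"
    using xy by (simp add: SM_carrier SM_add)
next
  fix r x assume xy: "r \<in> carrier R" "x \<in> carrier SM"
  have "(\<Oplus>\<^bsub>P\<^esub>g\<in>G. ginv g ((x \<otimes>\<^bsub>S\<^esub> emb r) g) \<odot>\<^bsub>P\<^esub> p g) = (\<Oplus>\<^bsub>P\<^esub>g\<in>G. (ginv g (x g) \<otimes> r) \<odot>\<^bsub>P\<^esub> p g)"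
  proof -
    interpret P: right_module R P by fact
    show ?thesis using xy p
      by (intro P.M.finsum_cong') (auto simp: S_mult_emb act_mult SM_carrier intro!: P.smult_closed)
  qed
  also have "\<dots> = r \<odot>\<^bsub>P\<^esub> (\<Oplus>\<^bsub>P\<^esub>g\<in>G. ginv g (x g) \<odot>\<^bsub>P\<^esub> p g)"
    using xy p by (intro lin_smult[OF P, symmetric]) (auto simp: SM_carrier)
  finally show "(\<lambda>a\<in>carrier S. \<Oplus>\<^bsub>P\<^esub>g\<in>G. ginv g (a g) \<odot>\<^bsub>P\<^esub> p g) (r \<odot>\<^bsub>SM\<^esub> x)
    = r \<odot>\<^bsub>P\<^esub> (\<lambda>a\<in>carrier S. \<Oplus>\<^bsub>P\<^esub>g\<in>G. ginv g (a g) \<odot>\<^bsub>P\<^esub> p g) x"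
    using xy by (simp add: SM_carrier SM_smult)
qed

text \<open>\<open>S\<close> is free over \<open>R\<close> on the elements
  \<open>sg g \<one>\<close>, so it suffices to lift their images.\<close>

lemma SM_projective:
  assumes P: "right_module R P" and M: "right_module R M" and e: "\<epsilon> \<in> mod_hom R P M" "\<epsilon> ` carrier P = carrier M"
    and pi: "\<pi> \<in> mod_hom R SM M"
  shows "\<exists>v \<in> mod_hom R SM P. \<forall>x \<in> carrier SM. \<epsilon> (v x) = \<pi> x"
proof -
  interpret P: right_module R P by fact
  interpret M: right_module R M by fact
  have "\<exists>p. p \<in> carrier P \<and> \<epsilon> p = \<pi> (sg g \<one>)" for g
  proof -
    have "\<pi> (sg g \<one>) \<in> \<epsilon> ` carrier P" unfolding e(2) using mod_homD(1)[OF pi] by (simp add: SM_carrier)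
    then show ?thesis by auto
  qed
  then obtain p where p: "\<And>g. p g \<in> carrier P" "\<And>g. \<epsilon> (p g) = \<pi> (sg g \<one>)" by metis
  define v where "v = (\<lambda>a\<in>carrier S. \<Oplus>\<^bsub>P\<^esub>g\<in>G. ginv g (a g) \<odot>\<^bsub>P\<^esub> p g)"
  have v: "v \<in> mod_hom R SM P" unfolding v_def using SM_hom_exists[OF P] p by blast
  have "\<epsilon> (v a) = \<pi> a" if a: "a \<in> carrier S" for a
  proof -
    have "\<epsilon> (v a) = (\<Oplus>\<^bsub>M\<^esub>g\<in>G. \<epsilon> (ginv g (a g) \<odot>\<^bsub>P\<^esub> p g))"
      unfolding v_def using a p by (simp add: mod_hom_finsum[OF P M e(1)] Pi_iff P.smult_closed)
    also have "\<dots> = (\<Oplus>\<^bsub>M\<^esub>g\<in>G. ginv g (a g) \<odot>\<^bsub>M\<^esub> \<pi> (sg g \<one>))"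
      using a p mod_homD(1)[OF pi]
      by (intro M.M.finsum_cong') (auto simp: mod_homD(3)[OF e(1)] SM_carrier intro!: M.smult_closed)
    also have "\<dots> = \<pi> a" by (rule SM_hom_formula[OF M pi a, symmetric])
    finally show ?thesis .
  qed
  then show ?thesis using v by (auto simp: SM_carrier)
qed

section \<open>The ideal of the averaging idempotent\<close>

abbreviation c0 :: 'k where "c0 \<equiv> inverse (of_nat (card G))"
definition J where "J = Idl\<^bsub>S\<^esub> {\<lambda>g\<in>G. mono c0 {#}}"
abbreviation RR where "RR \<equiv> module_via R (\<lambda>r. r)"

text \<open>\<open>gen \<beta> s\<close> is \<open>x\<^sup>\<beta> e s\<close> for the averaging idempotent \<open>e\<close>, which generates \<open>J\<close>.\<close>

definition gen :: "nat multiset \<Rightarrow> 'a \<Rightarrow> ('a \<Rightarrow> 'a) \<Rightarrow> 'a" where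
  "gen \<beta> s = (\<lambda>g\<in>G. mono c0 \<beta> \<otimes> g s)"

lemma gen_closed [simp]: "set_mset \<beta> \<subseteq> V \<Longrightarrow> s \<in> carrier R \<Longrightarrow> gen \<beta> s \<in> carrier S"
  by (auto simp: gen_def S_carrier)

lemma emb_S_mult: "r \<in> carrier R \<Longrightarrow> a \<in> carrier S \<Longrightarrow> emb r \<otimes>\<^bsub>S\<^esub> a = (\<lambda>g\<in>G. r \<otimes> a g)"
proof (rule N_inj)
  assume *: "r \<in> carrier R" "a \<in> carrier S"
  show "(\<lambda>g\<in>G. r \<otimes> a g) \<in> carrier S" using * by (auto simp: S_carrier)
  fix x assume x: "x \<in> carrier R"
  have "N (emb r \<otimes>\<^bsub>S\<^esub> a) x = r \<otimes> N a x" using * x by (simp add: N_mult N_emb)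
  also have "\<dots> = (\<Oplus>g\<in>G. r \<otimes> (a g \<otimes> g x))"
    using * x finite_G by (simp add: N_apply finsum_rdistr Pi_iff)
  also have "\<dots> = N (\<lambda>g\<in>G. r \<otimes> a g) x"
    unfolding N_apply[OF x] using * x by (auto simp: m_assoc intro!: finsum_cong')
  finally show "N (emb r \<otimes>\<^bsub>S\<^esub> a) x = N (\<lambda>g\<in>G. r \<otimes> a g) x" .
qed auto

lemma averaging_closed: "(\<lambda>g\<in>G. mono c0 {#}) \<in> carrier S"
  by (auto simp: S_carrier)

lemma ideal_J: "ideal J S"
  unfolding J_def using averaging_closed by (intro S.genideal_ideal) simp

lemma J_closed: "a \<in> J \<Longrightarrow> a \<in> carrier S"
  using ideal.Icarr[OF ideal_J] .

lemma gen_in_J: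
  assumes "set_mset \<beta> \<subseteq> V" "s \<in> carrier R"
  shows "gen \<beta> s \<in> J"
proof -
  have "(\<lambda>g\<in>G. mono c0 {#}) \<in> J" unfolding J_def using averaging_closed by (intro S.genideal_self') 
  then have "emb (mono 1 \<beta>) \<otimes>\<^bsub>S\<^esub> (\<lambda>g\<in>G. mono c0 {#}) \<otimes>\<^bsub>S\<^esub> emb s \<in> J"
    using assms by (intro ideal.I_r_closed[OF ideal_J] ideal.I_l_closed[OF ideal_J]) auto
  also have "emb (mono 1 \<beta>) \<otimes>\<^bsub>S\<^esub> (\<lambda>g\<in>G. mono c0 {#}) = (\<lambda>g\<in>G. mono c0 \<beta>)"
    using assms averaging_closed by (auto simp: emb_S_mult mono_scale intro!: restrict_ext)
  also have "(\<lambda>g\<in>G. mono c0 \<beta>) \<otimes>\<^bsub>S\<^esub> emb s = gen \<beta> s"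
    using assms by (subst S_mult_emb) (auto simp: S_carrier gen_def intro!: restrict_ext)
  finally show ?thesis .
qed

lemma gen_smult: "set_mset \<beta> \<subseteq> V \<Longrightarrow> s \<in> carrier R \<Longrightarrow> r \<in> carrier R \<Longrightarrow> gen \<beta> s \<otimes>\<^bsub>S\<^esub> emb r = gen \<beta> (s \<otimes> r)"
  by (subst S_mult_emb[OF gen_closed]) (auto simp: gen_def act_mult m_assoc intro!: restrict_ext)

lemma N_gen: "set_mset \<beta> \<subseteq> V \<Longrightarrow> s \<in> carrier R \<Longrightarrow> x \<in> carrier R \<Longrightarrow>
    N (gen \<beta> s) x = mono c0 \<beta> \<otimes> (\<Oplus>g\<in>G. g (s \<otimes> x))"
  using finite_G
  by (subst N_apply) (auto simp: gen_def finsum_rdistr Pi_iff act_mult m_assoc intro!: finsum_cong')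

text \<open>Because \<open>e h = e\<close>, one has \<open>x^\<beta> e s (r * h) = x^\<beta> e h
  h^-1(s r) = x^\<beta> e h^-1(s r)\<close>.\<close>

lemma gen_sg:
  assumes "set_mset \<beta> \<subseteq> V" "s \<in> carrier R" "r \<in> carrier R" "h \<in> G"
  shows "gen \<beta> s \<otimes>\<^bsub>S\<^esub> sg h r = gen \<beta> (ginv h (s \<otimes> r))"
proof (rule N_inj)
  fix x assume x: "x \<in> carrier R"
  have "(\<Oplus>g\<in>G. g (s \<otimes> (r \<otimes> h x))) = (\<Oplus>g\<in>G. (g \<cdot> h) (ginv h (s \<otimes> r) \<otimes> x))"
    using assms x by (intro finsum_cong') (auto simp: act_mult m_assoc)
  also have "\<dots> = (\<Oplus>g\<in>G. g (ginv h (s \<otimes> r) \<otimes> x))"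
    using assms x by (intro finsum_bij_betw[of "\<lambda>g. g \<cdot> h" G G "\<lambda>g. g (ginv h (s \<otimes> r) \<otimes> x)"] bij_gmult) auto
  finally show "N (gen \<beta> s \<otimes>\<^bsub>S\<^esub> sg h r) x = N (gen \<beta> (ginv h (s \<otimes> r))) x"
    using assms x by (simp add: N_mult N_sg N_gen)
qed (use assms S_mult_closed in auto)

text \<open>Because \<open>h e = e\<close>, one has
  \<open>h x^\<beta> e = wt h \<beta> x^\<beta> e\<close>, and the product of the two monomials
  contributes \<open>b \<alpha> \<beta>\<close>. Scalars are central, so they are collected in the
  right argument and the result is again of the form \<open>gen\<close>.\<close>

lemma sg_gen:
  assumes "set_mset \<beta> \<subseteq> V" "s \<in> carrier R" "set_mset \<alpha> \<subseteq> V" "h \<in> G"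
  shows "sg h (mono c \<alpha>) \<otimes>\<^bsub>S\<^esub> gen \<beta> s = gen (\<alpha> + \<beta>) (mono (c * wt h \<beta> * b \<alpha> \<beta>) {#} \<otimes> s)"
proof (rule N_inj)
  fix x assume x: "x \<in> carrier R"
  let ?A = "\<Oplus>g\<in>G. g (s \<otimes> x)" and ?k = "c * wt h \<beta> * b \<alpha> \<beta>"
  have A: "?A \<in> carrier R" using assms x by (auto intro!: finsum_closed)
  \<comment> \<open>The sum over the group is invariant, which is the identity
    \<open>h e = e\<close> as seen on \<open>R\<close>.\<close>
  have hA: "h ?A = ?A"
  proof -
    have "h ?A = (\<Oplus>g\<in>G. (h \<cdot> g) (s \<otimes> x))"
      using assms x by (subst act_finsum) (auto intro!: finsum_cong')
    also have "\<dots> = ?A" using assms x by (intro finsum_bij_betw[of "\<lambda>g. h \<cdot> g" G G "\<lambda>g. g (s \<otimes> x)"] bij_gmult) auto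
    finally show ?thesis .
  qed
  have kA: "(\<Oplus>g\<in>G. g (mono ?k {#} \<otimes> (s \<otimes> x))) = mono ?k {#} \<otimes> ?A"
    using assms x finite_G by (subst finsum_rdistr) (auto simp: act_mult m_assoc intro!: finsum_cong')
  have "N (sg h (mono c \<alpha>) \<otimes>\<^bsub>S\<^esub> gen \<beta> s) x = mono c \<alpha> \<otimes> h (mono c0 \<beta> \<otimes> ?A)"
    using assms x A by (simp add: N_mult N_sg N_gen)
  also have "\<dots> = mono c \<alpha> \<otimes> mono (c0 * wt h \<beta>) \<beta> \<otimes> ?A"
    using assms A by (simp add: act_mult hA m_assoc)
  also have "mono c \<alpha> \<otimes> mono (c0 * wt h \<beta>) \<beta> = mono c0 (\<alpha> + \<beta>) \<otimes> mono ?k {#}"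
    using assms by (simp add: mono_mult mono_scale mult_ac)
  also have "mono c0 (\<alpha> + \<beta>) \<otimes> mono ?k {#} \<otimes> ?A = N (gen (\<alpha> + \<beta>) (mono ?k {#} \<otimes> s)) x"
    using assms x A by (simp add: N_gen kA m_assoc)
  finally show "N (sg h (mono c \<alpha>) \<otimes>\<^bsub>S\<^esub> gen \<beta> s) x = N (gen (\<alpha> + \<beta>) (mono ?k {#} \<otimes> s)) x" .
qed (use assms S_mult_closed in auto)

text \<open>The finite sums of elements \<open>x^\<beta> e s\<close>, that is \<open>R e R\<close>.
  As an inductive set it allows maps on the ideal to be compared and divisibility to be proved by
  induction along such sums.\<close>

inductive_set gens :: "(('a \<Rightarrow> 'a) \<Rightarrow> 'a) set" where
  gens_zero: "\<zero>\<^bsub>S\<^esub> \<in> gens"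
| gens_add: "a \<in> gens \<Longrightarrow> set_mset \<beta> \<subseteq> V \<Longrightarrow> s \<in> carrier R \<Longrightarrow> a \<oplus>\<^bsub>S\<^esub> gen \<beta> s \<in> gens"

lemma gens_closed: "a \<in> gens \<Longrightarrow> a \<in> carrier S"
  by (induction rule: gens.induct) auto

lemma gens_sum: "c \<in> gens \<Longrightarrow> a \<in> gens \<Longrightarrow> a \<oplus>\<^bsub>S\<^esub> c \<in> gens"
proof (induction rule: gens.induct)
  case (gens_add c \<beta> s)
  then have "a \<oplus>\<^bsub>S\<^esub> c \<oplus>\<^bsub>S\<^esub> gen \<beta> s \<in> gens" by (intro gens.gens_add) auto
  then show ?case using gens_add by (simp add: S.a_assoc gens_closed)
qed (simp add: gens_closed)

lemma gen_in_gens: "set_mset \<beta> \<subseteq> V \<Longrightarrow> s \<in> carrier R \<Longrightarrow> gen \<beta> s \<in> gens"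
  using gens_add[OF gens_zero, of \<beta> s] by simp

lemma gens_finsum: "(\<And>i. i \<in> A \<Longrightarrow> t i \<in> gens) \<Longrightarrow> (\<Oplus>\<^bsub>S\<^esub>i\<in>A. t i) \<in> gens"
proof (induction A rule: infinite_finite_induct)
  case (insert i A)
  have "(\<Oplus>\<^bsub>S\<^esub>i\<in>insert i A. t i) = t i \<oplus>\<^bsub>S\<^esub> (\<Oplus>\<^bsub>S\<^esub>i\<in>A. t i)"
    using insert.hyps insert.prems gens_closed by (intro S.finsum_insert) auto
  then show ?case using insert by (simp add: gens_sum)
qed (simp_all add: gens_zero)

lemma sg_add: "r \<in> carrier R \<Longrightarrow> s \<in> carrier R \<Longrightarrow> sg g (r \<oplus> s) = sg g r \<oplus>\<^bsub>S\<^esub> sg g s"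
  by (auto simp: sg_def S_add intro!: restrict_ext)

lemma gens_ideal: "ideal gens S"
proof (rule idealI[OF ring_S])
  have neg: "a \<in> gens \<Longrightarrow> \<ominus>\<^bsub>S\<^esub> a \<in> gens" for a
  proof (induction rule: gens.induct)
    case (gens_add a \<beta> s)
    have "\<ominus>\<^bsub>S\<^esub> gen \<beta> s = gen \<beta> s \<otimes>\<^bsub>S\<^esub> emb (\<ominus> \<one>)"
    proof -
      have "emb (\<ominus> \<one>) = \<ominus>\<^bsub>S\<^esub> emb \<one>"
      proof (rule S.minus_equality[symmetric])
        show "emb (\<ominus> \<one>) \<oplus>\<^bsub>S\<^esub> emb \<one> = \<zero>\<^bsub>S\<^esub>"
          using ring_hom_add[OF emb_hom, of "\<ominus> \<one>" \<one>] by (simp add: l_neg emb_sg sg_def S_zero if_distrib cong: if_cong)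
      qed auto
      then show ?thesis using gens_add ring_hom_one[OF emb_hom] by (simp add: S.r_minus)
    qed
    then have "\<ominus>\<^bsub>S\<^esub> gen \<beta> s \<in> gens" using gens_add by (simp add: gen_smult gen_in_gens)
    then show ?case using gens_add by (simp add: S.minus_add gens_closed gens_sum)
  qed (simp add: gens_zero)
  show "subgroup gens (add_monoid S)"
  proof (rule S.add.subgroupI)
    show "gens \<subseteq> carrier S" using gens_closed by blast
    show "gens \<noteq> {}" using gens_zero by blast
  qed (use neg gens_sum in blast)+
next
  fix a x assume a: "a \<in> gens" and x: "x \<in> carrier S"
  show "x \<otimes>\<^bsub>S\<^esub> a \<in> gens" using a
  proof (induction rule: gens.induct)
    case (gens_add a \<beta> s)
    have sgr: "sg g r \<otimes>\<^bsub>S\<^esub> gen \<beta> s \<in> gens" if g: "g \<in> G" and r: "r \<in> carrier R" for g r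
      using r
    proof (induction r rule: monomial_induct)
      case (mono c \<alpha>)
      then show ?case using gens_add g by (simp add: sg_gen gen_in_gens)
    next
      case (add r s')
      then show ?case using gens_add by (simp add: sg_add S.l_distr gens_sum)
    qed
    have "x \<otimes>\<^bsub>S\<^esub> gen \<beta> s = (\<Oplus>\<^bsub>S\<^esub>g\<in>G. sg g (x g) \<otimes>\<^bsub>S\<^esub> gen \<beta> s)"
      using gens_add x finite_G by (subst S_decomp[OF x]) (simp add: S.finsum_ldistr Pi_iff)
    also have "\<dots> \<in> gens" using x sgr by (intro gens_finsum) auto
    finally show ?case using gens_add x gens_closed by (simp add: S.r_distr gens_sum)
  qed (simp add: x gens_zero)
  show "a \<otimes>\<^bsub>S\<^esub> x \<in> gens" using a
  proof (induction rule: gens.induct)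
    case (gens_add a \<beta> s)
    have "gen \<beta> s \<otimes>\<^bsub>S\<^esub> x = (\<Oplus>\<^bsub>S\<^esub>g\<in>G. gen \<beta> s \<otimes>\<^bsub>S\<^esub> sg g (x g))"
      using gens_add x finite_G by (subst S_decomp[OF x]) (simp add: S.finsum_rdistr Pi_iff)
    also have "\<dots> \<in> gens" using x gens_add by (intro gens_finsum) (auto simp: gen_sg gen_in_gens)
    finally show ?case using gens_add x gens_closed by (simp add: S.l_distr gens_sum)
  qed (simp add: x gens_zero)
qed

lemma J_subset_gens: "J \<subseteq> gens"
proof -
  have "gen {#} \<one> = (\<lambda>g\<in>G. mono c0 {#})" by (auto simp: gen_def act_one intro!: restrict_ext)
  then have "(\<lambda>g\<in>G. mono c0 {#}) \<in> gens" using gen_in_gens[of "{#}" \<one>] by simp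
  then show ?thesis unfolding J_def by (intro S.genideal_minimal gens_ideal) simp
qed

lemma RR: "right_module R RR"
  by (rule right_module_via[OF ring_axioms ring_axioms]) (auto intro: ring_hom_memI)

lemma RR_simps [simp]: "carrier RR = carrier R" "x \<oplus>\<^bsub>RR\<^esub> y = x \<oplus> y" "\<zero>\<^bsub>RR\<^esub> = \<zero>" "r \<odot>\<^bsub>RR\<^esub> x = x \<otimes> r"
  by (simp_all add: module_via_def)

text \<open>Expanding \<open>f\<close> over the right basis of \<open>S\<close> yields the
  characters \<open>wt (ginv g)\<close>; reindexing by \<open>ginv\<close> brings the formula into
  the shape of \<open>coef_N_mono\<close>. The values \<open>f (sg (ginv g) \<one>)\<close> then act
  like the coefficients of an element of \<open>S\<close>, so that extension from the ideal and
  surjectivity of \<open>N\<close> can share one argument.\<close>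

lemma coef_hom_gen:
  assumes f: "f \<in> mod_hom R SM RR" and \<beta>: "set_mset \<beta> \<subseteq> V"
  shows "coef (f (gen \<beta> \<one>)) \<nu> = (if \<beta> \<subseteq># \<nu> then
    c0 * (\<Sum>g\<in>G. coef (f (sg (ginv g) \<one>)) (\<nu> - \<beta>) * wt g \<beta>) * b (\<nu> - \<beta>) \<beta> else 0)"
proof -
  have fR: "f (sg g \<one>) \<in> carrier R" for g using mod_homD(1)[OF f] by (simp add: SM_carrier)
  have "f (gen \<beta> \<one>) = (\<Oplus>g\<in>G. f (sg g \<one>) \<otimes> ginv g (gen \<beta> \<one> g))"
    using SM_hom_formula[OF RR f, of "gen \<beta> \<one>"] \<beta> by (simp add: finsum_module_via)
  also have "\<dots> = (\<Oplus>g\<in>G. f (sg g \<one>) \<otimes> mono (c0 * wt (ginv g) \<beta>) \<beta>)"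
    using fR \<beta> by (intro finsum_cong') (auto simp: gen_def act_one)
  also have "\<dots> = (\<Oplus>g\<in>G. f (sg (ginv g) \<one>) \<otimes> mono (c0 * wt (ginv (ginv g)) \<beta>) \<beta>)"
    using fR \<beta> by (intro finsum_bij_betw[symmetric] bij_ginv) auto
  also have "\<dots> = (\<Oplus>g\<in>G. f (sg (ginv g) \<one>) \<otimes> mono (c0 * wt g \<beta>) \<beta>)"
    using fR \<beta> by (intro finsum_cong') auto
  finally show ?thesis
    using fR \<beta> by (simp add: coef_finsum coef_mult_mono sum_distrib_left sum_distrib_right mult_ac)
qed

text \<open>\<open>f\<close> is determined by its values at the elements \<open>sg g \<one>\<close>.
  Vanishing at all \<open>gen \<beta> \<one>\<close> is, coefficient by coefficient, a relation
  between the independent characters, so these values are zero. The lemma gives both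
  \<open>Hom(S/J, R) = 0\<close> and uniqueness of extensions from \<open>J\<close>.\<close>

lemma hom_zero_of_J:
  assumes f: "f \<in> mod_hom R SM RR" and zero: "\<And>a. a \<in> J \<Longrightarrow> f a = \<zero>" and a: "a \<in> carrier S"
  shows "f a = \<zero>"
proof -
  have fR: "f (sg g \<one>) \<in> carrier R" for g using mod_homD(1)[OF f] by (simp add: SM_carrier)
  have z: "f (sg (ginv g) \<one>) = \<zero>" if g: "g \<in> G" for g
  proof (rule coef_eqI[OF fR], simp)
    fix \<gamma>
    show "coef (f (sg (ginv g) \<one>)) \<gamma> = coef \<zero> \<gamma>"
    proof (cases "set_mset \<gamma> \<subseteq> V")
      case True
      have "coef (f (sg (ginv g) \<one>)) \<gamma> = 0"
      proof (rule independent_wt[OF _ g])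
        fix \<beta> assume \<beta>: "set_mset \<beta> \<subseteq> V"
        have "coef (f (gen \<beta> \<one>)) (\<gamma> + \<beta>) = 0" using zero[OF gen_in_J[OF \<beta>]] by simp
        then show "(\<Sum>g\<in>G. coef (f (sg (ginv g) \<one>)) \<gamma> * wt g \<beta>) = 0"
          using b_nonzero[OF True \<beta>] card_G by (simp add: coef_hom_gen[OF f \<beta>])
      qed
      then show ?thesis by simp
    next
      case False
      then have "coef (f (sg (ginv g) \<one>)) \<gamma> = 0" using coef_supp[OF fR] by blast
      then show ?thesis by simp
    qed
  qed
  have "f (sg g \<one>) = \<zero>" if "g \<in> G" for g using z[of "ginv g"] that by simp
  then have "f a = (\<Oplus>g\<in>G. \<zero>)"
    unfolding SM_hom_formula[OF RR f a] finsum_module_via using a by (intro finsum_cong') auto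
  then show ?thesis by simp
qed

lemma sg_apply: "h \<in> G \<Longrightarrow> sg g r h = (if h = g then r else \<zero>)"
  by (simp add: sg_def)

lemma weight_eq_iff:
  "restrict (\<lambda>g. wt g \<alpha>) G = restrict (\<lambda>g. wt g \<beta>) G \<longleftrightarrow> (\<forall>g\<in>G. wt g \<alpha> = wt g \<beta>)"
  by (auto simp: fun_eq_iff restrict_def)

text \<open>The common core of the vanishing of \<open>Ext^1\<close> and of the surjectivity of
  \<open>N\<close>. Within one weight \<open>common_left_factor\<close> makes \<open>u\<close> a
  left multiplication by some \<open>r\<close>; Fourier inversion turns the family of these factors,
  indexed by weights, into coefficients \<open>c\<close> indexed by \<open>G\<close>. The exponent
  \<open>\<delta>\<close> leaves room for completing monomials to invariants.\<close>

lemma weightwise_left_factor: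
  assumes rf: reflection_free
    and u: "\<And>\<beta>. set_mset \<beta> \<subseteq> V \<Longrightarrow> u \<beta> \<in> carrier R"
    and rel: "\<And>\<beta> \<beta>'. set_mset \<beta> \<subseteq> V \<Longrightarrow> set_mset \<beta>' \<subseteq> V \<Longrightarrow> (\<And>g. g \<in> G \<Longrightarrow> wt g \<beta> = wt g \<beta>') \<Longrightarrow>
      \<exists>\<delta> e e'. set_mset \<delta> \<subseteq> V \<and> e \<noteq> 0 \<and> e' \<noteq> 0 \<and>
        mono 1 \<beta> \<otimes> mono e (\<delta> + \<beta>') = mono 1 \<beta>' \<otimes> mono e' (\<delta> + \<beta>) \<and>
        u \<beta> \<otimes> mono e (\<delta> + \<beta>') = u \<beta>' \<otimes> mono e' (\<delta> + \<beta>)"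
  shows "\<exists>c. (\<forall>g\<in>G. c g \<in> carrier R) \<and> (\<forall>\<beta> \<nu>. set_mset \<beta> \<subseteq> V \<longrightarrow> coef (u \<beta>) \<nu> =
    (if \<beta> \<subseteq># \<nu> then (\<Sum>g\<in>G. coef (c g) (\<nu> - \<beta>) * wt g \<beta>) * b (\<nu> - \<beta>) \<beta> else 0))"
proof -
  have "\<exists>r \<in> carrier R. \<forall>\<beta>. set_mset \<beta> \<subseteq> V \<and> restrict (\<lambda>g. wt g \<beta>) G = \<psi> \<longrightarrow> u \<beta> = r \<otimes> mono 1 \<beta>"
    if \<psi>: "\<psi> \<in> weights" for \<psi>
  proof -
    let ?B = "{\<beta>. set_mset \<beta> \<subseteq> V \<and> restrict (\<lambda>g. wt g \<beta>) G = \<psi>}"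
    obtain \<beta>0 where \<beta>0: "\<beta>0 \<in> ?B" using \<psi> by (auto simp: weights_def)
    have "\<exists>r \<in> carrier R. \<forall>\<beta> \<in> ?B. u \<beta> = r \<otimes> mono 1 \<beta>"
    proof (rule common_left_factor)
      show "?B \<noteq> {}" using \<beta>0 by blast
      fix i assume "i \<in> V"
      then obtain \<alpha> where \<alpha>: "set_mset \<alpha> \<subseteq> V" "i \<notin># \<alpha>" "\<forall>g\<in>G. wt g \<alpha> = wt g \<beta>0"
        using wt_realized_avoiding[OF rf, of \<beta>0 i] \<beta>0 by auto
      then have "\<alpha> \<in> ?B" using \<beta>0 weight_eq_iff[of \<alpha> \<beta>0] by simp
      then show "\<exists>\<beta>\<in>?B. i \<notin># \<beta>" using \<alpha>(2) by (rule rev_bexI)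
    next
      fix \<beta> \<beta>' assume \<beta>: "\<beta> \<in> ?B" "\<beta>' \<in> ?B"
      show "\<exists>\<delta> e e'. set_mset \<delta> \<subseteq> V \<and> e \<noteq> 0 \<and> e' \<noteq> 0 \<and>
        mono 1 \<beta> \<otimes> mono e (\<delta> + \<beta>') = mono 1 \<beta>' \<otimes> mono e' (\<delta> + \<beta>) \<and>
        u \<beta> \<otimes> mono e (\<delta> + \<beta>') = u \<beta>' \<otimes> mono e' (\<delta> + \<beta>)"
        using \<beta> weight_eq_iff[of \<beta> \<beta>'] by (intro rel) auto
    qed (use u in auto)
    then show ?thesis by blast
  qed
  then obtain r where r: "\<And>\<psi>. \<psi> \<in> weights \<Longrightarrow> r \<psi> \<in> carrier R"
    "\<And>\<psi> \<beta>. \<psi> \<in> weights \<Longrightarrow> set_mset \<beta> \<subseteq> V \<Longrightarrow> restrict (\<lambda>g. wt g \<beta>) G = \<psi> \<Longrightarrow> u \<beta> = r \<psi> \<otimes> mono 1 \<beta>"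
    by metis
  from prescribed_transform[of r, OF r(1)]
  obtain c where c: "\<forall>g\<in>G. c g \<in> carrier R"
    "\<And>\<beta> \<gamma>. set_mset \<beta> \<subseteq> V \<Longrightarrow> (\<Sum>g\<in>G. coef (c g) \<gamma> * wt g \<beta>) = coef (r (restrict (\<lambda>g. wt g \<beta>) G)) \<gamma>" by blast
  have "coef (u \<beta>) \<nu> = (if \<beta> \<subseteq># \<nu> then (\<Sum>g\<in>G. coef (c g) (\<nu> - \<beta>) * wt g \<beta>) * b (\<nu> - \<beta>) \<beta> else 0)"
    if \<beta>: "set_mset \<beta> \<subseteq> V" for \<beta> \<nu>
  proof -
    have w: "restrict (\<lambda>g. wt g \<beta>) G \<in> weights" using \<beta> by (auto simp: weights_def)
    show ?thesis
      unfolding r(2)[OF w \<beta> refl] by (simp add: coef_mult_mono r(1)[OF w] \<beta> c(2)[OF \<beta>])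
  qed
  then show ?thesis using c(1) by blast
qed

subsection \<open>Vanishing of the first Ext group\<close>

lemma reflection_free_extends:
  assumes rf: reflection_free
  shows "extends_from_ker R SM J RR"
  unfolding extends_from_ker_def
proof
  fix \<eta> assume \<eta>: "\<eta> \<in> mod_hom R (SM\<lparr>carrier := J\<rparr>) RR"
  have \<eta>c: "a \<in> J \<Longrightarrow> \<eta> a \<in> carrier R"
    and \<eta>a: "a \<in> J \<Longrightarrow> c \<in> J \<Longrightarrow> \<eta> (a \<oplus>\<^bsub>S\<^esub> c) = \<eta> a \<oplus> \<eta> c"
    and \<eta>m: "r \<in> carrier R \<Longrightarrow> a \<in> J \<Longrightarrow> \<eta> (a \<otimes>\<^bsub>S\<^esub> emb r) = \<eta> a \<otimes> r" for a c r
    using mod_homD(1-3)[OF \<eta>] by (simp_all add: SM_add SM_smult)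
  define u where "u \<beta> = \<eta> (gen \<beta> \<one>)" for \<beta>
  have u: "u \<beta> \<in> carrier R" if "set_mset \<beta> \<subseteq> V" for \<beta> using that by (simp add: u_def \<eta>c gen_in_J)
  have \<eta>_gen: "\<eta> (gen \<beta> s) = u \<beta> \<otimes> s" if "set_mset \<beta> \<subseteq> V" "s \<in> carrier R" for \<beta> s
    using \<eta>m[OF that(2) gen_in_J[OF that(1) one_closed]] that by (simp add: u_def gen_smult)
  have "\<exists>c. (\<forall>g\<in>G. c g \<in> carrier R) \<and> (\<forall>\<beta> \<nu>. set_mset \<beta> \<subseteq> V \<longrightarrow> coef (u \<beta>) \<nu> =
    (if \<beta> \<subseteq># \<nu> then (\<Sum>g\<in>G. coef (c g) (\<nu> - \<beta>) * wt g \<beta>) * b (\<nu> - \<beta>) \<beta> else 0))"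
  proof (rule weightwise_left_factor[OF rf u])
    fix \<beta> \<beta>' assume \<beta>: "set_mset \<beta> \<subseteq> V" "set_mset \<beta>' \<subseteq> V" and w: "\<And>g. g \<in> G \<Longrightarrow> wt g \<beta> = wt g \<beta>'"
    \<comment> \<open>With equal weights, moving \<open>e\<close> past \<open>x^\<beta>\<close> or
      past \<open>x^\<beta>'\<close> gives the same factor at every \<open>g\<close>, so the two
      elements differ only by structure constants, which the scalars equalize. No additional
      exponent is required, and \<open>\<delta>\<close> is taken empty.\<close>
    have "gen \<beta> (mono (b \<beta>' \<beta>) \<beta>') = gen \<beta>' (mono (b \<beta> \<beta>') \<beta>)"
      using \<beta> w by (auto simp: gen_def mono_mult add.commute mult_ac intro!: restrict_ext)
    then have "u \<beta> \<otimes> mono (b \<beta>' \<beta>) \<beta>' = u \<beta>' \<otimes> mono (b \<beta> \<beta>') \<beta>"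
      using \<beta> by (simp flip: \<eta>_gen)
    moreover have "mono 1 \<beta> \<otimes> mono (b \<beta>' \<beta>) \<beta>' = mono 1 \<beta>' \<otimes> mono (b \<beta> \<beta>') \<beta>"
      using \<beta> by (simp add: mono_mult add.commute mult_ac)
    ultimately show "\<exists>\<delta> e e'. set_mset \<delta> \<subseteq> V \<and> e \<noteq> 0 \<and> e' \<noteq> 0 \<and>
      mono 1 \<beta> \<otimes> mono e (\<delta> + \<beta>') = mono 1 \<beta>' \<otimes> mono e' (\<delta> + \<beta>) \<and>
      u \<beta> \<otimes> mono e (\<delta> + \<beta>') = u \<beta>' \<otimes> mono e' (\<delta> + \<beta>)"
      using b_nonzero \<beta> by (intro exI[of _ "{#}"] exI[of _ "b \<beta>' \<beta>"] exI[of _ "b \<beta> \<beta>'"]) auto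
  qed
  then obtain c where c: "\<And>g. g \<in> G \<Longrightarrow> c g \<in> carrier R"
    "\<And>\<beta> \<nu>. set_mset \<beta> \<subseteq> V \<Longrightarrow> coef (u \<beta>) \<nu> =
      (if \<beta> \<subseteq># \<nu> then (\<Sum>g\<in>G. coef (c g) (\<nu> - \<beta>) * wt g \<beta>) * b (\<nu> - \<beta>) \<beta> else 0)" by blast
  \<comment> \<open>The factor \<open>card G\<close> cancels the \<open>c0\<close> of
    \<open>coef_hom_gen\<close>, and \<open>ginv\<close> its reindexing.\<close>
  define q where "q g = mono (of_nat (card G)) {#} \<otimes> c (ginv g)" for g
  have q: "q g \<in> carrier R" if "g \<in> G" for g using c(1) that by (simp add: q_def)
  define H where "H = (\<lambda>a\<in>carrier S. \<Oplus>\<^bsub>RR\<^esub>g\<in>G. ginv g (a g) \<odot>\<^bsub>RR\<^esub> q g)"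
  have H: "H \<in> mod_hom R SM RR"
    unfolding H_def using q by (intro SM_hom_exists[OF RR]) simp
  have H_sg: "H (sg g \<one>) = q g" if g: "g \<in> G" for g
  proof -
    have "H (sg g \<one>) = (\<Oplus>h\<in>G. if h = g then q g else \<zero>)"
      unfolding H_def using q g
      by (auto simp: finsum_module_via sg_apply act_one act_zero intro!: finsum_cong')
    then show ?thesis using finsum_delta[OF g, of "\<lambda>h. q g"] q g by simp
  qed
  have H_gen1: "H (gen \<beta> \<one>) = u \<beta>" if \<beta>: "set_mset \<beta> \<subseteq> V" for \<beta>
  proof (rule coef_eqI)
    have "c0 * (\<Sum>g\<in>G. coef (H (sg (ginv g) \<one>)) \<gamma> * wt g \<beta>) = (\<Sum>g\<in>G. coef (c g) \<gamma> * wt g \<beta>)" for \<gamma>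
      unfolding sum_distrib_left using card_G c(1) by (intro sum.cong) (simp_all add: H_sg q_def coef_scale)
    then show "coef (H (gen \<beta> \<one>)) \<nu> = coef (u \<beta>) \<nu>" for \<nu>
      unfolding coef_hom_gen[OF H \<beta>] c(2)[OF \<beta>] by simp
  qed (use \<beta> u mod_homD(1)[OF H] in \<open>auto simp: SM_carrier\<close>)
  have H_gen: "H (gen \<beta> s) = u \<beta> \<otimes> s" if "set_mset \<beta> \<subseteq> V" "s \<in> carrier R" for \<beta> s
    using mod_homD(3)[OF H that(2), of "gen \<beta> \<one>"] that
    by (simp add: SM_carrier SM_smult gen_smult H_gen1)
  have "a \<in> gens \<Longrightarrow> a \<in> J \<and> H a = \<eta> a" for a
  proof (induction rule: gens.induct)
    case gens_zero
    interpret J: right_module R "SM\<lparr>carrier := J\<rparr>"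
      using ideal.Icarr[OF ideal_J] additive_subgroup.zero_closed[OF ideal.axioms(1)[OF ideal_J]]
        additive_subgroup.a_closed[OF ideal.axioms(1)[OF ideal_J]] ideal.I_r_closed[OF ideal_J]
      by (intro right_module_subset[OF SM]) (auto simp: SM_carrier SM_zero SM_add SM_smult)
    show ?case
      using mod_hom_zero[OF SM RR H] mod_hom_zero[OF J.right_module_axioms RR \<eta>]
        additive_subgroup.zero_closed[OF ideal.axioms(1)[OF ideal_J]] by (simp add: SM_zero)
  next
    case (gens_add a \<beta> s)
    then have J: "a \<in> J" "gen \<beta> s \<in> J" "a \<oplus>\<^bsub>S\<^esub> gen \<beta> s \<in> J"
      using gen_in_J additive_subgroup.a_closed[OF ideal.axioms(1)[OF ideal_J]] by auto
    then show ?case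
      using gens_add mod_homD(2)[OF H, of a "gen \<beta> s"] J_closed by (simp add: SM_carrier SM_add \<eta>a H_gen \<eta>_gen)
  qed
  then have "\<forall>a\<in>J. H a = \<eta> a" using J_subset_gens by blast
  then show "\<exists>H\<in>mod_hom R SM RR. \<forall>k\<in>J. H k = \<eta> k" using H by blast
qed

text \<open>
  A reflection \<open>h\<close> in the variable \<open>x\<^sub>i\<close> makes \<open>x \<ominus> h x\<close> divisible by \<open>x\<^sub>i\<close>; the quotient is not
  given by an element of \<open>S\<close>.
\<close>

lemma reflection_divides:
  assumes h: "h \<in> G" and one: "\<And>j. j \<in> V - {i} \<Longrightarrow> \<chi> h j = 1" and x: "x \<in> carrier R"
    and nz: "coef (x \<ominus> h x) \<alpha> \<noteq> 0"
  shows "i \<in># \<alpha>"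
proof (rule ccontr)
  assume i: "i \<notin># \<alpha>"
  have nz': "coef x \<alpha> \<noteq> 0" using nz h x by (auto simp: coef_minus coef_act)
  have "wt h \<alpha> = 1" if "set_mset \<alpha> \<subseteq> V - {i}" for \<alpha>
    using that one by (induction \<alpha>) (auto simp: wt_def)
  then have "wt h \<alpha> = 1" using coef_supp[OF x nz'] i by blast
  then show False using nz h x by (simp add: coef_minus coef_act)
qed

text \<open>The map \<open>\<tau>\<close> below takes values in \<open>x_i R\<close> on
  \<open>J\<close>, and its quotient by \<open>x_i\<close> is a homomorphism from \<open>J\<close>
  to \<open>R\<close>. If \<open>H\<close> extended it, \<open>x_i H\<close> and
  \<open>\<tau>\<close> would agree on \<open>J\<close>, hence on all of \<open>S\<close> by
  \<open>hom_zero_of_J\<close>; but \<open>\<tau>\<close> takes the value 1 at the identity, which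
  is no multiple of \<open>x_i\<close>.\<close>

lemma extends_reflection_free:
  assumes ext: "extends_from_ker R SM J RR"
  shows reflection_free
proof (rule ccontr)
  assume "\<not> reflection_free"
  then obtain i h where ih: "i \<in> V" "h \<in> G" "\<And>j. j \<in> V - {i} \<Longrightarrow> \<chi> h j = 1" "h \<noteq> gone"
    unfolding reflection_free_def by blast
  let ?x = "mono 1 {#i#}"
  have xi: "?x \<in> carrier R" and iV: "set_mset {#i#} \<subseteq> V" using ih(1) by auto
  \<comment> \<open>On the right basis \<open>sg g \<one>\<close> this map is 1 at the identity,
    \<open>-1\<close> at \<open>h\<close> and 0 elsewhere, so it sends \<open>x^\<beta> e s\<close>
    to a scalar multiple of \<open>(x^\<beta> - h^-1(x^\<beta>)) s\<close>.\<close>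
  define \<tau> where "\<tau> a = a gone \<ominus> ginv h (a h)" for a
  have \<tau>c: "\<tau> a \<in> carrier R" if "a \<in> carrier S" for a using that ih(2) by (simp add: \<tau>_def)
  have \<tau>a: "\<tau> (a \<oplus>\<^bsub>S\<^esub> c) = \<tau> a \<oplus> \<tau> c" if "a \<in> carrier S" "c \<in> carrier S" for a c
    using that ih(2) by (intro coef_eqI) (auto simp: \<tau>_def S_add act_add coef_minus coef_add)
  have \<tau>m: "\<tau> (a \<otimes>\<^bsub>S\<^esub> emb r) = \<tau> a \<otimes> r" if "a \<in> carrier S" "r \<in> carrier R" for a r
    using that ih(2) by (simp add: \<tau>_def S_mult_emb act_mult minus_eq l_distr l_minus)
  have "\<exists>y \<in> carrier R. \<tau> a = ?x \<otimes> y" if "a \<in> gens" for a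
    using that
  proof (induction rule: gens.induct)
    case gens_zero
    then show ?case using ih(2) xi by (intro bexI[of _ \<zero>]) (auto simp: \<tau>_def S_zero act_zero minus_eq)
  next
    case (gens_add a \<beta> s)
    then obtain y where y: "y \<in> carrier R" "\<tau> a = ?x \<otimes> y" by blast
    let ?m = "mono (c0 * wt (ginv h) \<beta>) \<beta>"
    \<comment> \<open>\<open>?m\<close> is the image of \<open>c0 x^\<beta>\<close> under
      \<open>ginv h\<close>, so the difference is \<open>-(?m - h ?m)\<close>, to which
      \<open>reflection_divides\<close> applies.\<close>
    have "i \<in># \<alpha>" if "coef (mono c0 \<beta> \<ominus> ?m) \<alpha> \<noteq> 0" for \<alpha>
    proof -
      have "coef (?m \<ominus> h ?m) \<alpha> \<noteq> 0"
        using that gens_add ih(2) by (auto simp: coef_minus wt_ginv wt_nonzero coef_mono split: if_splits)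
      moreover have "?m \<in> carrier R" using gens_add by simp
      ultimately show ?thesis using reflection_divides[OF ih(2), of i ?m \<alpha>] ih(3) by blast
    qed
    then obtain z where z: "z \<in> carrier R" "mono c0 \<beta> \<ominus> ?m = ?x \<otimes> z"
      using left_divisible[OF _ iV, of "mono c0 \<beta> \<ominus> ?m"] gens_add by auto
    have "\<tau> (gen \<beta> s) = (mono c0 \<beta> \<ominus> ?m) \<otimes> s"
      using gens_add ih(2) by (simp add: \<tau>_def gen_def act_mult minus_eq l_distr l_minus)
    then have "\<tau> (a \<oplus>\<^bsub>S\<^esub> gen \<beta> s) = ?x \<otimes> (y \<oplus> z \<otimes> s)"
      using gens_add gens_closed y z xi by (simp add: \<tau>a r_distr m_assoc)
    then show ?case using gens_add y z by (intro bexI[of _ "y \<oplus> z \<otimes> s"]) auto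
  qed
  then have "\<forall>a\<in>J. \<exists>y. y \<in> carrier R \<and> \<tau> a = ?x \<otimes> y" using J_subset_gens by blast
  from bchoice[OF this]
  obtain q where q: "\<And>a. a \<in> J \<Longrightarrow> q a \<in> carrier R" "\<And>a. a \<in> J \<Longrightarrow> \<tau> a = ?x \<otimes> q a"
    by auto
  have cancel: "r = s" if "r \<in> carrier R" "s \<in> carrier R" "?x \<otimes> r = ?x \<otimes> s" for r s
    using mono_mult_cancel[OF that(1,2) iV that(3)] .
  note Ja = additive_subgroup.a_closed[OF ideal.axioms(1)[OF ideal_J]]
  note Jm = ideal.I_r_closed[OF ideal_J]
  have "restrict q J \<in> mod_hom R (SM\<lparr>carrier := J\<rparr>) RR"
  proof (rule mod_homI)
    show "restrict q J \<in> carrier (SM\<lparr>carrier := J\<rparr>) \<rightarrow>\<^sub>E carrier RR" using q(1) by simp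
  next
    fix a c assume "a \<in> carrier (SM\<lparr>carrier := J\<rparr>)" "c \<in> carrier (SM\<lparr>carrier := J\<rparr>)"
    then have ac: "a \<in> J" "c \<in> J" by auto
    have "?x \<otimes> q (a \<oplus>\<^bsub>S\<^esub> c) = \<tau> a \<oplus> \<tau> c"
      using q(2)[OF Ja[OF ac]] \<tau>a[OF J_closed[OF ac(1)] J_closed[OF ac(2)]] by simp
    also have "\<dots> = ?x \<otimes> (q a \<oplus> q c)" using q ac xi by (simp add: r_distr)
    finally have "q (a \<oplus>\<^bsub>S\<^esub> c) = q a \<oplus> q c"
      by (rule cancel[rotated 2]) (use q(1) ac Ja[OF ac] in simp_all)
    then show "restrict q J (a \<oplus>\<^bsub>SM\<lparr>carrier := J\<rparr>\<^esub> c) = restrict q J a \<oplus>\<^bsub>RR\<^esub> restrict q J c"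
      using ac Ja[OF ac] by (simp add: SM_add)
  next
    fix r a assume "r \<in> carrier R" "a \<in> carrier (SM\<lparr>carrier := J\<rparr>)"
    then have ac: "a \<in> J" "r \<in> carrier R" by auto
    have am: "a \<otimes>\<^bsub>S\<^esub> emb r \<in> J" using ac by (intro Jm) auto
    have "?x \<otimes> q (a \<otimes>\<^bsub>S\<^esub> emb r) = \<tau> a \<otimes> r"
      using q(2)[OF am] \<tau>m[OF J_closed[OF ac(1)] ac(2)] by simp
    also have "\<dots> = ?x \<otimes> (q a \<otimes> r)" using q ac xi by (simp add: m_assoc)
    finally have "q (a \<otimes>\<^bsub>S\<^esub> emb r) = q a \<otimes> r"
      by (rule cancel[rotated 2]) (use q(1) ac am in simp_all)
    then show "restrict q J (r \<odot>\<^bsub>SM\<lparr>carrier := J\<rparr>\<^esub> a) = r \<odot>\<^bsub>RR\<^esub> restrict q J a"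
      using ac am by (simp add: SM_smult)
  qed
  from bspec[OF ext[unfolded extends_from_ker_def] this]
  obtain H where H: "H \<in> mod_hom R SM RR" "\<And>a. a \<in> J \<Longrightarrow> H a = q a" by auto
  note DH = mod_homD(1-3)[OF H(1), unfolded SM_carrier SM_add SM_smult RR_simps]
  \<comment> \<open>The difference vanishes on \<open>J\<close> and therefore everywhere; evaluation
    at the identity of \<open>S\<close> then gives the contradiction.\<close>
  define D where "D = (\<lambda>a\<in>carrier S. ?x \<otimes> H a \<ominus> \<tau> a)"
  have "D \<in> mod_hom R SM RR"
  proof (rule mod_homI, unfold SM_carrier SM_add SM_smult RR_simps)
    show "D \<in> carrier S \<rightarrow>\<^sub>E carrier R" using xi by (auto simp: D_def DH \<tau>c)
  next
    fix a c assume ac: "a \<in> carrier S" "c \<in> carrier S"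
    then have "?x \<otimes> H a \<in> carrier R" "?x \<otimes> H c \<in> carrier R" using xi DH(1) by auto
    then show "D (a \<oplus>\<^bsub>S\<^esub> c) = D a \<oplus> D c"
      using ac xi \<tau>c by (simp add: D_def DH \<tau>a r_distr minus_eq minus_add a_ac)
  next
    fix r a assume ra: "r \<in> carrier R" "a \<in> carrier S"
    then show "D (a \<otimes>\<^bsub>S\<^esub> emb r) = D a \<otimes> r"
      using xi \<tau>c by (simp add: D_def S_mult_closed DH \<tau>m m_assoc minus_eq l_distr l_minus)
  qed
  moreover have "D a = \<zero>" if "a \<in> J" for a
    using that J_closed q xi by (simp add: D_def H(2) minus_eq r_neg)
  ultimately have "D \<one>\<^bsub>S\<^esub> = \<zero>" by (rule hom_zero_of_J[OF _ _ S_one_closed])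
  moreover have "\<tau> \<one>\<^bsub>S\<^esub> = \<one>" using ih(2,4) by (simp add: \<tau>_def S_one act_zero minus_eq)
  ultimately have "coef (?x \<otimes> H \<one>\<^bsub>S\<^esub> \<ominus> \<one>) {#} = 0" by (simp add: D_def S_one_closed)
  then show False using xi iV DH(1) S_one_closed by (simp add: coef_minus coef_mono_mult coef_one)
qed

text \<open>\<open>S\<close> is projective over \<open>R\<close> and maps onto
  \<open>S Quot J\<close> with kernel \<open>J\<close>, so it can replace the resolution chosen in
  \<open>Ext\<close>; degree 0 imposes no condition.\<close>

theorem homologically_small_iff:
  "grade R (module_via (S Quot J) (\<lambda>r. J +>\<^bsub>S\<^esub> emb r)) \<ge> 2 \<longleftrightarrow> reflection_free"
proof -
  interpret J: ideal J S by (rule ideal_J)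
  interpret Q: ring "S Quot J" by (rule J.quotient_is_ring)
  let ?M = "module_via (S Quot J) (\<lambda>r. J +>\<^bsub>S\<^esub> emb r)"
  have hom: "(\<lambda>r. J +>\<^bsub>S\<^esub> emb r) \<in> ring_hom R (S Quot J)"
    using ring_hom_trans[OF emb_hom J.rcos_ring_hom] by (simp add: o_def)
  have M: "right_module R ?M" by (rule right_module_via[OF ring_axioms Q.ring_axioms hom])
  have cM: "carrier ?M = carrier (S Quot J)" and zM: "\<zero>\<^bsub>?M\<^esub> = J"
    by (simp_all add: module_via_def FactRing_def)
  define \<pi> where "\<pi> = (\<lambda>a\<in>carrier S. J +>\<^bsub>S\<^esub> a)"
  have \<pi>: "\<pi> \<in> mod_hom R SM ?M"
  proof (rule mod_homI, unfold SM_carrier SM_add SM_smult cM)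
    show "\<pi> \<in> carrier S \<rightarrow>\<^sub>E carrier (S Quot J)"
      using ring_hom_closed[OF J.rcos_ring_hom] by (auto simp: \<pi>_def)
    show "\<pi> (x \<oplus>\<^bsub>S\<^esub> y) = \<pi> x \<oplus>\<^bsub>?M\<^esub> \<pi> y" if "x \<in> carrier S" "y \<in> carrier S" for x y
      using that ring_hom_add[OF J.rcos_ring_hom that] by (simp add: \<pi>_def module_via_def)
    show "\<pi> (x \<otimes>\<^bsub>S\<^esub> emb r) = r \<odot>\<^bsub>?M\<^esub> \<pi> x" if "r \<in> carrier R" "x \<in> carrier S" for r x
      using that ring_hom_mult[OF J.rcos_ring_hom that(2), of "emb r"] by (simp add: \<pi>_def module_via_def)
  qed
  have surj: "\<pi> ` carrier SM = carrier ?M"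
    unfolding cM SM_carrier by (auto simp: \<pi>_def FactRing_def A_RCOSETS_def')
  have ker: "hom_ker SM ?M \<pi> = J"
  proof -
    have "J +>\<^bsub>S\<^esub> a = J \<longleftrightarrow> a \<in> J" if "a \<in> carrier S" for a
      using that S.a_coset_join1[OF _ that J.a_subgroup] S.a_coset_join2[OF that J.a_subgroup] by blast
    then show ?thesis using J_closed by (auto simp: hom_ker_def \<pi>_def SM_carrier zM)
  qed
  have proj: "\<exists>v \<in> mod_hom R SM P. \<forall>x \<in> carrier SM. \<epsilon> (v x) = \<pi> x"
    if "right_module R P" "\<epsilon> \<in> mod_hom R P ?M" "\<epsilon> ` carrier P = carrier ?M"
    for P :: "('a, ((('a \<Rightarrow> 'a) \<Rightarrow> 'a) set \<times> 'a) list) module" and \<epsilon>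
    using SM_projective[OF that(1) M that(2,3) \<pi>] .
  have "\<forall>f \<in> mod_hom R ?M RR. \<forall>x \<in> carrier ?M. f x = \<zero>"
  proof (intro ballI)
    fix f x assume f: "f \<in> mod_hom R ?M RR" and "x \<in> carrier ?M"
    then obtain a where a: "a \<in> carrier S" "x = \<pi> a" unfolding surj[symmetric] by (auto simp: SM_carrier)
    have "compose (carrier SM) f \<pi> \<in> mod_hom R SM RR" by (rule mod_hom_compose[OF SM \<pi> f])
    then have "compose (carrier SM) f \<pi> a = \<zero>"
    proof (rule hom_zero_of_J[OF _ _ a(1)])
      fix a assume "a \<in> J"
      then have "a \<in> hom_ker SM ?M \<pi>" using ker by simp
      then show "compose (carrier SM) f \<pi> a = \<zero>"
        using mod_hom_zero[OF M RR f] by (simp add: compose_def hom_ker_def)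
    qed
    then show "f x = \<zero>" using a by (simp add: compose_def SM_carrier)
  qed
  then show ?thesis
    using grade_ge_2_iff[OF M RR SM one_neq_zero \<pi> surj proj] reflection_free_extends extends_reflection_free
    unfolding ker by blast
qed

subsection \<open>The endomorphism ring over the fixed ring\<close>

abbreviation RG where "RG \<equiv> fixed_ring R G"
abbreviation E where "E \<equiv> End_ring RG RR"

lemma RG_carrier: "r \<in> carrier RG \<longleftrightarrow> r \<in> carrier R \<and> (\<forall>g\<in>G. g r = r)"
  by (simp add: fixed_ring_def)

lemma E_carrier: "carrier E = mod_hom RG RR RR"
  and E_mult: "f \<otimes>\<^bsub>E\<^esub> h = compose (carrier R) f h"
  and E_one: "\<one>\<^bsub>E\<^esub> = (\<lambda>x\<in>carrier R. x)"
  and E_add: "f \<oplus>\<^bsub>E\<^esub> h = (\<lambda>x\<in>carrier R. f x \<oplus> h x)"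
  by (simp_all add: End_ring_def)

lemma N_extensional: "N a \<in> extensional (carrier R)"
  by (simp add: natural_map_def)

lemma N_in_E:
  assumes a: "a \<in> carrier S" shows "N a \<in> carrier E"
  unfolding E_carrier
proof (rule mod_homI, unfold RR_simps)
  show "N a \<in> carrier R \<rightarrow>\<^sub>E carrier R" using a N_extensional by (auto simp: PiE_iff)
  show "N a (x \<oplus> y) = N a x \<oplus> N a y" if "x \<in> carrier R" "y \<in> carrier R" for x y
    using N_additive[OF a that] .
  show "N a (x \<otimes> r) = N a x \<otimes> r" if r: "r \<in> carrier RG" and x: "x \<in> carrier R" for r x
  proof -
    have r': "r \<in> carrier R" "\<And>g. g \<in> G \<Longrightarrow> g r = r" using r by (simp_all add: RG_carrier)
    have "N a (x \<otimes> r) = (\<Oplus>g\<in>G. a g \<otimes> g x \<otimes> r)"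
      unfolding N_apply[OF m_closed[OF x r'(1)]]
    proof (intro finsum_cong')
      fix g assume g: "g \<in> G"
      then show "a g \<otimes> g (x \<otimes> r) = a g \<otimes> g x \<otimes> r"
        using a x r'(1) by (simp add: act_mult r'(2)[OF g] m_assoc)
    qed (use a x r' in auto)
    also have "\<dots> = N a x \<otimes> r"
      unfolding N_apply[OF x] using a x r' finite_G by (intro finsum_ldistr[symmetric]) auto
    finally show ?thesis .
  qed
qed

lemma N_ring_hom: "N \<in> ring_hom S E"
proof (rule ring_hom_memI)
  show "N a \<in> carrier E" if "a \<in> carrier S" for a using N_in_E[OF that] .
  show "N (a \<otimes>\<^bsub>S\<^esub> c) = N a \<otimes>\<^bsub>E\<^esub> N c" if "a \<in> carrier S" "c \<in> carrier S" for a c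
    using that by (intro extensionalityI[OF N_extensional]) (auto simp: E_mult N_mult compose_def)
  show "N (a \<oplus>\<^bsub>S\<^esub> c) = N a \<oplus>\<^bsub>E\<^esub> N c" if "a \<in> carrier S" "c \<in> carrier S" for a c
    using that by (intro extensionalityI[OF N_extensional]) (auto simp: E_add N_add)
  show "N \<one>\<^bsub>S\<^esub> = \<one>\<^bsub>E\<^esub>"
    by (intro extensionalityI[OF N_extensional]) (auto simp: E_one N_one)
qed

text \<open>Scalars are fixed by \<open>G\<close>, so maps linear over the fixed ring are linear
  over the field and are determined by their values on monomials.\<close>

lemma E_hom_scalar:
  assumes "f \<in> carrier E" "set_mset \<alpha> \<subseteq> V"
  shows "f (mono c \<alpha>) = f (mono 1 \<alpha>) \<otimes> mono c {#}"
proof -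
  have "mono c {#} \<in> carrier RG" by (simp add: RG_carrier)
  from mod_homD(3)[OF assms(1)[unfolded E_carrier] this, of "mono 1 \<alpha>"] assms(2)
  show ?thesis by (simp add: mono_scale)
qed

lemma E_eqI:
  assumes f: "f \<in> carrier E" and h: "h \<in> carrier E"
    and eq: "\<And>\<alpha>. set_mset \<alpha> \<subseteq> V \<Longrightarrow> f (mono 1 \<alpha>) = h (mono 1 \<alpha>)"
  shows "f = h"
proof -
  have "f x = h x" if "x \<in> carrier R" for x
    using that
  proof (induction x rule: monomial_induct)
    case (mono c \<alpha>)
    show ?case
      by (subst E_hom_scalar[OF f mono], subst E_hom_scalar[OF h mono]) (simp only: eq[OF mono])
  next
    case (add r s)
    then show ?case using mod_homD(2)[OF f[unfolded E_carrier]] mod_homD(2)[OF h[unfolded E_carrier]] by simp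
  qed
  then show ?thesis using mod_hom_eqI[OF f[unfolded E_carrier] h[unfolded E_carrier]] by simp
qed

lemma reflection_free_surj:
  assumes rf: reflection_free and f: "f \<in> carrier E"
  shows "\<exists>a \<in> carrier S. N a = f"
proof -
  note Df = mod_homD(1-3)[OF f[unfolded E_carrier], unfolded RR_simps]
  define u where "u \<beta> = f (mono 1 \<beta>)" for \<beta>
  have u: "u \<beta> \<in> carrier R" if "set_mset \<beta> \<subseteq> V" for \<beta> using that by (simp add: u_def Df)
  have "\<exists>c. (\<forall>g\<in>G. c g \<in> carrier R) \<and> (\<forall>\<beta> \<nu>. set_mset \<beta> \<subseteq> V \<longrightarrow> coef (u \<beta>) \<nu> =
    (if \<beta> \<subseteq># \<nu> then (\<Sum>g\<in>G. coef (c g) (\<nu> - \<beta>) * wt g \<beta>) * b (\<nu> - \<beta>) \<beta> else 0))"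
  proof (rule weightwise_left_factor[OF rf u])
    fix \<beta> \<beta>' assume \<beta>: "set_mset \<beta> \<subseteq> V" "set_mset \<beta>' \<subseteq> V" and w: "\<And>g. g \<in> G \<Longrightarrow> wt g \<beta> = wt g \<beta>'"
    \<comment> \<open>\<open>f\<close> commutes only with invariant elements. This choice makes
      \<open>x^(\<delta> + \<beta>)\<close> invariant, and also
      \<open>x^(\<delta> + \<beta>')\<close> since the weights of \<open>\<beta>\<close> and
      \<open>\<beta>'\<close> agree.\<close>
    obtain \<delta> where \<delta>: "set_mset \<delta> \<subseteq> V" "\<And>g. g \<in> G \<Longrightarrow> wt g \<delta> = inverse (wt g \<beta>)"
      using wt_inverse_realized[OF \<beta>(1)] by auto
    have V: "set_mset (\<delta> + \<beta>) \<subseteq> V" "set_mset (\<delta> + \<beta>') \<subseteq> V" using \<delta> \<beta> by auto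
    have w1: "wt g (\<delta> + \<beta>) = 1" "wt g (\<delta> + \<beta>') = 1" if "g \<in> G" for g
      using that \<beta> w[OF that] wt_nonzero[OF that \<beta>(1)] by (simp_all add: wt_add \<delta>(2))
    \<comment> \<open>Both products have the exponent \<open>\<delta> + \<beta> + \<beta>'\<close>;
      each scalar is the structure constant of the other product, which makes them equal.\<close>
    let ?e = "b \<beta>' (\<delta> + \<beta>)" and ?e' = "b \<beta> (\<delta> + \<beta>')"
    have inv: "mono c (\<delta> + \<beta>) \<in> carrier RG" "mono c (\<delta> + \<beta>') \<in> carrier RG" for c
      using V w1 by (simp_all add: RG_carrier del: set_mset_union)
    have eq: "mono 1 \<beta> \<otimes> mono ?e (\<delta> + \<beta>') = mono 1 \<beta>' \<otimes> mono ?e' (\<delta> + \<beta>)"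
      using V \<beta> by (simp add: mono_mult ac_simps del: set_mset_union)
    have "u \<beta> \<otimes> mono ?e (\<delta> + \<beta>') = f (mono 1 \<beta> \<otimes> mono ?e (\<delta> + \<beta>'))"
      using Df(3)[OF inv(2)] \<beta> by (simp add: u_def)
    also have "\<dots> = u \<beta>' \<otimes> mono ?e' (\<delta> + \<beta>)"
      unfolding eq using Df(3)[OF inv(1)] \<beta> by (simp add: u_def)
    finally show "\<exists>\<delta> e e'. set_mset \<delta> \<subseteq> V \<and> e \<noteq> 0 \<and> e' \<noteq> 0 \<and>
      mono 1 \<beta> \<otimes> mono e (\<delta> + \<beta>') = mono 1 \<beta>' \<otimes> mono e' (\<delta> + \<beta>) \<and>
      u \<beta> \<otimes> mono e (\<delta> + \<beta>') = u \<beta>' \<otimes> mono e' (\<delta> + \<beta>)"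
      using b_nonzero V \<beta> \<delta>(1) eq
      by (intro exI[of _ \<delta>] exI[of _ ?e] exI[of _ ?e']) (simp del: set_mset_union)
  qed
  then obtain c where c: "\<And>g. g \<in> G \<Longrightarrow> c g \<in> carrier R"
    "\<And>\<beta> \<nu>. set_mset \<beta> \<subseteq> V \<Longrightarrow> coef (u \<beta>) \<nu> =
      (if \<beta> \<subseteq># \<nu> then (\<Sum>g\<in>G. coef (c g) (\<nu> - \<beta>) * wt g \<beta>) * b (\<nu> - \<beta>) \<beta> else 0)" by blast
  let ?a = "restrict c G"
  have a: "?a \<in> carrier S" using c(1) by (simp add: S_carrier)
  have "N ?a = f"
  proof (rule E_eqI[OF N_in_E[OF a] f], rule coef_eqI)
    fix \<beta> \<nu> assume \<beta>: "set_mset \<beta> \<subseteq> V"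
    show "coef (N ?a (mono 1 \<beta>)) \<nu> = coef (f (mono 1 \<beta>)) \<nu>"
      unfolding u_def[symmetric] c(2)[OF \<beta>]
      using \<beta> c(1) by (simp add: N_apply coef_finsum coef_mult_mono sum_distrib_right)
  qed (use a Df(1) in auto)
  then show ?thesis using a by blast
qed

text \<open>Since \<open>h\<close> fixes \<open>R^G\<close>, the map \<open>x_i^-1 (1 - h)\<close>
  is linear over it. An element \<open>a\<close> of \<open>S\<close> inducing it would satisfy
  \<open>x_i a = 1 - h\<close> in \<open>S\<close>, because \<open>N\<close> is injective.\<close>

lemma surj_reflection_free:
  assumes surj: "N ` carrier S = carrier E"
  shows reflection_free
proof (rule ccontr)
  assume "\<not> reflection_free"
  then obtain i h where ih: "i \<in> V" "h \<in> G" "\<And>j. j \<in> V - {i} \<Longrightarrow> \<chi> h j = 1" "h \<noteq> gone"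
    unfolding reflection_free_def by blast
  let ?x = "mono 1 {#i#}"
  have xi: "?x \<in> carrier R" and iV: "set_mset {#i#} \<subseteq> V" using ih(1) by auto
  have "\<exists>y \<in> carrier R. x \<ominus> h x = ?x \<otimes> y" if x: "x \<in> carrier R" for x
  proof (rule left_divisible[OF _ iV])
    show "x \<ominus> h x \<in> carrier R" using x ih(2) by simp
    fix \<alpha> assume "coef (x \<ominus> h x) \<alpha> \<noteq> 0"
    then have "i \<in># \<alpha>" using reflection_divides[OF ih(2) _ x, of i \<alpha>] ih(3) by blast
    then show "{#i#} \<subseteq># \<alpha>" by simp
  qed
  then obtain q where q: "\<And>x. x \<in> carrier R \<Longrightarrow> q x \<in> carrier R"
    "\<And>x. x \<in> carrier R \<Longrightarrow> x \<ominus> h x = ?x \<otimes> q x" by metis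
  have cancel: "r = s" if "r \<in> carrier R" "s \<in> carrier R" "?x \<otimes> r = ?x \<otimes> s" for r s
    using mono_mult_cancel[OF that(1,2) iV that(3)] .
  have "restrict q (carrier R) \<in> carrier E"
    unfolding E_carrier
  proof (rule mod_homI, unfold RR_simps)
    show "restrict q (carrier R) \<in> carrier R \<rightarrow>\<^sub>E carrier R" using q(1) by simp
    show "restrict q (carrier R) (x \<oplus> y) = restrict q (carrier R) x \<oplus> restrict q (carrier R) y"
      if xy: "x \<in> carrier R" "y \<in> carrier R" for x y
    proof -
      have "?x \<otimes> q (x \<oplus> y) = (x \<oplus> y) \<ominus> h (x \<oplus> y)" using q(2) xy by simp
      also have "\<dots> = (x \<ominus> h x) \<oplus> (y \<ominus> h y)"
        using xy ih(2) by (intro coef_eqI) (simp_all add: act_add coef_minus coef_add)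
      also have "\<dots> = ?x \<otimes> (q x \<oplus> q y)" using q xy xi by (simp add: r_distr)
      finally have "q (x \<oplus> y) = q x \<oplus> q y"
        by (rule cancel[rotated 2]) (use q(1) xy in simp_all)
      then show ?thesis using xy by simp
    qed
    show "restrict q (carrier R) (x \<otimes> r) = restrict q (carrier R) x \<otimes> r"
      if r: "r \<in> carrier RG" and x: "x \<in> carrier R" for r x
    proof -
      have r': "r \<in> carrier R" "h r = r" using r ih(2) by (simp_all add: RG_carrier)
      have "?x \<otimes> q (x \<otimes> r) = (x \<otimes> r) \<ominus> h (x \<otimes> r)" using q(2) x r' by simp
      also have "\<dots> = (x \<ominus> h x) \<otimes> r"
        using x r' ih(2) by (simp add: act_mult minus_eq l_distr l_minus)
      also have "\<dots> = ?x \<otimes> (q x \<otimes> r)" using q x xi r' by (simp add: m_assoc)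
      finally have "q (x \<otimes> r) = q x \<otimes> r"
        by (rule cancel[rotated 2]) (use q(1) x r' in simp_all)
      then show ?thesis using x r' by simp
    qed
  qed
  then have "restrict q (carrier R) \<in> N ` carrier S" by (simp only: surj)
  then obtain a where a: "a \<in> carrier S" "N a = restrict q (carrier R)"
    by (rule imageE) (rule that, assumption, erule sym)
  let ?c = "\<lambda>g\<in>G. ?x \<otimes> a g"
  have c: "?c \<in> carrier S" using a xi by (auto simp: S_carrier)
  have "?c \<oplus>\<^bsub>S\<^esub> sg h \<one> = \<one>\<^bsub>S\<^esub>"
  proof (rule N_inj)
    fix x assume x: "x \<in> carrier R"
    have "N ?c x = ?x \<otimes> N a x"
      using N_mult[OF emb_closed[OF xi] a(1) x] N_emb[OF xi q(1)[OF x]] a x xi by (simp add: emb_S_mult)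
    also have "\<dots> = x \<ominus> h x" using a(2) x q(2) by simp
    finally have "N (?c \<oplus>\<^bsub>S\<^esub> sg h \<one>) x = (x \<ominus> h x) \<oplus> h x"
      using c x ih(2) by (simp add: N_add N_sg)
    also have "\<dots> = x" using x ih(2) by (simp add: minus_eq a_assoc l_neg)
    finally show "N (?c \<oplus>\<^bsub>S\<^esub> sg h \<one>) x = N \<one>\<^bsub>S\<^esub> x" using x by (simp add: N_one)
  qed (use c S_add_closed S_one_closed in auto)
  \<comment> \<open>As \<open>h\<close> is not the identity, the component at the identity reads
    \<open>x_i a_1 = 1\<close>, which the constant coefficient refutes.\<close>
  from fun_cong[OF this, of gone] have "?x \<otimes> a gone = \<one>"
    using ih(4) a xi by (auto simp: S_add S_one sg_apply split: if_splits)
  from arg_cong[OF this, of "\<lambda>r. coef r {#}"] show False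
    using a iV by (simp add: coef_mono_mult coef_one)
qed

section \<open>Degrees\<close>

definition hom_part :: "int \<Rightarrow> 'a set" where
  "hom_part d = {r \<in> carrier R. \<forall>\<alpha>. coef r \<alpha> \<noteq> 0 \<longrightarrow> int (size \<alpha>) = d}"

lemma hom_part_mono: "set_mset \<alpha> \<subseteq> V \<Longrightarrow> mono c \<alpha> \<in> hom_part (int (size \<alpha>))"
  by (auto simp: hom_part_def coef_mono)

text \<open>Forwards, degrees add under multiplication and are kept by \<open>G\<close>. Backwards,
  the images of all monomials are tested: coefficients of a wrong degree form a vanishing
  combination of characters for every \<open>\<beta>\<close>, hence are zero.\<close>

lemma N_degree:
  assumes a: "a \<in> carrier S"
  shows "(\<forall>g\<in>G. a g \<in> hom_part d) \<longleftrightarrow> (\<forall>m. N a ` hom_part m \<subseteq> hom_part (m + d))"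
proof (intro iffI allI ballI subsetI)
  fix m y assume ad: "\<forall>g\<in>G. a g \<in> hom_part d" and "y \<in> N a ` hom_part m"
  then obtain x where x: "x \<in> hom_part m" "y = N a x" by blast
  have xR: "x \<in> carrier R" using x by (simp add: hom_part_def)
  have *: "int (size \<gamma>) = m + d"
    if r: "r \<in> carrier R" "\<And>\<alpha>. coef r \<alpha> \<noteq> 0 \<Longrightarrow> int (size \<alpha>) = d"
      and s: "s \<in> carrier R" "\<And>\<alpha>. coef s \<alpha> \<noteq> 0 \<Longrightarrow> int (size \<alpha>) = m"
      and nz: "coef (r \<otimes> s) \<gamma> \<noteq> 0" for r s \<gamma>
  proof -
    \<comment> \<open>Every exponent in a product is a sum of exponents of the factors; the
      induction peels one monomial at a time off \<open>s\<close>.\<close>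
    have "\<exists>\<alpha> \<beta>. coef r \<alpha> \<noteq> 0 \<and> coef s \<beta> \<noteq> 0 \<and> \<gamma> = \<alpha> + \<beta>"
      using s(1) nz
    proof (induction "{\<beta>. coef s \<beta> \<noteq> 0}" arbitrary: s rule: infinite_finite_induct)
      case infinite
      then show ?case using coef_finite by auto
    next
      case empty
      then have "s = \<zero>" by (intro coef_eqI) auto
      then show ?case using empty r by simp
    next
      case (insert \<beta> F)
      have \<beta>: "coef s \<beta> \<noteq> 0" using insert.hyps(4) by blast
      have V: "set_mset \<beta> \<subseteq> V" using coef_supp[OF insert.prems(1) \<beta>] .
      let ?m = "mono (coef s \<beta>) \<beta>"
      have s': "s \<ominus> ?m \<in> carrier R" using insert.prems V by simp
      have F: "F = {\<beta>. coef (s \<ominus> ?m) \<beta> \<noteq> 0}"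
        using insert.hyps insert.prems(1) V by (auto simp: coef_minus coef_mono)
      have "r \<otimes> s = r \<otimes> (s \<ominus> ?m) \<oplus> r \<otimes> ?m"
        using r insert.prems(1) V s' by (simp add: minus_eq a_assoc l_neg flip: r_distr)
      then consider "coef (r \<otimes> (s \<ominus> ?m)) \<gamma> \<noteq> 0" | "coef (r \<otimes> ?m) \<gamma> \<noteq> 0"
        using insert.prems(2) r s' V by (fastforce simp: coef_add)
      then show ?case
      proof cases
        case 1
        then obtain \<alpha> \<beta>' where *: "coef r \<alpha> \<noteq> 0" "coef (s \<ominus> ?m) \<beta>' \<noteq> 0" "\<gamma> = \<alpha> + \<beta>'"
          using insert.hyps(3)[OF F s'] by blast
        then have "coef s \<beta>' \<noteq> 0" using insert.hyps(4) F by blast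
        then show ?thesis using * by blast
      next
        case 2
        then have "\<beta> \<subseteq># \<gamma>" "coef r (\<gamma> - \<beta>) \<noteq> 0" using r V by (auto simp: coef_mult_mono split: if_splits)
        then show ?thesis using \<beta> by (intro exI[of _ "\<gamma> - \<beta>"] exI[of _ \<beta>]) simp
      qed
    qed
    then show ?thesis using r(2) s(2) by force
  qed
  have "int (size \<gamma>) = m + d" if "coef (N a x) \<gamma> \<noteq> 0" for \<gamma>
  proof -
    have "(\<Sum>g\<in>G. coef (a g \<otimes> g x) \<gamma>) \<noteq> 0" using that a xR by (simp add: N_apply coef_finsum)
    then obtain g where g: "g \<in> G" "coef (a g \<otimes> g x) \<gamma> \<noteq> 0"
      by (rule sum.not_neutral_contains_not_neutral)
    show ?thesis
    proof (rule *[OF _ _ _ _ g(2)])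
      show "int (size \<alpha>) = d" if "coef (a g) \<alpha> \<noteq> 0" for \<alpha> using that ad g(1) by (simp add: hom_part_def)
      show "int (size \<alpha>) = m" if "coef (g x) \<alpha> \<noteq> 0" for \<alpha>
        using that x(1) g(1) xR by (auto simp: hom_part_def coef_act)
    qed (use g a xR in auto)
  qed
  then show "y \<in> hom_part (m + d)" using x a xR by (simp add: hom_part_def)
next
  fix g assume N: "\<forall>m. N a ` hom_part m \<subseteq> hom_part (m + d)" and g: "g \<in> G"
  have "int (size \<gamma>) = d" if nz: "coef (a g) \<gamma> \<noteq> 0" for \<gamma>
  proof (rule ccontr)
    assume d: "int (size \<gamma>) \<noteq> d"
    have \<gamma>: "set_mset \<gamma> \<subseteq> V" using coef_supp[OF _ nz] a g by simp
    have "coef (a g) \<gamma> = 0"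
    proof (rule independent_wt[OF _ g])
      fix \<beta> assume \<beta>: "set_mset \<beta> \<subseteq> V"
      have "N a (mono 1 \<beta>) \<in> hom_part (int (size \<beta>) + d)" using N hom_part_mono[OF \<beta>] by blast
      then have "coef (N a (mono 1 \<beta>)) (\<gamma> + \<beta>) = 0" using d by (force simp: hom_part_def)
      then show "(\<Sum>g\<in>G. coef (a g) \<gamma> * wt g \<beta>) = 0"
        using coef_N_mono[OF a \<beta>] b_nonzero[OF \<gamma> \<beta>] by simp
    qed
    then show False using nz by simp
  qed
  then show "a g \<in> hom_part d" using a g by (simp add: hom_part_def)
qed

theorem natural_map_iso_iff:
  "N \<in> graded_algebra_iso
     S (\<lambda>c. emb (mono c {#})) (\<lambda>d. {a \<in> carrier S. \<forall>g \<in> G. a g \<in> hom_part d})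
     E (\<lambda>c. \<lambda>x \<in> carrier R. mono c {#} \<otimes> x)
       (\<lambda>d. {f \<in> carrier E. \<forall>m. f ` hom_part m \<subseteq> hom_part (m + d)}) \<longleftrightarrow> reflection_free"
proof
  assume "N \<in> graded_algebra_iso
     S (\<lambda>c. emb (mono c {#})) (\<lambda>d. {a \<in> carrier S. \<forall>g \<in> G. a g \<in> hom_part d})
     E (\<lambda>c. \<lambda>x \<in> carrier R. mono c {#} \<otimes> x)
       (\<lambda>d. {f \<in> carrier E. \<forall>m. f ` hom_part m \<subseteq> hom_part (m + d)})"
  then have "N ` carrier S = carrier E" by (simp add: graded_algebra_iso_def ring_iso_def bij_betw_def)
  then show reflection_free by (rule surj_reflection_free)
next
  assume rf: reflection_free
  have inj: "inj_on N (carrier S)" by (rule inj_onI) (rule N_inj, auto)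
  have surj: "N ` carrier S = carrier E" using N_in_E reflection_free_surj[OF rf] by (auto simp: image_iff)
  have "N \<in> ring_iso S E" using N_ring_hom inj surj by (simp add: ring_iso_def bij_betw_def)
  moreover have "N (emb (mono c {#})) = (\<lambda>x \<in> carrier R. mono c {#} \<otimes> x)" for c
    by (rule extensionalityI[OF N_extensional]) (auto simp: N_emb)
  moreover have "N ` {a \<in> carrier S. \<forall>g \<in> G. a g \<in> hom_part d}
      = {f \<in> carrier E. \<forall>m. f ` hom_part m \<subseteq> hom_part (m + d)}" for d
  proof (intro equalityI subsetI)
    fix f assume "f \<in> N ` {a \<in> carrier S. \<forall>g \<in> G. a g \<in> hom_part d}"
    then obtain a where a: "a \<in> carrier S" "\<forall>g \<in> G. a g \<in> hom_part d" "f = N a" by blast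
    then show "f \<in> {f \<in> carrier E. \<forall>m. f ` hom_part m \<subseteq> hom_part (m + d)}"
      using N_degree[OF a(1)] N_in_E by simp
  next
    fix f assume f: "f \<in> {f \<in> carrier E. \<forall>m. f ` hom_part m \<subseteq> hom_part (m + d)}"
    then obtain a where a: "a \<in> carrier S" "f = N a" using surj by (metis (no_types, lifting) imageE mem_Collect_eq)
    then have "\<forall>g\<in>G. a g \<in> hom_part d" using f N_degree[OF a(1)] by simp
    then show "f \<in> N ` {a \<in> carrier S. \<forall>g \<in> G. a g \<in> hom_part d}" using a by blast
  qed
  ultimately show "N \<in> graded_algebra_iso
     S (\<lambda>c. emb (mono c {#})) (\<lambda>d. {a \<in> carrier S. \<forall>g \<in> G. a g \<in> hom_part d})
     E (\<lambda>c. \<lambda>x \<in> carrier R. mono c {#} \<otimes> x)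
       (\<lambda>d. {f \<in> carrier E. \<forall>m. f ` hom_part m \<subseteq> hom_part (m + d)})"
    by (simp add: graded_algebra_iso_def)
qed

end

section \<open>The monomial basis of a skew polynomial ring\<close>

abbreviation word_over :: "nat \<Rightarrow> fword \<Rightarrow> bool" where
  "word_over n w \<equiv> set (letters w) \<subseteq> {1..n}"

lemma word_simps [simp]: "letters 0 = []" "letters (u + v) = letters u @ letters v"
  by (simp_all add: zero_fword_def plus_fword_def)

lemma free_alg_carrier: "f \<in> carrier (free_alg n) \<longleftrightarrow> (\<forall>w \<in> Poly_Mapping.keys f. word_over n w)"
  and free_alg_simps [simp]: "f \<otimes>\<^bsub>free_alg n\<^esub> g = f * g" "\<one>\<^bsub>free_alg n\<^esub> = 1"
    "\<zero>\<^bsub>free_alg n\<^esub> = 0" "f \<oplus>\<^bsub>free_alg n\<^esub> g = f + g"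
  by (simp_all add: free_alg_def)

lemma ring_free_alg: "ring (free_alg n :: (fword \<Rightarrow>\<^sub>0 'k::field) ring)"
proof (rule ringI)
  show "abelian_group (free_alg n :: (fword \<Rightarrow>\<^sub>0 'k) ring)"
  proof (rule abelian_groupI)
    fix f g :: "fword \<Rightarrow>\<^sub>0 'k" assume "f \<in> carrier (free_alg n)" "g \<in> carrier (free_alg n)"
    then show "f \<oplus>\<^bsub>free_alg n\<^esub> g \<in> carrier (free_alg n)"
      using keys_add[of f g] by (auto simp: free_alg_carrier)
  next
    fix f :: "fword \<Rightarrow>\<^sub>0 'k" assume "f \<in> carrier (free_alg n)"
    then show "\<exists>g\<in>carrier (free_alg n). g \<oplus>\<^bsub>free_alg n\<^esub> f = \<zero>\<^bsub>free_alg n\<^esub>"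
      by (intro bexI[of _ "- f"]) (auto simp: free_alg_carrier in_keys_iff)
  qed (auto simp: free_alg_carrier algebra_simps)
  show "Group.monoid (free_alg n :: (fword \<Rightarrow>\<^sub>0 'k) ring)"
  proof (rule monoidI)
    fix f g :: "fword \<Rightarrow>\<^sub>0 'k" assume "f \<in> carrier (free_alg n)" "g \<in> carrier (free_alg n)"
    then show "f \<otimes>\<^bsub>free_alg n\<^esub> g \<in> carrier (free_alg n)"
      using keys_mult[of f g] by (fastforce simp: free_alg_carrier)
  qed (auto simp: free_alg_carrier algebra_simps)
qed (auto simp: free_alg_carrier algebra_simps)

lemma single_carrier [simp]: "word_over n w \<Longrightarrow> Poly_Mapping.single w c \<in> carrier (free_alg n)"
  by (auto simp: free_alg_carrier)

lemma free_alg_induct [consumes 1, case_names single add]: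
  assumes f: "f \<in> carrier (free_alg n)"
    and single: "\<And>w c. word_over n w \<Longrightarrow> P (Poly_Mapping.single w c)"
    and add: "\<And>f g. f \<in> carrier (free_alg n) \<Longrightarrow> g \<in> carrier (free_alg n) \<Longrightarrow> P f \<Longrightarrow> P g \<Longrightarrow> P (f + g)"
  shows "P f"
  using f
proof (induction "card (Poly_Mapping.keys f)" arbitrary: f rule: less_induct)
  case less
  show ?case
  proof (cases "f = 0")
    case True
    then show ?thesis using single[of 0 0] by simp
  next
    case False
    then obtain w where w: "w \<in> Poly_Mapping.keys f" by (metis all_not_in_conv keys_eq_empty)
    let ?s = "Poly_Mapping.single w (Poly_Mapping.lookup f w)"
    have eq: "Poly_Mapping.keys (f - ?s) = Poly_Mapping.keys f - {w}"
      by (auto simp: in_keys_iff lookup_minus lookup_single when_def split: if_splits)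
    have wn: "word_over n w" using less.prems w by (simp add: free_alg_carrier)
    have c: "f - ?s \<in> carrier (free_alg n)" using less.prems by (simp add: free_alg_carrier eq)
    have "card (Poly_Mapping.keys (f - ?s)) < card (Poly_Mapping.keys f)"
      unfolding eq using w by (intro card_Diff1_less) simp_all
    then have "P (f - ?s + ?s)"
      using less.hyps c single[OF wn] wn by (intro add) simp_all
    then show ?thesis by simp
  qed
qed

section \<open>Straightening of words\<close>

text \<open>The product of \<open>p i j\<close> over the inversions of the word, that is over the
  places where \<open>j\<close> stands before a smaller \<open>i\<close>: the scalar picked up when
  the word is sorted by the rule \<open>x_j x_i = p_ij x_i x_j\<close>.\<close>

primrec word_coef :: "(nat \<Rightarrow> nat \<Rightarrow> 'k::field) \<Rightarrow> nat list \<Rightarrow> 'k" where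
  "word_coef p [] = 1"
| "word_coef p (x # w) = (\<Prod>i\<in>#mset w. if i < x then p i x else 1) * word_coef p w"

text \<open>The scalar in \<open>x^\<alpha> x^\<beta> = bichar p \<alpha> \<beta> x^(\<alpha> +
  \<beta>)\<close>, a bicharacter on exponents.\<close>

definition bichar :: "(nat \<Rightarrow> nat \<Rightarrow> 'k::field) \<Rightarrow> nat multiset \<Rightarrow> nat multiset \<Rightarrow> 'k" where
  "bichar p \<alpha> \<beta> = (\<Prod>j\<in>#\<alpha>. \<Prod>i\<in>#\<beta>. if i < j then p i j else 1)"

text \<open>Inversions of \<open>u @ v\<close> lie inside \<open>u\<close>, inside \<open>v\<close>
  or between them, and the number of those between depends only on the multisets of letters.
  Straightening is therefore compatible with products.\<close>

lemma word_coef_append: "word_coef p (u @ v) = word_coef p u * word_coef p v * bichar p (mset u) (mset v)"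
  by (induction u) (simp_all add: bichar_def mult_ac)

lemma word_coef_sorted: "sorted w \<Longrightarrow> word_coef p w = 1"
proof (induction w)
  case (Cons x w)
  have "(\<Prod>i\<in>#mset w. if i < x then p i x else 1) = (\<Prod>i\<in>#mset w. 1)"
    using Cons.prems by (intro arg_cong[where f = prod_mset] image_mset_cong) auto
  then show ?case using Cons by simp
qed simp

text \<open>The coefficient of \<open>x\<^sup>\<alpha>\<close> after straightening a noncommutative polynomial.\<close>

definition free_coef :: "(nat \<Rightarrow> nat \<Rightarrow> 'k::field) \<Rightarrow> (fword \<Rightarrow>\<^sub>0 'k) \<Rightarrow> nat multiset \<Rightarrow> 'k" where
  "free_coef p f \<alpha> = (\<Sum>w\<in>Poly_Mapping.keys f.
    if mset (letters w) = \<alpha> then Poly_Mapping.lookup f w * word_coef p (letters w) else 0)"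

lemma free_coef_superset:
  "finite A \<Longrightarrow> Poly_Mapping.keys f \<subseteq> A \<Longrightarrow> free_coef p f \<alpha> = (\<Sum>w\<in>A.
    if mset (letters w) = \<alpha> then Poly_Mapping.lookup f w * word_coef p (letters w) else 0)"
  unfolding free_coef_def by (rule sum.mono_neutral_left) (auto simp: in_keys_iff)

lemma free_coef_add: "free_coef p (f + g) \<alpha> = free_coef p f \<alpha> + free_coef p g \<alpha>"
proof -
  let ?A = "Poly_Mapping.keys f \<union> Poly_Mapping.keys g"
  have "free_coef p (f + g) \<alpha> = (\<Sum>w\<in>?A.
    if mset (letters w) = \<alpha> then Poly_Mapping.lookup (f + g) w * word_coef p (letters w) else 0)"
    using keys_add[of f g] by (intro free_coef_superset) auto
  also have "\<dots> = free_coef p f \<alpha> + free_coef p g \<alpha>"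
    unfolding free_coef_superset[of ?A f, simplified] free_coef_superset[of ?A g, simplified] sum.distrib[symmetric]
    by (intro sum.cong) (auto simp: lookup_add algebra_simps)
  finally show ?thesis .
qed

lemma free_coef_zero [simp]: "free_coef p 0 \<alpha> = 0"
  by (simp add: free_coef_def)

lemma free_coef_uminus: "free_coef p (- f) \<alpha> = - free_coef p f \<alpha>"
  using free_coef_add[of p "- f" f \<alpha>] by (simp add: eq_neg_iff_add_eq_0)

lemma free_coef_diff: "free_coef p (f - g) \<alpha> = free_coef p f \<alpha> - free_coef p g \<alpha>"
  using free_coef_add[of p f "- g" \<alpha>] by (simp add: free_coef_uminus)

lemma free_coef_single: "free_coef p (Poly_Mapping.single w c) \<alpha> = (if mset (letters w) = \<alpha> then c * word_coef p (letters w) else 0)"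
  using free_coef_superset[of "{w}" "Poly_Mapping.single w c" p \<alpha>] by simp

lemma free_coef_single_mult:
  assumes "f \<in> carrier (free_alg n)"
  shows "free_coef p (Poly_Mapping.single u c * f) \<gamma> = (if mset (letters u) \<subseteq># \<gamma> then
    c * word_coef p (letters u) * bichar p (mset (letters u)) (\<gamma> - mset (letters u)) * free_coef p f (\<gamma> - mset (letters u)) else 0)"
  using assms
proof (induction f rule: free_alg_induct)
  case (single w d)
  have "mset (letters u) + mset (letters w) = \<gamma> \<longleftrightarrow> mset (letters u) \<subseteq># \<gamma> \<and> mset (letters w) = \<gamma> - mset (letters u)"
    by (metis add_diff_cancel_left' mset_subset_eq_add_left subset_mset.add_diff_inverse)
  then show ?case by (auto simp: mult_single free_coef_single word_coef_append)
next
  case (add f g)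
  then show ?case by (simp add: distrib_left free_coef_add algebra_simps)
qed

lemma free_coef_mult_single:
  assumes "f \<in> carrier (free_alg n)"
  shows "free_coef p (f * Poly_Mapping.single u c) \<gamma> = (if mset (letters u) \<subseteq># \<gamma> then
    c * word_coef p (letters u) * bichar p (\<gamma> - mset (letters u)) (mset (letters u)) * free_coef p f (\<gamma> - mset (letters u)) else 0)"
  using assms
proof (induction f rule: free_alg_induct)
  case (single w d)
  have "mset (letters w) + mset (letters u) = \<gamma> \<longleftrightarrow> mset (letters u) \<subseteq># \<gamma> \<and> mset (letters w) = \<gamma> - mset (letters u)"
    by (metis add_diff_cancel_right' mset_subset_eq_add_right subset_mset.diff_add)
  then show ?case by (auto simp: mult_single free_coef_single word_coef_append)
next
  case (add f g)
  then show ?case by (simp add: distrib_right free_coef_add algebra_simps)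
qed

text \<open>The polynomials that straighten to zero. As this set is an ideal and contains the
  relations, it contains \<open>sp_ideal n p\<close>; sorted monomials thus stay independent in the
  quotient, and no confluence argument has to be made.\<close>

definition free_kernel :: "nat \<Rightarrow> (nat \<Rightarrow> nat \<Rightarrow> 'k::field) \<Rightarrow> (fword \<Rightarrow>\<^sub>0 'k) set" where
  "free_kernel n p = {f \<in> carrier (free_alg n). \<forall>\<alpha>. free_coef p f \<alpha> = 0}"

lemma ideal_free_kernel:
  fixes p :: "nat \<Rightarrow> nat \<Rightarrow> 'k::field"
  shows "ideal (free_kernel n p) (free_alg n)"
proof (rule idealI[OF ring_free_alg])
  interpret F: ring "free_alg n :: (fword \<Rightarrow>\<^sub>0 'k) ring" by (rule ring_free_alg)
  show "subgroup (free_kernel n p) (add_monoid (free_alg n))"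
  proof (rule F.add.subgroupI)
    show "\<ominus>\<^bsub>free_alg n\<^esub> f \<in> free_kernel n p" if "f \<in> free_kernel n p" for f
    proof -
      have "- f \<in> carrier (free_alg n)" using that by (auto simp: free_kernel_def free_alg_carrier in_keys_iff)
      then have "\<ominus>\<^bsub>free_alg n\<^esub> f = - f" using that by (intro F.minus_equality) (auto simp: free_kernel_def)
      then show ?thesis using that \<open>- f \<in> _\<close> by (simp add: free_kernel_def free_coef_uminus)
    qed
    show "f \<oplus>\<^bsub>free_alg n\<^esub> g \<in> free_kernel n p" if "f \<in> free_kernel n p" "g \<in> free_kernel n p" for f g
      using that F.a_closed[of f g] by (auto simp: free_kernel_def free_coef_add)
    show "free_kernel n p \<noteq> {}" using F.zero_closed by (auto simp: free_kernel_def intro!: exI[of _ 0])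
  qed (auto simp: free_kernel_def)
  fix f g :: "fword \<Rightarrow>\<^sub>0 'k" assume f: "f \<in> free_kernel n p" and g: "g \<in> carrier (free_alg n)"
  have fc: "f \<in> carrier (free_alg n)" "free_coef p f \<alpha> = 0" for \<alpha> using f by (auto simp: free_kernel_def)
  have "free_coef p (g * f) \<alpha> = 0" for \<alpha>
    using g by (induction g rule: free_alg_induct) (simp_all add: free_coef_single_mult[OF fc(1)] fc(2) distrib_right free_coef_add)
  then show "g \<otimes>\<^bsub>free_alg n\<^esub> f \<in> free_kernel n p" using F.m_closed[OF g fc(1)] by (simp add: free_kernel_def)
  have "free_coef p (f * g) \<alpha> = 0" for \<alpha>
    using g by (induction g rule: free_alg_induct) (simp_all add: free_coef_mult_single[OF fc(1)] fc(2) distrib_left free_coef_add)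
  then show "f \<otimes>\<^bsub>free_alg n\<^esub> g \<in> free_kernel n p" using F.m_closed[OF fc(1) g] by (simp add: free_kernel_def)
qed

lemma relation_eq:
  "free_var j * free_var i - free_const (p i j) * free_var i * free_var j
    = Poly_Mapping.single (Word [j, i]) 1 - Poly_Mapping.single (Word [i, j]) (p i j)"
  by (simp add: free_var_def free_const_def mult_single plus_fword_def)

definition relations :: "nat \<Rightarrow> (nat \<Rightarrow> nat \<Rightarrow> 'k::field) \<Rightarrow> (fword \<Rightarrow>\<^sub>0 'k) set" where
  "relations n p = {free_var j * free_var i - free_const (p i j) * free_var i * free_var j | i j.
        1 \<le> i \<and> i < j \<and> j \<le> n}"

lemma relations_kernel: "relations n p \<subseteq> free_kernel n p"
proof
  fix f assume "f \<in> relations n p"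
  then obtain i j where ij: "1 \<le> i" "i < j" "j \<le> n"
    "f = Poly_Mapping.single (Word [j, i]) 1 - Poly_Mapping.single (Word [i, j]) (p i j)"
    by (auto simp: relations_def relation_eq)
  have "Poly_Mapping.keys f \<subseteq> {Word [j, i], Word [i, j]}"
    unfolding ij(4) by (rule order_trans[OF keys_diff]) auto
  then have "w = Word [j, i] \<or> w = Word [i, j]" if "w \<in> Poly_Mapping.keys f" for w using that by blast
  then have "f \<in> carrier (free_alg n)" using ij(1-3) unfolding free_alg_carrier by fastforce
  moreover have "free_coef p f \<alpha> = 0" for \<alpha>
    using ij(2) by (auto simp: ij(4) free_coef_diff free_coef_single add_mset_commute)
  ultimately show "f \<in> free_kernel n p" by (simp add: free_kernel_def)
qed

lemma sp_ideal_relations: "sp_ideal n p = Idl\<^bsub>free_alg n\<^esub> (relations n p)"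
  by (simp add: sp_ideal_def relations_def)

lemma relations_carrier: "relations n p \<subseteq> carrier (free_alg n)"
  using relations_kernel by (force simp: free_kernel_def)

lemma ideal_sp_ideal: "ideal (sp_ideal n p) (free_alg n)"
  unfolding sp_ideal_relations by (rule ring.genideal_ideal[OF ring_free_alg relations_carrier])

lemma sp_ideal_subset_kernel: "sp_ideal n p \<subseteq> free_kernel n p"
  unfolding sp_ideal_relations
  by (rule ring.genideal_minimal[OF ring_free_alg ideal_free_kernel relations_kernel])

lemma sp_ideal_closed:
  "f \<in> sp_ideal n p \<Longrightarrow> g \<in> sp_ideal n p \<Longrightarrow> f + g \<in> sp_ideal n p"
  "f \<in> sp_ideal n p \<Longrightarrow> g \<in> carrier (free_alg n) \<Longrightarrow> g * f \<in> sp_ideal n p"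
  "f \<in> sp_ideal n p \<Longrightarrow> g \<in> carrier (free_alg n) \<Longrightarrow> f * g \<in> sp_ideal n p"
  "0 \<in> sp_ideal n p"
  using additive_subgroup.a_closed[OF ideal.axioms(1)[OF ideal_sp_ideal], of f n p g]
    additive_subgroup.zero_closed[OF ideal.axioms(1)[OF ideal_sp_ideal], of n p]
    ideal.I_l_closed[OF ideal_sp_ideal, of f n p g] ideal.I_r_closed[OF ideal_sp_ideal, of f n p g]
  by simp_all

text \<open>The letter \<open>x\<close> crosses the smaller letters before its place one by one,
  each time by one relation. The scalar may stay existential, since \<open>free_coef\<close>
  determines it afterwards.\<close>

lemma single_insort:
  assumes "x \<in> {1..n}" "set w \<subseteq> {1..n}"
  shows "\<exists>d. Poly_Mapping.single (Word (x # w)) c - Poly_Mapping.single (Word (insort x w)) d \<in> sp_ideal n p"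
  using assms(2)
proof (induction w arbitrary: c)
  case Nil
  then show ?case using sp_ideal_closed(4) by (auto intro!: exI[of _ c])
next
  case (Cons y w)
  show ?case
  proof (cases "x \<le> y")
    case True
    then show ?thesis using sp_ideal_closed(4) by (auto intro!: exI[of _ c])
  next
    case False
    let ?r = "Poly_Mapping.single (Word [x, y]) 1 - Poly_Mapping.single (Word [y, x]) (p y x)"
    have "?r \<in> relations n p"
      unfolding relations_def relation_eq using False assms(1) Cons.prems
      by (intro CollectI exI[of _ y] exI[of _ x]) auto
    then have "?r \<in> sp_ideal n p"
      unfolding sp_ideal_relations using ring.genideal_self[OF ring_free_alg relations_carrier] by blast
    then have 1: "?r * Poly_Mapping.single (Word w) c \<in> sp_ideal n p"
      using Cons.prems by (intro sp_ideal_closed(3)) auto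
    obtain d where "Poly_Mapping.single (Word (x # w)) (p y x * c) - Poly_Mapping.single (Word (insort x w)) d \<in> sp_ideal n p"
      using Cons by auto
    then have 2: "Poly_Mapping.single (Word [y]) 1 * (Poly_Mapping.single (Word (x # w)) (p y x * c)
        - Poly_Mapping.single (Word (insort x w)) d) \<in> sp_ideal n p"
      using Cons.prems by (intro sp_ideal_closed(2)) auto
    have eq: "Poly_Mapping.single (Word (x # y # w)) c - Poly_Mapping.single (Word (insort x (y # w))) d
      = ?r * Poly_Mapping.single (Word w) c + Poly_Mapping.single (Word [y]) 1 * (Poly_Mapping.single (Word (x # w)) (p y x * c)
        - Poly_Mapping.single (Word (insort x w)) d)"
      using False by (simp add: algebra_simps mult_single plus_fword_def)
    show ?thesis by (rule exI[of _ d]) (simp only: eq sp_ideal_closed(1)[OF 1 2])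
  qed
qed

lemma single_sort:
  assumes "set w \<subseteq> {1..n}"
  shows "\<exists>d. Poly_Mapping.single (Word w) c - Poly_Mapping.single (Word (sort w)) d \<in> sp_ideal n p"
  using assms
proof (induction w arbitrary: c)
  case Nil
  then show ?case using sp_ideal_closed(4) by (auto intro!: exI[of _ c])
next
  case (Cons x w)
  then obtain d where "Poly_Mapping.single (Word w) c - Poly_Mapping.single (Word (sort w)) d \<in> sp_ideal n p" by auto
  then have 1: "Poly_Mapping.single (Word [x]) 1 * (Poly_Mapping.single (Word w) c - Poly_Mapping.single (Word (sort w)) d) \<in> sp_ideal n p"
    using Cons.prems by (intro sp_ideal_closed(2)) auto
  obtain e where 2: "Poly_Mapping.single (Word (x # sort w)) d - Poly_Mapping.single (Word (insort x (sort w))) e \<in> sp_ideal n p"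
    using single_insort[of x n "sort w" d p] Cons.prems by auto
  have eq: "Poly_Mapping.single (Word (x # w)) c - Poly_Mapping.single (Word (sort (x # w))) e
    = Poly_Mapping.single (Word [x]) 1 * (Poly_Mapping.single (Word w) c - Poly_Mapping.single (Word (sort w)) d)
      + (Poly_Mapping.single (Word (x # sort w)) d - Poly_Mapping.single (Word (insort x (sort w))) e)"
    by (simp add: algebra_simps mult_single plus_fword_def)
  show ?case by (rule exI[of _ e]) (simp only: eq sp_ideal_closed(1)[OF 1 2])
qed

lemma sorted_representative:
  assumes "f \<in> carrier (free_alg n)"
  shows "\<exists>g \<in> carrier (free_alg n). f - g \<in> sp_ideal n p \<and> (\<forall>w \<in> Poly_Mapping.keys g. sorted (letters w))"
  using assms
proof (induction f rule: free_alg_induct)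
  case (single w c)
  obtain d where "Poly_Mapping.single (Word (letters w)) c - Poly_Mapping.single (Word (sort (letters w))) d \<in> sp_ideal n p"
    using single_sort[OF single] by blast
  then show ?case using single by (intro bexI[of _ "Poly_Mapping.single (Word (sort (letters w))) d"]) auto
next
  case (add f g)
  then obtain f' g' where fg: "f' \<in> carrier (free_alg n)" "f - f' \<in> sp_ideal n p" "\<forall>w \<in> Poly_Mapping.keys f'. sorted (letters w)"
    "g' \<in> carrier (free_alg n)" "g - g' \<in> sp_ideal n p" "\<forall>w \<in> Poly_Mapping.keys g'. sorted (letters w)" by blast
  have "(f + g) - (f' + g') \<in> sp_ideal n p" using sp_ideal_closed(1)[OF fg(2,5)] by (simp add: algebra_simps)
  moreover have "f' + g' \<in> carrier (free_alg n)"
    using ring.ring_simprules(1)[OF ring_free_alg fg(1,4)] by simp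
  moreover have "\<forall>w \<in> Poly_Mapping.keys (f' + g'). sorted (letters w)"
    using fg(3,6) keys_add[of f' g'] by blast
  ultimately show ?case by blast
qed

text \<open>A sorted word is determined by its multiset of letters and has no inversions, so
  straightening leaves its coefficient untouched.\<close>

lemma free_coef_sorted:
  assumes "\<forall>w \<in> Poly_Mapping.keys g. sorted (letters w)" "sorted (letters w)"
  shows "free_coef p g (mset (letters w)) = Poly_Mapping.lookup g w"
proof -
  have "(mset (letters v) = mset (letters w)) \<longleftrightarrow> v = w" if "v \<in> Poly_Mapping.keys g" for v
    using that assms properties_for_sort[of "letters v" "letters w"] by (metis fword.expand sorted_sort_id)
  then have "free_coef p g (mset (letters w)) = (\<Sum>v\<in>Poly_Mapping.keys g. if v = w then Poly_Mapping.lookup g v * word_coef p (letters v) else 0)"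
    unfolding free_coef_def by (intro sum.cong) auto
  also have "\<dots> = Poly_Mapping.lookup g w" using assms(2) by (simp add: word_coef_sorted in_keys_iff)
  finally show ?thesis .
qed

text \<open>An element of the kernel is congruent to a combination of sorted words, from which
  \<open>free_coef\<close> reads off the coefficients; they all vanish. Spanning and independence of
  the sorted monomials meet here.\<close>

lemma sp_ideal_eq_kernel: "sp_ideal n p = free_kernel n p"
proof
  show "free_kernel n p \<subseteq> sp_ideal n p"
  proof
    fix f assume f: "f \<in> free_kernel n p"
    then obtain g where g: "g \<in> carrier (free_alg n)" "f - g \<in> sp_ideal n p" "\<forall>w \<in> Poly_Mapping.keys g. sorted (letters w)"
      using sorted_representative[of f n p] by (auto simp: free_kernel_def)
    have "free_coef p g \<alpha> = 0" for \<alpha>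
      using g(2) f sp_ideal_subset_kernel[of n p] by (auto simp: free_kernel_def free_coef_diff subset_iff)
    then have "Poly_Mapping.lookup g w = 0" for w
      using free_coef_sorted[OF g(3), of w p] g(3) by (metis in_keys_iff)
    then have "g = 0" by (intro poly_mapping_eqI) simp
    then show "f \<in> sp_ideal n p" using g(2) by simp
  qed
qed (rule sp_ideal_subset_kernel)

lemma free_alg_closed:
  assumes "f \<in> carrier (free_alg n)" "g \<in> carrier (free_alg n)"
  shows "f + g \<in> carrier (free_alg n)" "f * g \<in> carrier (free_alg n)"
  using ring.ring_simprules(1,5)[OF ring_free_alg assms] by simp_all

lemma sp_class_eq_iff:
  assumes f: "f \<in> carrier (free_alg n)" and g: "g \<in> carrier (free_alg n)"
  shows "sp_class n p f = sp_class n p g \<longleftrightarrow> (\<forall>\<alpha>. free_coef p f \<alpha> = free_coef p g \<alpha>)"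
proof -
  interpret F: ring "free_alg n :: (fword \<Rightarrow>\<^sub>0 'a) ring" by (rule ring_free_alg)
  have "- g \<in> carrier (free_alg n)" using g by (simp add: free_alg_carrier in_keys_iff)
  then have m: "f \<ominus>\<^bsub>free_alg n\<^esub> g = f - g"
    using g F.minus_equality[of "- g" g] by (simp add: F.minus_eq)
  have "f - g \<in> carrier (free_alg n)" using F.minus_closed[OF f g] by (simp add: m)
  then have "f - g \<in> sp_ideal n p \<longleftrightarrow> (\<forall>\<alpha>. free_coef p f \<alpha> = free_coef p g \<alpha>)"
    unfolding sp_ideal_eq_kernel by (simp add: free_kernel_def free_coef_diff)
  then show ?thesis
    unfolding sp_class_def using F.quotient_eq_iff_same_a_r_cos[OF ideal_sp_ideal f g, of p] by (simp add: m)
qed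

lemma ring_sp_ring: "ring (sp_ring n p)"
  unfolding sp_ring_def by (rule ideal.quotient_is_ring[OF ideal_sp_ideal])

lemma sp_class_hom: "sp_class n p \<in> ring_hom (free_alg n) (sp_ring n p)"
proof -
  have "sp_class n p = (+>\<^bsub>free_alg n\<^esub>) (sp_ideal n p)" by (intro ext) (simp add: sp_class_def)
  then show ?thesis unfolding sp_ring_def using ideal.rcos_ring_hom[OF ideal_sp_ideal, of n p] by simp
qed

lemma sp_ring_carrier: "carrier (sp_ring n p) = sp_class n p ` carrier (free_alg n)"
  by (auto simp: sp_ring_def FactRing_def A_RCOSETS_def' sp_class_def)

lemma sp_class_simps:
  assumes "f \<in> carrier (free_alg n)" "g \<in> carrier (free_alg n)"
  shows "sp_class n p f \<oplus>\<^bsub>sp_ring n p\<^esub> sp_class n p g = sp_class n p (f + g)"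
    "sp_class n p f \<otimes>\<^bsub>sp_ring n p\<^esub> sp_class n p g = sp_class n p (f * g)"
  using ring_hom_add[OF sp_class_hom assms, of p] ring_hom_mult[OF sp_class_hom assms, of p] by simp_all

text \<open>The choice of a representative is harmless, as \<open>free_coef\<close> is constant on
  cosets of the ideal.\<close>

definition sp_coef :: "nat \<Rightarrow> (nat \<Rightarrow> nat \<Rightarrow> 'k::field) \<Rightarrow> (fword \<Rightarrow>\<^sub>0 'k) set \<Rightarrow> nat multiset \<Rightarrow> 'k" where
  "sp_coef n p r = free_coef p (SOME f. f \<in> carrier (free_alg n) \<and> sp_class n p f = r)"

definition sp_mono :: "nat \<Rightarrow> (nat \<Rightarrow> nat \<Rightarrow> 'k::field) \<Rightarrow> 'k \<Rightarrow> nat multiset \<Rightarrow> (fword \<Rightarrow>\<^sub>0 'k) set" where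
  "sp_mono n p c \<alpha> = sp_class n p (Poly_Mapping.single (Word (sorted_list_of_multiset \<alpha>)) c)"

lemma sp_coef_class:
  assumes "f \<in> carrier (free_alg n)"
  shows "sp_coef n p (sp_class n p f) \<alpha> = free_coef p f \<alpha>"
proof -
  let ?g = "SOME g. g \<in> carrier (free_alg n) \<and> sp_class n p g = sp_class n p f"
  have "?g \<in> carrier (free_alg n) \<and> sp_class n p ?g = sp_class n p f"
    by (rule someI[of _ f]) (use assms in simp)
  then show ?thesis unfolding sp_coef_def using sp_class_eq_iff[OF _ assms, of ?g p] by blast
qed

lemma word_coef_sorted_list [simp]: "word_coef p (sorted_list_of_multiset \<alpha>) = 1"
  by (rule word_coef_sorted) simp

lemma monomial_ring_sp_ring:
  assumes nz: "\<And>i j. 1 \<le> i \<Longrightarrow> i < j \<Longrightarrow> j \<le> n \<Longrightarrow> p i j \<noteq> 0"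
  shows "monomial_ring (sp_ring n p) {1..n} (sp_coef n p) (sp_mono n p) (bichar p)"
proof (intro monomial_ring.intro monomial_ring_axioms.intro ring_sp_ring)
  have w: "Poly_Mapping.single (Word (sorted_list_of_multiset \<alpha>)) c \<in> carrier (free_alg n)"
    if "set_mset \<alpha> \<subseteq> {1..n}" for \<alpha> :: "nat multiset" and c :: 'a
    using that by (intro single_carrier) simp
  fix \<alpha> \<beta> :: "nat multiset" and c d :: 'a
  assume \<alpha>: "set_mset \<alpha> \<subseteq> {1..n}"
  show "sp_mono n p c \<alpha> \<in> carrier (sp_ring n p)"
    using w[OF \<alpha>] by (auto simp: sp_mono_def sp_ring_carrier)
  show "sp_coef n p (sp_mono n p c \<alpha>) \<beta> = (if \<beta> = \<alpha> then c else 0)"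
    using w[OF \<alpha>] by (auto simp: sp_mono_def sp_coef_class free_coef_single)
  assume \<beta>: "set_mset \<beta> \<subseteq> {1..n}"
  have \<alpha>\<beta>: "set_mset (\<alpha> + \<beta>) \<subseteq> {1..n}" using \<alpha> \<beta> by simp
  have "sp_class n p (Poly_Mapping.single (Word (sorted_list_of_multiset \<alpha>)) c * Poly_Mapping.single (Word (sorted_list_of_multiset \<beta>)) d)
    = sp_class n p (Poly_Mapping.single (Word (sorted_list_of_multiset (\<alpha> + \<beta>))) (c * d * bichar p \<alpha> \<beta>))"
    unfolding sp_class_eq_iff[OF free_alg_closed(2)[OF w[OF \<alpha>] w[OF \<beta>]] w[OF \<alpha>\<beta>]]
    by (simp add: mult_single free_coef_single word_coef_append)
  then show "sp_mono n p c \<alpha> \<otimes>\<^bsub>sp_ring n p\<^esub> sp_mono n p d \<beta> = sp_mono n p (c * d * bichar p \<alpha> \<beta>) (\<alpha> + \<beta>)"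
    using w[OF \<alpha>, of c] w[OF \<beta>, of d] by (simp add: sp_mono_def sp_class_simps)
  show "bichar p \<alpha> \<beta> \<noteq> 0"
  proof -
    have "p i j \<noteq> 0" if "j \<in># \<alpha>" "i \<in># \<beta>" "i < j" for i j
      using that \<alpha> \<beta> nz[of i j] by (meson atLeastAtMost_iff subsetD)
    then show ?thesis by (auto simp: bichar_def prod_mset_zero_iff split: if_splits)
  qed
next
  fix r s assume "r \<in> carrier (sp_ring n p)" "s \<in> carrier (sp_ring n p)"
  then obtain f g where fg: "f \<in> carrier (free_alg n)" "g \<in> carrier (free_alg n)" "r = sp_class n p f" "s = sp_class n p g"
    by (auto simp: sp_ring_carrier)
  show "sp_coef n p (r \<oplus>\<^bsub>sp_ring n p\<^esub> s) \<alpha> = sp_coef n p r \<alpha> + sp_coef n p s \<alpha>" for \<alpha>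
    using fg by (simp add: sp_class_simps sp_coef_class free_alg_closed free_coef_add)
  show "r = s" if "\<And>\<alpha>. sp_coef n p r \<alpha> = sp_coef n p s \<alpha>"
    using that fg by (simp add: sp_class_eq_iff sp_coef_class)
next
  fix r assume "r \<in> carrier (sp_ring n p)"
  then obtain f where f: "f \<in> carrier (free_alg n)" "r = sp_class n p f" by (auto simp: sp_ring_carrier)
  have *: "\<exists>w \<in> Poly_Mapping.keys f. mset (letters w) = \<alpha>" if "sp_coef n p r \<alpha> \<noteq> 0" for \<alpha>
  proof -
    have "free_coef p f \<alpha> \<noteq> 0" using that f by (simp add: sp_coef_class)
    then show ?thesis unfolding free_coef_def by (rule sum.not_neutral_contains_not_neutral) (auto split: if_splits)
  qed
  have "{\<alpha>. sp_coef n p r \<alpha> \<noteq> 0} \<subseteq> (\<lambda>w. mset (letters w)) ` Poly_Mapping.keys f" using * by blast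
  then show "finite {\<alpha>. sp_coef n p r \<alpha> \<noteq> 0}" by (rule finite_subset) simp
  show "set_mset \<alpha> \<subseteq> {1..n}" if "sp_coef n p r \<alpha> \<noteq> 0" for \<alpha>
    using *[OF that] f(1) unfolding free_alg_carrier by (metis set_mset_mset)
next
  show "sp_mono n p 1 {#} = \<one>\<^bsub>sp_ring n p\<^esub>"
    using ring_hom_one[OF sp_class_hom, of n p]
    by (simp add: sp_mono_def flip: zero_fword_def)
qed

lemma sp_const_mono: "sp_const n p c = sp_mono n p c {#}"
  by (simp add: sp_const_def sp_mono_def free_const_def)

lemma sp_var_mono: "sp_var n p i = sp_mono n p 1 {#i#}"
  by (simp add: sp_var_def sp_mono_def free_var_def)

lemma sp_degree_eq:
  "sp_degree n p d = {r \<in> carrier (sp_ring n p). \<forall>\<alpha>. sp_coef n p r \<alpha> \<noteq> 0 \<longrightarrow> int (size \<alpha>) = d}"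
proof (intro equalityI subsetI)
  fix r assume "r \<in> sp_degree n p d"
  then obtain f where f: "f \<in> carrier (free_alg n)" "r = sp_class n p f"
    "\<And>w. w \<in> Poly_Mapping.keys f \<Longrightarrow> int (length (letters w)) = d" by (auto simp: sp_degree_def)
  have "int (size \<alpha>) = d" if "sp_coef n p r \<alpha> \<noteq> 0" for \<alpha>
  proof -
    have "free_coef p f \<alpha> \<noteq> 0" using that f by (simp add: sp_coef_class)
    then obtain w where "w \<in> Poly_Mapping.keys f" "mset (letters w) = \<alpha>"
      unfolding free_coef_def by (rule sum.not_neutral_contains_not_neutral) (auto split: if_splits)
    then show ?thesis using f(3) size_mset by metis
  qed
  then show "r \<in> {r \<in> carrier (sp_ring n p). \<forall>\<alpha>. sp_coef n p r \<alpha> \<noteq> 0 \<longrightarrow> int (size \<alpha>) = d}"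
    using f by (auto simp: sp_ring_carrier)
next
  fix r assume "r \<in> {r \<in> carrier (sp_ring n p). \<forall>\<alpha>. sp_coef n p r \<alpha> \<noteq> 0 \<longrightarrow> int (size \<alpha>) = d}"
  then obtain f where f: "f \<in> carrier (free_alg n)" "r = sp_class n p f"
    and d: "\<And>\<alpha>. sp_coef n p r \<alpha> \<noteq> 0 \<Longrightarrow> int (size \<alpha>) = d" by (auto simp: sp_ring_carrier)
  \<comment> \<open>The representative \<open>f\<close> may be inhomogeneous by an element of the
    ideal; the sorted one contains exactly the words that \<open>sp_coef\<close> sees.\<close>
  obtain g where g: "g \<in> carrier (free_alg n)" "f - g \<in> sp_ideal n p" "\<forall>w \<in> Poly_Mapping.keys g. sorted (letters w)"
    using sorted_representative[OF f(1), of p] by blast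
  have "free_coef p f \<alpha> = free_coef p g \<alpha>" for \<alpha>
    using g(2) by (simp add: sp_ideal_eq_kernel free_kernel_def free_coef_diff)
  then have r: "r = sp_class n p g" using f g sp_class_eq_iff by metis
  have "int (length (letters w)) = d" if w: "w \<in> Poly_Mapping.keys g" for w
  proof -
    have "sp_coef n p r (mset (letters w)) \<noteq> 0"
      using w g free_coef_sorted[OF g(3), of w p] by (simp add: r sp_coef_class in_keys_iff)
    from d[OF this] show ?thesis by simp
  qed
  then show "r \<in> sp_degree n p d" unfolding r sp_degree_def using g(1) by blast
qed

section \<open>Linear algebra of the variables\<close>

context monomial_ring
begin

definition scalars where "scalars = range (\<lambda>c. mono c {#})"

lemma subfield_scalars: "subfield scalars R"
proof (rule subfieldI)
  have sub: "subring scalars R"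
  proof (rule subringI)
    show "scalars \<subseteq> carrier R" by (auto simp: scalars_def)
    show "\<one> \<in> scalars" by (auto simp: scalars_def simp flip: mono_one)
    show "\<ominus> h \<in> scalars" if h: "h \<in> scalars" for h
    proof -
      obtain c where "h = mono c {#}" using h by (auto simp: scalars_def)
      then have "\<ominus> h = mono (- c) {#}" by (intro coef_eqI) (auto simp: coef_uminus coef_mono)
      then show ?thesis by (simp add: scalars_def)
    qed
    show "h1 \<otimes> h2 \<in> scalars" if "h1 \<in> scalars" "h2 \<in> scalars" for h1 h2
      using that by (auto simp: scalars_def mono_scale)
    show "h1 \<oplus> h2 \<in> scalars" if h: "h1 \<in> scalars" "h2 \<in> scalars" for h1 h2
    proof -
      obtain c d where "h1 = mono c {#}" "h2 = mono d {#}" using h by (auto simp: scalars_def)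
      then have "h1 \<oplus> h2 = mono (c + d) {#}" by (intro coef_eqI) (auto simp: coef_add coef_mono)
      then show ?thesis by (simp add: scalars_def)
    qed
  qed
  have comm: "h1 \<otimes> h2 = h2 \<otimes> h1" if "h1 \<in> scalars" "h2 \<in> scalars" for h1 h2
    using that by (auto simp: scalars_def mono_scale mult.commute)
  show "subcring scalars R" by (rule subcringI[OF sub comm])
  show "Units (R\<lparr>carrier := scalars\<rparr>) = scalars - {\<zero>}"
  proof (intro equalityI subsetI)
    fix x assume "x \<in> Units (R\<lparr>carrier := scalars\<rparr>)"
    then obtain y where "x \<in> scalars" "y \<in> scalars" "y \<otimes> x = \<one>" by (auto simp: Units_def)
    then show "x \<in> scalars - {\<zero>}"
      using one_neq_zero subringE(1)[OF sub] by auto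
  next
    fix x assume x: "x \<in> scalars - {\<zero>}"
    then obtain c where c: "x = mono c {#}" by (auto simp: scalars_def)
    then have "c \<noteq> 0" using x by (auto simp: mono_zero)
    then have "mono (inverse c) {#} \<otimes> x = \<one>" "x \<otimes> mono (inverse c) {#} = \<one>"
      by (simp_all add: c mono_scale mono_one)
    then show "x \<in> Units (R\<lparr>carrier := scalars\<rparr>)"
      using x by (auto simp: Units_def scalars_def)
  qed
qed

text \<open>The span of the variables \<open>x_i\<close> with \<open>i \<in> I\<close>, described by
  coefficients so that inclusions and fixed vectors can be checked coordinate by coordinate.\<close>

definition linear_part :: "nat set \<Rightarrow> 'a set" where
  "linear_part I = {r \<in> carrier R. \<forall>\<alpha>. coef r \<alpha> \<noteq> 0 \<longrightarrow> (\<exists>i\<in>I. \<alpha> = {#i#})}"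

lemma Span_vars:
  "set is \<subseteq> V \<Longrightarrow> Span scalars (map (\<lambda>i. mono 1 {#i#}) is) = linear_part (set is)"
proof (induction "is")
  case Nil
  have "r = \<zero>" if "r \<in> linear_part {}" for r
    using that by (intro coef_eqI) (auto simp: linear_part_def)
  then show ?case by (auto simp: linear_part_def)
next
  case (Cons i "is")
  have iV: "set_mset {#i#} \<subseteq> V" using Cons.prems by simp
  have IH: "Span scalars (map (\<lambda>i. mono 1 {#i#}) is) = linear_part (set is)" using Cons by simp
  have "Span scalars (map (\<lambda>i. mono 1 {#i#}) (i # is)) = line_extension scalars (mono 1 {#i#}) (linear_part (set is))"
    using IH by simp
  also have "\<dots> = linear_part (set (i # is))"
  proof (intro equalityI subsetI)
    fix r assume "r \<in> line_extension scalars (mono 1 {#i#}) (linear_part (set is))"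
    then obtain c v where "v \<in> linear_part (set is)" "r = mono c {#} \<otimes> mono 1 {#i#} \<oplus> v"
      by (auto simp: line_extension_mem_iff scalars_def)
    then show "r \<in> linear_part (set (i # is))"
      using iV by (auto simp: linear_part_def mono_scale coef_add coef_mono split: if_splits)
  next
    fix r assume r: "r \<in> linear_part (set (i # is))"
    let ?m = "mono (coef r {#i#}) {#i#}"
    have rc: "r \<in> carrier R" using r by (simp add: linear_part_def)
    have "r \<ominus> ?m \<in> linear_part (set is)"
      using r iV rc by (auto simp: linear_part_def coef_minus coef_mono split: if_splits)
    moreover have "r = mono (coef r {#i#}) {#} \<otimes> mono 1 {#i#} \<oplus> (r \<ominus> ?m)"
      using rc iV by (intro coef_eqI) (auto simp: mono_scale coef_add coef_minus)
    ultimately show "r \<in> line_extension scalars (mono 1 {#i#}) (linear_part (set is))"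
      unfolding line_extension_mem_iff scalars_def by blast
  qed
  finally show ?case .
qed

lemma independent_vars:
  "distinct is \<Longrightarrow> set is \<subseteq> V \<Longrightarrow> independent scalars (map (\<lambda>i. mono 1 {#i#}) is)"
proof (induction "is")
  case (Cons i "is")
  have "coef (mono 1 {#i#}) {#i#} \<noteq> 0" using Cons.prems by (simp add: coef_mono)
  then have "mono 1 {#i#} \<notin> linear_part (set is)"
    using Cons.prems by (force simp: linear_part_def)
  then have "mono 1 {#i#} \<notin> Span scalars (map (\<lambda>i. mono 1 {#i#}) is)"
    using Span_vars[of "is"] Cons.prems by simp
  then show ?case using Cons by (auto intro!: li_Cons simp del: Span.simps)
qed simp

lemma dimension_vars:
  assumes "finite I" "I \<subseteq> V" shows "dimension (card I) scalars (linear_part I)"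
proof -
  have "set (sorted_list_of_set I) = I" "distinct (sorted_list_of_set I)" "length (sorted_list_of_set I) = card I"
    using assms(1) by auto
  then show ?thesis
    using dimension_independent[OF independent_vars[of "sorted_list_of_set I"]] Span_vars[of "sorted_list_of_set I"] assms(2)
    by simp
qed

end

section \<open>Small subgroups\<close>

lemma subgroup_GL:
  assumes R: "ring R" and VR: "V \<subseteq> carrier R"
    and add: "\<And>u v. u \<in> V \<Longrightarrow> v \<in> V \<Longrightarrow> u \<oplus>\<^bsub>R\<^esub> v \<in> V"
    and smult: "\<And>k v. k \<in> K \<Longrightarrow> v \<in> V \<Longrightarrow> k \<otimes>\<^bsub>R\<^esub> v \<in> V"
  shows "subgroup (carrier (GL R K V)) (BijGroup V)"
proof -
  interpret B: group "BijGroup V" by (rule group_BijGroup)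
  have car: "f \<in> carrier (GL R K V) \<longleftrightarrow> f \<in> Bij V \<and>
     (\<forall>u \<in> V. \<forall>v \<in> V. f (u \<oplus>\<^bsub>R\<^esub> v) = f u \<oplus>\<^bsub>R\<^esub> f v) \<and>
     (\<forall>k \<in> K. \<forall>v \<in> V. f (k \<otimes>\<^bsub>R\<^esub> v) = k \<otimes>\<^bsub>R\<^esub> f v)" for f
    by (auto simp: GL_def)
  have m: "f \<otimes>\<^bsub>BijGroup V\<^esub> g = compose V f g" if "f \<in> Bij V" "g \<in> Bij V" for f g
    using that by (simp add: BijGroup_def)
  have B: "f v \<in> V" if "f \<in> Bij V" "v \<in> V" for f v using Bij_imp_funcset[OF that(1)] that(2) by blast
  show ?thesis
  proof (rule B.subgroupI)
    show "carrier (GL R K V) \<subseteq> carrier (BijGroup V)" by (auto simp: car BijGroup_def)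
    have "(\<lambda>x\<in>V. x) \<in> carrier (GL R K V)" by (auto simp: car id_Bij add smult)
    then show "carrier (GL R K V) \<noteq> {}" by blast
    fix f assume f: "f \<in> carrier (GL R K V)"
    then have fB: "f \<in> Bij V" by (simp add: car)
    let ?i = "inv_into V f"
    have i: "?i v \<in> V" "f (?i v) = v" if "v \<in> V" for v
      using that fB Bij_inv_into_mem[OF fB that] by (auto simp: Bij_def bij_betw_def f_inv_into_f)
    have i': "?i (f v) = v" if "v \<in> V" for v
      using that fB by (simp add: Bij_def bij_betw_def)
    have "?i (u \<oplus>\<^bsub>R\<^esub> v) = ?i u \<oplus>\<^bsub>R\<^esub> ?i v" if "u \<in> V" "v \<in> V" for u v
    proof -
      have "f (?i u \<oplus>\<^bsub>R\<^esub> ?i v) = u \<oplus>\<^bsub>R\<^esub> v" using f i that by (simp add: car)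
      then show ?thesis using i'[of "?i u \<oplus>\<^bsub>R\<^esub> ?i v"] add i that by simp
    qed
    moreover have "?i (k \<otimes>\<^bsub>R\<^esub> v) = k \<otimes>\<^bsub>R\<^esub> ?i v" if "k \<in> K" "v \<in> V" for k v
    proof -
      have "f (k \<otimes>\<^bsub>R\<^esub> ?i v) = k \<otimes>\<^bsub>R\<^esub> v" using f i that by (simp add: car)
      then show ?thesis using i'[of "k \<otimes>\<^bsub>R\<^esub> ?i v"] smult i that by simp
    qed
    ultimately show "inv\<^bsub>BijGroup V\<^esub> f \<in> carrier (GL R K V)"
      using fB by (simp add: inv_BijGroup car restrict_inv_into_Bij add smult)
    fix g assume g: "g \<in> carrier (GL R K V)"
    then have gB: "g \<in> Bij V" by (simp add: car)
    show "f \<otimes>\<^bsub>BijGroup V\<^esub> g \<in> carrier (GL R K V)"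
      unfolding m[OF fB gB] using f g B[OF gB] compose_Bij[OF fB gB] by (simp add: car compose_def add smult)
  qed
qed

lemma group_GL:
  assumes "ring R" "V \<subseteq> carrier R"
    and "\<And>u v. u \<in> V \<Longrightarrow> v \<in> V \<Longrightarrow> u \<oplus>\<^bsub>R\<^esub> v \<in> V"
    and "\<And>k v. k \<in> K \<Longrightarrow> v \<in> V \<Longrightarrow> k \<otimes>\<^bsub>R\<^esub> v \<in> V"
  shows "group (GL R K V)"
proof -
  have GL: "GL R K V = BijGroup V\<lparr>carrier := carrier (GL R K V)\<rparr>" by (simp add: GL_def)
  show ?thesis
    by (subst GL) (rule subgroup.subgroup_is_group[OF subgroup_GL[of R V K, OF assms] group_BijGroup])
qed

context monomial_action
begin

interpretation B: group "BijGroup (carrier R)" by (rule group_BijGroup)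

abbreviation W where "W \<equiv> linear_part V"
abbreviation GLW where "GLW \<equiv> GL R scalars W"
abbreviation Gr where "Gr \<equiv> BijGroup (carrier R)\<lparr>carrier := G\<rparr>"
abbreviation rst where "rst \<equiv> \<lambda>g. restrict g W"

lemma W_carrier: "v \<in> W \<Longrightarrow> v \<in> carrier R"
  by (simp add: linear_part_def)

lemma W_add: "u \<in> W \<Longrightarrow> v \<in> W \<Longrightarrow> u \<oplus> v \<in> W"
  by (auto simp: linear_part_def coef_add) (metis add.right_neutral)

lemma W_smult: "k \<in> scalars \<Longrightarrow> v \<in> W \<Longrightarrow> k \<otimes> v \<in> W"
  by (auto simp: linear_part_def scalars_def coef_scale)

lemma W_act: "g \<in> G \<Longrightarrow> v \<in> W \<Longrightarrow> g v \<in> W"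
  by (auto simp: linear_part_def coef_act)

lemma W_var: "i \<in> V \<Longrightarrow> mono 1 {#i#} \<in> W"
  by (auto simp: linear_part_def coef_mono)

interpretation GL: group GLW
  by (rule group_GL) (auto simp: W_carrier W_add W_smult intro: ring_axioms)

interpretation Gr: group Gr
  by (rule subgroup.subgroup_is_group[OF subgroup_G group_BijGroup])

lemma rst_Bij: "g \<in> G \<Longrightarrow> rst g \<in> Bij W"
  unfolding Bij_def
  by (auto simp: W_act W_carrier intro!: bij_betw_byWitness[where f' = "ginv g"])

lemma rst_GL: "g \<in> G \<Longrightarrow> rst g \<in> carrier GLW"
  using rst_Bij by (auto simp: GL_def W_add W_smult act_add act_mult W_carrier scalars_def)

lemma rst_hom: "rst \<in> hom Gr GLW"
proof (rule homI)
  fix g h assume "g \<in> carrier Gr" "h \<in> carrier Gr"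
  then have gh: "g \<in> G" "h \<in> G" by auto
  have "rst (g \<cdot> h) = compose W (rst g) (rst h)"
    using gh by (auto simp: compose_def W_act W_carrier intro!: restrict_ext)
  then show "rst (g \<otimes>\<^bsub>Gr\<^esub> h) = rst g \<otimes>\<^bsub>GLW\<^esub> rst h"
    using gh by (simp add: GL_def) (simp add: BijGroup_def rst_Bij)
qed (simp add: rst_GL)

interpretation hom: group_hom Gr GLW rst
  by unfold_locales (rule rst_hom)

lemma rst_inj: "inj_on rst G"
proof (rule inj_onI)
  fix g h assume gh: "g \<in> G" "h \<in> G" "rst g = rst h"
  have "\<chi> g i = \<chi> h i" if i: "i \<in> V" for i
  proof -
    have "g (mono 1 {#i#}) = h (mono 1 {#i#})" using fun_cong[OF gh(3), of "mono 1 {#i#}"] W_var[OF i] by simp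
    then have "coef (g (mono 1 {#i#})) {#i#} = coef (h (mono 1 {#i#})) {#i#}" by simp
    then show ?thesis using gh i by (simp add: coef_mono wt_single)
  qed
  then have "wt g \<alpha> = wt h \<alpha>" if "set_mset \<alpha> \<subseteq> V" for \<alpha>
    using that unfolding wt_def by (intro arg_cong[where f = prod_mset] image_mset_cong) blast
  then show "g = h" using gh by (intro wt_eqI)
qed

text \<open>A fixed vector has coefficient 0 at each variable whose eigenvalue is not 1. Two such
  variables would confine the hyperplane to a subspace of codimension two; a single one leaves the
  span of the other variables fixed.\<close>

lemma pseudo_reflection_iff:
  assumes V: "finite V" and g: "g \<in> G"
  shows "pseudo_reflection R scalars W (rst g) \<longleftrightarrow> g \<noteq> gone \<and> (\<exists>i\<in>V. \<forall>j\<in>V - {i}. \<chi> g j = 1)"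
proof
  assume "pseudo_reflection R scalars W (rst g)"
  then obtain H m where H: "rst g \<noteq> \<one>\<^bsub>GLW\<^esub>" "H \<subseteq> W" "dimension m scalars H" "dimension (Suc m) scalars W"
    "\<And>v. v \<in> H \<Longrightarrow> rst g v = v" by (auto simp: pseudo_reflection_def hyperplane_def)
  have ne: "g \<noteq> gone" using H(1) hom.hom_one by auto
  have cV: "Suc m = card V" using dimension_is_inj[OF subfield_scalars H(4) dimension_vars[OF V]] by simp
  have "\<exists>i\<in>V. \<forall>j\<in>V - {i}. \<chi> g j = 1"
  proof (rule ccontr)
    assume *: "\<not> ?thesis"
    have "V \<noteq> {}" using cV by auto
    then obtain i where "i \<in> V" by blast
    then obtain j where j: "j \<in> V" "\<chi> g j \<noteq> 1" using * by blast
    then obtain k where k: "k \<in> V" "k \<noteq> j" "\<chi> g k \<noteq> 1" using * by blast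
    have "H \<subseteq> linear_part (V - {j, k})"
    proof
      fix v assume v: "v \<in> H"
      then have vW: "v \<in> W" "g v = v" using H(2) H(5)[OF v] by auto
      have "coef v {#l#} = 0" if "l \<in> V" "\<chi> g l \<noteq> 1" for l
      proof -
        have "wt g {#l#} * coef v {#l#} = coef v {#l#}"
          using coef_act[OF g W_carrier[OF vW(1)], of "{#l#}"] vW(2) by simp
        then show ?thesis using that by (simp add: wt_single)
      qed
      then show "v \<in> linear_part (V - {j, k})" using vW(1) j k by (fastforce simp: linear_part_def)
    qed
    moreover obtain Us where Us: "independent scalars Us" "length Us = m" "Span scalars Us = H" "set Us \<subseteq> carrier R"
      using exists_base[OF subfield_scalars H(3)] by blast
    moreover have "set Us \<subseteq> H" using Span_base_incl[OF subfield_scalars Us(4)] Us(3) by simp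
    ultimately have "m \<le> card (V - {j, k})"
      using independent_length_le_dimension[OF subfield_scalars dimension_vars[of "V - {j, k}"] Us(1)] V by auto
    moreover have "card (V - {j, k}) = card V - 2" using j k by (subst card_Diff_subset) auto
    \<comment> \<open>Subtraction of naturals is truncated, so \<open>card V - 2\<close> is
      informative only together with this lower bound on \<open>card V\<close>.\<close>
    moreover have "card {j, k} \<le> card V" using V j k by (intro card_mono) auto
    moreover have "card {j, k} = 2" using k by simp
    ultimately show False using cV by linarith
  qed
  then show "g \<noteq> gone \<and> (\<exists>i\<in>V. \<forall>j\<in>V - {i}. \<chi> g j = 1)" using ne by blast
next
  assume "g \<noteq> gone \<and> (\<exists>i\<in>V. \<forall>j\<in>V - {i}. \<chi> g j = 1)"
  then obtain i where ne: "g \<noteq> gone" and i: "i \<in> V" "\<And>j. j \<in> V - {i} \<Longrightarrow> \<chi> g j = 1" by blast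
  have "rst g \<noteq> \<one>\<^bsub>GLW\<^esub>"
  proof
    assume "rst g = \<one>\<^bsub>GLW\<^esub>"
    then have "rst g = rst gone" using hom.hom_one by simp
    then show False using ne g rst_inj by (auto dest: inj_onD)
  qed
  \<comment> \<open>The order of the finite group serves as the exponent.\<close>
  moreover have "\<exists>m::nat. m > 0 \<and> rst g [^]\<^bsub>GLW\<^esub> m = \<one>\<^bsub>GLW\<^esub>"
  proof (intro exI[of _ "card G"] conjI)
    show "card G > 0" using card_G by (metis gr0I of_nat_0)
    have "g [^]\<^bsub>Gr\<^esub> card G = \<one>\<^bsub>Gr\<^esub>" using Gr.pow_order_eq_1[of g] g finite_G by (simp add: Coset.order_def)
    then show "rst g [^]\<^bsub>GLW\<^esub> card G = \<one>\<^bsub>GLW\<^esub>" using hom.hom_nat_pow[of g "card G"] g hom.hom_one by simp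
  qed
  moreover have "hyperplane R scalars W (linear_part (V - {i}))"
  proof -
    have "dimension (Suc (card (V - {i}))) scalars W"
      using dimension_vars[OF V order_refl] i(1) V by (simp add: card_Suc_Diff1 del: card_Diff_insert)
    moreover have "dimension (card (V - {i})) scalars (linear_part (V - {i}))"
      using V by (intro dimension_vars) auto
    ultimately show ?thesis by (auto simp: hyperplane_def linear_part_def)
  qed
  moreover have "rst g v = v" if v: "v \<in> linear_part (V - {i})" for v
  proof -
    have vW: "v \<in> W" using v by (auto simp: linear_part_def)
    have "coef (g v) \<alpha> = coef v \<alpha>" for \<alpha>
    proof (cases "coef v \<alpha> = 0")
      case False
      then obtain j where "j \<in> V - {i}" "\<alpha> = {#j#}" using v by (auto simp: linear_part_def)
      then show ?thesis using i(2) g vW W_carrier by (simp add: coef_act wt_single)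
    qed (use g vW W_carrier in \<open>simp add: coef_act\<close>)
    then have "g v = v" using g vW W_carrier by (intro coef_eqI) auto
    then show ?thesis using vW by simp
  qed
  ultimately show "pseudo_reflection R scalars W (rst g)"
    using rst_GL[OF g] unfolding pseudo_reflection_def by blast
qed

theorem small_iff:
  assumes V: "finite V"
  shows "small R scalars W (rst ` G) \<longleftrightarrow> reflection_free"
proof -
  have "subgroup (rst ` G) GLW" using hom.img_is_subgroup by simp
  moreover have "finite (rst ` G)" using finite_G by simp
  ultimately show ?thesis
    unfolding small_def reflection_free_def using pseudo_reflection_iff[OF V] by blast
qed

end

section \<open>The theorem for skew polynomial rings\<close>

lemma subgroup_sp_auts: "subgroup (sp_auts n p) (BijGroup (carrier (sp_ring n p)))"
proof -
  let ?R = "sp_ring n p" and ?C = "carrier (sp_ring n p)"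
  interpret R: ring ?R by (rule ring_sp_ring)
  interpret B: group "BijGroup ?C" by (rule group_BijGroup)
  have const: "sp_const n p c \<in> ?C" for c
    by (auto simp: sp_const_def free_const_def sp_ring_carrier)
  show ?thesis
  proof (rule B.subgroupI)
    show "sp_auts n p \<subseteq> carrier (BijGroup ?C)" by (auto simp: sp_auts_def BijGroup_def)
    have "(\<lambda>x\<in>?C. x) \<in> sp_auts n p"
      by (auto simp: sp_auts_def id_Bij const intro!: ring_hom_memI)
    then show "sp_auts n p \<noteq> {}" by blast
    fix f assume "f \<in> sp_auts n p"
    then have f: "f \<in> Bij ?C" "f \<in> ring_hom ?R ?R" "\<And>c. f (sp_const n p c) = sp_const n p c" by (auto simp: sp_auts_def)
    let ?i = "inv_into ?C f"
    have inj: "inj_on f ?C" using f(1) by (simp add: Bij_def bij_betw_def)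
    have i: "?i x \<in> ?C" "f (?i x) = x" if "x \<in> ?C" for x
      using that f(1) Bij_inv_into_mem[OF f(1) that] by (auto simp: Bij_def bij_betw_def f_inv_into_f)
    have i': "?i x = y" if "y \<in> ?C" "f y = x" for x y
      using inv_into_f_f[OF inj that(1)] that(2) by simp
    have "restrict ?i ?C \<in> ring_hom ?R ?R"
      by (rule ring_hom_memI)
        (use i ring_hom_mult[OF f(2)] ring_hom_add[OF f(2)] ring_hom_one[OF f(2)] in \<open>auto intro!: i'\<close>)
    moreover have "?i (sp_const n p c) = sp_const n p c" for c by (rule i'[OF const f(3)])
    ultimately show "inv\<^bsub>BijGroup ?C\<^esub> f \<in> sp_auts n p"
      using f(1) const by (simp add: inv_BijGroup sp_auts_def restrict_inv_into_Bij)
    fix g assume "g \<in> sp_auts n p"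
    then have g: "g \<in> Bij ?C" "g \<in> ring_hom ?R ?R" "\<And>c. g (sp_const n p c) = sp_const n p c" by (auto simp: sp_auts_def)
    have "compose ?C f g \<in> ring_hom ?R ?R"
      using ring_hom_closed[OF f(2)] ring_hom_closed[OF g(2)] ring_hom_mult[OF f(2)] ring_hom_mult[OF g(2)]
        ring_hom_add[OF f(2)] ring_hom_add[OF g(2)] ring_hom_one[OF f(2)] ring_hom_one[OF g(2)]
      by (intro ring_hom_memI) (auto simp: compose_def)
    then show "f \<otimes>\<^bsub>BijGroup ?C\<^esub> g \<in> sp_auts n p"
      using f g const by (simp add: BijGroup_def sp_auts_def compose_Bij compose_eq)
  qed
qed

text \<open>The eigenvalue is defined as the coefficient of \<open>x_i\<close> in
  \<open>g x_i\<close>, so no choice is involved. Genericity diagonalizes the action on variables,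
  and multiplicativity carries this over to monomials.\<close>

lemma monomial_action_sp_ring:
  fixes p :: "nat \<Rightarrow> nat \<Rightarrow> 'k::field"
  assumes nz: "\<And>i j. 1 \<le> i \<Longrightarrow> i < j \<Longrightarrow> j \<le> n \<Longrightarrow> p i j \<noteq> 0"
    and generic: "sp_generic n p" and G: "subgroup G (sp_AutGroup n p)" "finite G"
    and card: "(of_nat (card G) :: 'k) \<noteq> 0"
  shows "monomial_action (sp_ring n p) {1..n} (sp_coef n p) (sp_mono n p) (bichar p) G
    (\<lambda>g i. sp_coef n p (g (sp_var n p i)) {#i#})"
proof -
  interpret M: monomial_ring "sp_ring n p" "{1..n}" "sp_coef n p" "sp_mono n p" "bichar p"
    by (rule monomial_ring_sp_ring[OF nz])
  let ?\<chi> = "\<lambda>g i. sp_coef n p (g (sp_var n p i)) {#i#}"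
  have auts: "g \<in> sp_auts n p" if "g \<in> G" for g
    using subgroup.subset[OF G(1)] that by (auto simp: sp_AutGroup_def)
  have hom: "g \<in> ring_hom (sp_ring n p) (sp_ring n p)" if "g \<in> G" for g
    using auts[OF that] by (simp add: sp_auts_def)
  have var: "g (sp_mono n p 1 {#i#}) = sp_mono n p (?\<chi> g i) {#i#}" if g: "g \<in> G" and i: "i \<in> {1..n}" for g i
  proof -
    obtain a where a: "g (sp_var n p i) = sp_const n p a \<otimes>\<^bsub>sp_ring n p\<^esub> sp_var n p i"
      using generic auts[OF g] i unfolding sp_generic_def by blast
    have "g (sp_mono n p 1 {#i#}) = sp_mono n p a {#i#}"
      using a i by (simp add: sp_var_mono sp_const_mono M.mono_scale)
    then show ?thesis using i by (simp add: sp_var_mono M.coef_mono)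
  qed
  have act: "g (sp_mono n p c \<alpha>) = sp_mono n p (c * (\<Prod>i\<in>#\<alpha>. ?\<chi> g i)) \<alpha>"
    if g: "g \<in> G" and \<alpha>: "set_mset \<alpha> \<subseteq> {1..n}" for g c \<alpha>
    using \<alpha>
  proof (induction \<alpha> arbitrary: c)
    case empty
    then show ?case using auts[OF g] by (simp add: sp_auts_def flip: sp_const_mono)
  next
    case (add i \<alpha>)
    then have i: "i \<in> {1..n}" and \<alpha>: "set_mset \<alpha> \<subseteq> {1..n}" and iV: "set_mset {#i#} \<subseteq> {1..n}" by auto
    let ?b = "bichar p \<alpha> {#i#}"
    have b: "?b \<noteq> 0" using M.b_nonzero[OF \<alpha> iV] .
    \<comment> \<open>Splitting off one variable produces a structure constant, which the scalar of
      the remaining monomial has to compensate.\<close>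
    have eq: "sp_mono n p d (add_mset i \<alpha>) = sp_mono n p (d / (e * ?b)) \<alpha> \<otimes>\<^bsub>sp_ring n p\<^esub> sp_mono n p e {#i#}"
      if "e \<noteq> 0" for d e
      using that b by (simp add: M.mono_mult[OF \<alpha> iV])
    have "g (sp_mono n p c (add_mset i \<alpha>)) = g (sp_mono n p (c / ?b) \<alpha>) \<otimes>\<^bsub>sp_ring n p\<^esub> g (sp_mono n p 1 {#i#})"
      unfolding eq[of 1 c, simplified] using M.mono_closed[OF \<alpha>] M.mono_closed[OF iV] by (simp add: ring_hom_mult[OF hom[OF g]])
    also have "\<dots> = sp_mono n p (c / ?b * (\<Prod>i\<in>#\<alpha>. ?\<chi> g i)) \<alpha> \<otimes>\<^bsub>sp_ring n p\<^esub> sp_mono n p (?\<chi> g i) {#i#}"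
      using add.IH[OF \<alpha>] var[OF g i] by simp
    also have "\<dots> = sp_mono n p (c * (\<Prod>i\<in>#add_mset i \<alpha>. ?\<chi> g i)) (add_mset i \<alpha>)"
      using b by (simp add: M.mono_mult[OF \<alpha> iV] mult_ac)
    finally show ?case .
  qed
  have "subgroup G (BijGroup (carrier (sp_ring n p)))"
    using group.incl_subgroup[OF group_BijGroup subgroup_sp_auts] G(1) by (simp add: sp_AutGroup_def)
  then show ?thesis
    by (intro monomial_action.intro monomial_action_axioms.intro M.monomial_ring_axioms G(2) card)
      ((rule hom act | assumption)+)
qed

text \<open>Independence of the variables shows that \<open>sp_V\<close> is the direct sum of the
  lines they span, and injectivity of restriction lets \<open>G\<close> be viewed inside
  \<open>GL\<close>. The three equivalent conditions are each compared with
  \<open>reflection_free\<close>.\<close>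

theorem theorem0p8:
  fixes n :: nat
    and p :: "nat \<Rightarrow> nat \<Rightarrow> 'k::field"
    and G :: "((fword \<Rightarrow>\<^sub>0 'k) set \<Rightarrow> (fword \<Rightarrow>\<^sub>0 'k) set) set"
  assumes "n \<ge> 2"
    and "\<And>i j. 1 \<le> i \<Longrightarrow> i < j \<Longrightarrow> j \<le> n \<Longrightarrow> p i j \<noteq> 0"
    and "sp_generic n p"
    and "subgroup G (sp_AutGroup n p)" and "finite G"
    and "(of_nat (card G) :: 'k) \<noteq> 0"
  shows "ring.independent (sp_ring n p) (sp_scalars n p) (sp_vars n p)
    \<and> (\<lambda>g. restrict g (sp_V n p)) \<in>
        hom (sp_AutGroup n p \<lparr>carrier := G\<rparr>) (GL (sp_ring n p) (sp_scalars n p) (sp_V n p))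
    \<and> inj_on (\<lambda>g. restrict g (sp_V n p)) G
    \<and> (small (sp_ring n p) (sp_scalars n p) (sp_V n p) ((\<lambda>g. restrict g (sp_V n p)) ` G)
        \<longleftrightarrow> homologically_small n p G)
    \<and> (homologically_small n p G \<longleftrightarrow> natural_map_graded_iso n p G)"
proof -
  interpret A: monomial_action "sp_ring n p" "{1..n}" "sp_coef n p" "sp_mono n p" "bichar p" G
    "\<lambda>g i. sp_coef n p (g (sp_var n p i)) {#i#}"
    by (rule monomial_action_sp_ring[OF assms(2-6)])
  have vars: "sp_vars n p = map (\<lambda>i. sp_mono n p 1 {#i#}) [1..<Suc n]"
    by (simp add: sp_vars_def sp_var_mono)
  have scalars: "sp_scalars n p = A.scalars"
    by (simp add: sp_scalars_def A.scalars_def sp_const_mono)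
  have set: "set [1..<Suc n] = {1..n}" by auto
  have V: "sp_V n p = A.linear_part {1..n}"
    unfolding sp_V_def vars scalars using A.Span_vars[of "[1..<Suc n]"] by (simp only: set order_refl)
  have "ring.independent (sp_ring n p) (sp_scalars n p) (sp_vars n p)"
    unfolding vars scalars by (rule A.independent_vars) auto
  moreover have "(\<lambda>g. restrict g (sp_V n p)) \<in>
      hom (sp_AutGroup n p \<lparr>carrier := G\<rparr>) (GL (sp_ring n p) (sp_scalars n p) (sp_V n p))"
    using A.rst_hom by (simp add: V scalars sp_AutGroup_def)
  moreover have "inj_on (\<lambda>g. restrict g (sp_V n p)) G"
    using A.rst_inj by (simp add: V)
  moreover have "small (sp_ring n p) (sp_scalars n p) (sp_V n p) ((\<lambda>g. restrict g (sp_V n p)) ` G)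
      \<longleftrightarrow> A.reflection_free"
    unfolding V scalars by (rule A.small_iff) simp
  moreover have "homologically_small n p G \<longleftrightarrow> A.reflection_free"
  proof -
    have "averaging_ideal n p G = A.J" by (simp add: averaging_ideal_def A.J_def sp_const_mono)
    then show ?thesis
      unfolding homologically_small_def Let_def using A.homologically_small_iff by simp
  qed
  moreover have "natural_map_graded_iso n p G \<longleftrightarrow> A.reflection_free"
  proof -
    have "sp_degree n p = A.hom_part" by (intro ext) (simp add: sp_degree_eq A.hom_part_def)
    then show ?thesis
      unfolding natural_map_graded_iso_def Let_def using A.natural_map_iso_iff by (simp add: sp_const_mono)
  qed
  ultimately show ?thesis by blast
qed

end
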